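(* Let $\tau\in\mathbb{H}$, $\gamma\in(0,2)$, $Q=\frac2\gamma+\frac\gamma2$, $\mu>0$, let $z_1,\dots,z_n\in\mathbb{T}$ be distinct points and $\alpha_1,\dots,\alpha_n\in\mathbb{R}$ with $\sum_i\alpha_i>0$ and $\alpha_i<Q$ for all $i$. The law of the couple Liouville field/measure is modular invariant: for every $\psi\in\mathcal{M}$, $\psi(z)=\frac{az+b}{cz+d}$, the law of $$\big(\phi_{\psi(\tau)},\,e^{\gamma\phi_{\psi(\tau)}}d\lambda_{\hat g_{\psi(\tau)}}\big)\quad\text{under }\mathbb{P}^{\gamma,\mu}_{(z_i,\alpha_i)_i,\hat g_{\psi(\tau)}}$$ is the same as the law of $$\big(\phi_\tau\circ\widetilde\psi+Q\ln|c\tau+d|,\ \widetilde\psi^{-1}*e^{\gamma\phi_\tau}d\lambda_{\hat g_\tau}\big)\quad\text{under }\mathbb{P}^{\gamma,\mu}_{(\widetilde\psi(z_i),\alpha_i)_i,\hat g_\tau}.$$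
   Context: $\mathbb{T}=\mathbb{R}^2/\mathbb{Z}^2$ with coordinates $x=(x_1,x_2)$ and Lebesgue measure $\lambda$; $\mathbb{H}=\{\tau\in\mathbb{C}:\mathrm{Im}\,\tau>0\}$. For $\tau\in\mathbb{H}$, $\hat g_\tau$ is the flat metric $|dx_1+\tau dx_2|^2$, with volume form $\lambda_\tau=\lambda_{\hat g_\tau}=\mathrm{Im}(\tau)\lambda$ and Laplacian $\triangle_\tau=\mathrm{Im}(\tau)^{-2}(|\tau|^2\partial_{11}-2\mathrm{Re}(\tau)\partial_{12}+\partial_{22})$. The modular group $\mathcal{M}$ consists of the maps $\psi(z)=\frac{az+b}{cz+d}$ of $\mathbb{H}$ with $a,b,c,d\in\mathbb{Z}$, $ad-bc=1$; $\widetilde\psi(x)=(dx_1+bx_2,cx_1+ax_2)$ is the associated map of $\mathbb{T}$, which is a biholomorphism $(\mathbb{T},\hat g_{\psi(\tau)})\to(\mathbb{T},\hat g_\tau)$, given by $z\mapsto(c\tau+d)z$ in the complex coordinates $x_1+\psi(\tau)x_2$ (source) and $x_1+\tau x_2$ (target). $f*m$ denotes the pushforward of a measure $m$ by $f$. Green function: $G_\tau(x,w)=G_\tau(x-w)$ solves $-\triangle_\tau G_\tau(w,\cdot)=2\pi(\delta_w-\frac1{\mathrm{Im}\,\tau})$, $\int_{\mathbb{T}}G_\tau(w,\cdot)d\lambda_\tau=0$, with $\delta_w$ the Dirac mass relative to $\lambda_\tau$. $X_\tau$ is the Gaussian Free Field: the centered Gaussian random element of $H^{-1}(\mathbb{T})$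 with covariance kernel $G_\tau(x-y)$; its circle average is $X_{\tau,\epsilon}(x)=\frac1{2\pi}\int_0^{2\pi}X_\tau(x+c_\tau(\epsilon e^{i\theta}))d\theta$ with $c_\tau(z)=\big(\mathrm{Re}\,z-\frac{\mathrm{Re}\,\tau}{\mathrm{Im}\,\tau}\mathrm{Im}\,z,\frac{\mathrm{Im}\,z}{\mathrm{Im}\,\tau}\big)$. $M_{\gamma,\tau}$ is the limit in probability (weak convergence of measures) of $\epsilon^{\gamma^2/2}e^{\gamma(X_{\tau,\epsilon}-\frac Q2\ln\mathrm{Im}\,\tau)}d\lambda_\tau$ as $\epsilon\to0$. $\eta(\tau)=q^{1/12}\prod_{n\ge1}(1-q^{2n})$, $q=e^{i\pi\tau}$; $\Theta(\tau)=-\ln2\pi-2\ln|\eta(\tau)|$; $Z^{\mathrm{FF}}(\hat g_\tau)=\frac1{\sqrt{\mathrm{Im}\,\tau}|\eta(\tau)|^2}$. $M_+(\mathbb{T})$ is the space of positive measures on $\mathbb{T}$ with the weak topology. For bounded measurable $F:H^{-1}(\mathbb{T})\times M_+(\mathbb{T})\to\mathbb{R}$ set $$\Pi_{\gamma,\mu}^{(z_i,\alpha_i)_i}(\hat g_\tau,F)=Z^{\mathrm{FF}}(\hat g_\tau)e^{C_\tau(\mathbf z)}\int_{\mathbb{R}}e^{c\sum_i\alpha_i}\mathbb{E}\Big[F\big(c+X_\tau+H_\tau-\tfrac Q2\ln\mathrm{Im}\,\tau,\ e^{\gamma c}e^{\gamma H_\tau}dM_{\gamma,\tau}\big)e^{-\mu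 e^{\gamma c}\int_{\mathbb{T}}e^{\gamma H_\tau}dM_{\gamma,\tau}}\Big]dc,$$ with $H_\tau(x)=\sum_i\alpha_iG_\tau(x-z_i)$ and $C_\tau(\mathbf z)=\sum_{i<j}\alpha_i\alpha_jG_\tau(z_i-z_j)+\frac{\Theta(\tau)}2\sum_i\alpha_i^2-\frac Q2\ln\mathrm{Im}(\tau)\sum_i\alpha_i$. The couple (Liouville field, Liouville measure) $(\phi_\tau,e^{\gamma\phi_\tau}d\lambda_{\hat g_\tau})$ is the random element of $H^{-1}(\mathbb{T})\times M_+(\mathbb{T})$ whose law $\mathbb{P}^{\gamma,\mu}_{(z_i,\alpha_i)_i,\hat g_\tau}$ is given by $\mathbb{E}^{\gamma,\mu}_{(z_i,\alpha_i)_i,\hat g_\tau}[F]=\Pi_{\gamma,\mu}^{(z_i,\alpha_i)_i}(\hat g_\tau,F)/\Pi_{\gamma,\mu}^{(z_i,\alpha_i)_i}(\hat g_\tau,1)$. *)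

theory Defs
  imports "HOL-Probability.Probability"
begin

section \<open>The torus\<close>

definition torus_rel :: "real \<times> real \<Rightarrow> real \<times> real \<Rightarrow> bool" where
  "torus_rel x y \<longleftrightarrow> fst x - fst y \<in> \<int> \<and> snd x - snd y \<in> \<int>"

lemma Ints_minus_swap: "(a::real) - b \<in> \<int> \<Longrightarrow> b - a \<in> \<int>"
  using Ints_minus[of "a - b"] by simp

quotient_type torus = "real \<times> real" / torus_rel
proof (rule equivpI)
  show "reflp torus_rel"
    by (auto simp: reflp_def torus_rel_def)
  show "symp torus_rel"
    by (auto simp: symp_def torus_rel_def intro: Ints_minus_swap)
  show "transp torus_rel"
  proof (rule transpI)
    fix x y z assume "torus_rel x y" "torus_rel y z"
    then show "torus_rel x z"
      using Ints_add[of "fst x - fst y" "fst y - fst z"] Ints_add[of "snd x - snd y" "snd y - snd z"]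
      by (simp add: torus_rel_def)
  qed
qed

instantiation torus :: ab_group_add
begin

lift_definition zero_torus :: torus is "0 :: real \<times> real" .

lift_definition plus_torus :: "torus \<Rightarrow> torus \<Rightarrow> torus" is "(+)"
proof -
  fix p1 p2 p3 p4 :: "real \<times> real"
  assume a: "torus_rel p1 p2" "torus_rel p3 p4"
  have "fst (p1 + p3) - fst (p2 + p4) = (fst p1 - fst p2) + (fst p3 - fst p4)"
    "snd (p1 + p3) - snd (p2 + p4) = (snd p1 - snd p2) + (snd p3 - snd p4)" by auto
  then show "torus_rel (p1 + p3) (p2 + p4)"
    using a by (simp only: torus_rel_def Ints_add simp_thms)
qed

lift_definition uminus_torus :: "torus \<Rightarrow> torus" is uminus
  unfolding torus_rel_def
  by (simp add: Ints_minus_swap)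

lift_definition minus_torus :: "torus \<Rightarrow> torus \<Rightarrow> torus" is "(-)"
proof -
  fix p1 p2 p3 p4 :: "real \<times> real"
  assume a: "torus_rel p1 p2" "torus_rel p3 p4"
  have "fst (p1 - p3) - fst (p2 - p4) = (fst p1 - fst p2) - (fst p3 - fst p4)"
    "snd (p1 - p3) - snd (p2 - p4) = (snd p1 - snd p2) - (snd p3 - snd p4)" by auto
  then show "torus_rel (p1 - p3) (p2 - p4)"
    using a by (simp only: torus_rel_def Ints_diff simp_thms)
qed

instance
  by standard (transfer; simp add: torus_rel_def)+

end

lift_definition torus_map :: "int \<Rightarrow> int \<Rightarrow> int \<Rightarrow> int \<Rightarrow> torus \<Rightarrow> torus" is
  "\<lambda>a b c d (x1, x2). (of_int d * x1 + of_int b * x2, of_int c * x1 + of_int a * x2)"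
proof -
  fix a b c d :: int and p q :: "real \<times> real"
  assume "torus_rel p q"
  then have *: "fst p - fst q \<in> \<int>" "snd p - snd q \<in> \<int>" by (auto simp: torus_rel_def)
  have "real_of_int k * (fst p - fst q) + real_of_int l * (snd p - snd q) \<in> \<int>" for k l
    using * by auto
  from this[of d b] this[of c a]
  show "torus_rel (case p of (x1, x2) \<Rightarrow> (of_int d * x1 + of_int b * x2, of_int c * x1 + of_int a * x2))
    (case q of (x1, x2) \<Rightarrow> (of_int d * x1 + of_int b * x2, of_int c * x1 + of_int a * x2))"
    by (cases p; cases q) (simp add: torus_rel_def algebra_simps)
qed

text \<open>The quotient topology.\<close>

instantiation torus :: topological_space
begin

definition open_torus :: "torus set \<Rightarrow> bool" where
  "open_torus U \<longleftrightarrow> open (abs_torus -` U)"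

instance
proof
  show "open (UNIV :: torus set)"
    by (simp add: open_torus_def)
  show "open (S \<inter> T)" if "open S" "open T" for S T :: "torus set"
    using that by (simp add: open_torus_def vimage_Int open_Int)
  show "open (\<Union>K)" if "\<forall>S\<in>K. open S" for K :: "torus set set"
    using that by (auto simp: open_torus_def vimage_Union)
qed

end

lemma torus_cases:
  obtains p where "x = abs_torus p"
proof -
  have "\<exists>p. x = abs_torus p"
    by (induct x rule: torus.abs_induct) blast
  then show ?thesis using that by blast
qed

lemma continuous_abs_torus: "continuous_on UNIV abs_torus"
  by (simp add: continuous_on_open_vimage open_torus_def)

definition torus_lebesgue :: "torus measure" where
  "torus_lebesgue = distr (restrict_space lborel ({0..<1} \<times> {0..<1})) borel abs_torus"

definition torus_vol :: "complex \<Rightarrow> torus measure" where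
  "torus_vol \<tau> = scale_measure (ennreal (Im \<tau>)) torus_lebesgue"

section \<open>Smooth functions and the Laplacian\<close>

definition dirderiv :: "real \<times> real \<Rightarrow> (torus \<Rightarrow> real) \<Rightarrow> torus \<Rightarrow> real" where
  "dirderiv v f x = deriv (\<lambda>t. f (x + abs_torus (t *\<^sub>R v))) 0"

text \<open>The functions all of whose iterated directional derivatives exist and are continuous,
  that is, the space \<open>C\<^sup>\<infinity>\<close>.\<close>

coinductive smooth :: "(torus \<Rightarrow> real) \<Rightarrow> bool" where
  smooth: "continuous_on UNIV f \<Longrightarrow>
    (\<And>v x. (\<lambda>t. f (x + abs_torus (t *\<^sub>R v))) differentiable at 0) \<Longrightarrow>
    (\<And>v. smooth (dirderiv v f)) \<Longrightarrow> smooth f"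

definition laplace :: "complex \<Rightarrow> (torus \<Rightarrow> real) \<Rightarrow> torus \<Rightarrow> real" where
  "laplace \<tau> f x = ((cmod \<tau>)\<^sup>2 * dirderiv (1,0) (dirderiv (1,0) f) x
      - 2 * Re \<tau> * dirderiv (1,0) (dirderiv (0,1) f) x
      + dirderiv (0,1) (dirderiv (0,1) f) x) / (Im \<tau>)\<^sup>2"

lemma DERIV_dirderiv:
  assumes "smooth f"
  shows "((\<lambda>t. f (x + abs_torus (t *\<^sub>R v))) has_real_derivative dirderiv v f x) (at 0)"
  using assms unfolding dirderiv_def
  by (cases rule: smooth.cases) (simp add: DERIV_deriv_iff_real_differentiable)

lemma smooth_continuous: "smooth f \<Longrightarrow> continuous_on UNIV f"
  by (erule smooth.cases) auto

lemma smooth_dirderiv: "smooth f \<Longrightarrow> smooth (dirderiv v f)"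
  by (erule smooth.cases) auto

lemma dirderiv_lincomb:
  assumes "smooth f" "smooth g"
  shows "dirderiv v (\<lambda>x. r * f x + s * g x) = (\<lambda>x. r * dirderiv v f x + s * dirderiv v g x)"
proof
  fix x
  show "dirderiv v (\<lambda>x. r * f x + s * g x) x = r * dirderiv v f x + s * dirderiv v g x"
    unfolding dirderiv_def[of v "\<lambda>x. r * f x + s * g x"]
    by (rule DERIV_imp_deriv) (intro DERIV_add DERIV_cmult DERIV_dirderiv assms)
qed

lemma smooth_lincomb:
  assumes "smooth f" "smooth g"
  shows "smooth (\<lambda>x. r * f x + s * g x)"
proof -
  have "\<exists>f g. smooth f \<and> smooth g \<and> (\<lambda>x. r * f x + s * g x) = (\<lambda>x. r * f x + s * g x)"
    using assms by blast
  then have "\<exists>f' g'. smooth f' \<and> smooth g' \<and> (\<lambda>x. r * f x + s * g x) = (\<lambda>x. r * f' x + s * g' x)"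
    using assms by blast
  then show ?thesis
  proof (coinduction arbitrary: f g rule: smooth.coinduct)
    case smooth
    then obtain f' g' where fg: "smooth f'" "smooth g'"
      "(\<lambda>x. r * f x + s * g x) = (\<lambda>x. r * f' x + s * g' x)" by blast
    have "continuous_on UNIV (\<lambda>x. r * f' x + s * g' x)"
      by (intro continuous_intros smooth_continuous fg)
    moreover have "(\<lambda>t. r * f' (x + abs_torus (t *\<^sub>R v)) + s * g' (x + abs_torus (t *\<^sub>R v)))
        differentiable at 0" for v x
      using DERIV_add[OF DERIV_cmult[OF DERIV_dirderiv[OF fg(1)]] DERIV_cmult[OF DERIV_dirderiv[OF fg(2)]]]
      unfolding real_differentiable_def by blast
    moreover note dirderiv_lincomb[OF fg(1,2)] smooth_dirderiv[OF fg(1)] smooth_dirderiv[OF fg(2)]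
    ultimately show ?case
      unfolding fg(3) by (auto intro!: exI)
  qed
qed

lemma smooth_const: "smooth (\<lambda>_. k)"
proof (coinduction arbitrary: k rule: smooth.coinduct)
  case smooth
  have "dirderiv v (\<lambda>_. k) = (\<lambda>_. 0)" for v
    by (rule ext) (simp add: dirderiv_def)
  then show ?case by auto
qed

lemma dirderiv_reflect:
  assumes "smooth f"
  shows "dirderiv v (\<lambda>w. f (y - w)) = (\<lambda>w. dirderiv (- v) f (y - w))"
proof
  fix w
  have "y - (w + abs_torus (t *\<^sub>R v)) = y - w + abs_torus (t *\<^sub>R (- v))" for t
    by (transfer, simp add: torus_rel_def)
  then show "dirderiv v (\<lambda>w. f (y - w)) w = dirderiv (- v) f (y - w)"
    by (simp only: dirderiv_def)
qed

lemma continuous_torus_reflect: "continuous_on UNIV (\<lambda>w. y - w :: torus)"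
proof -
  obtain p where y: "y = abs_torus p" by (rule torus_cases)
  have "abs_torus -` ((\<lambda>w. y - w) -` U) = (\<lambda>x. p - x) -` (abs_torus -` U)" for U
    by (auto simp: y minus_torus.abs_eq)
  moreover have "open ((\<lambda>x. p - x) -` W)" if "open W" for W :: "(real \<times> real) set"
    using that by (intro open_vimage) (auto intro!: continuous_intros)
  ultimately show ?thesis
    by (simp add: continuous_on_open_vimage open_torus_def)
qed

lemma smooth_reflect:
  assumes "smooth f"
  shows "smooth (\<lambda>w. f (y - w))"
  using assms
proof (coinduction arbitrary: f rule: smooth.coinduct)
  case smooth
  have "continuous_on UNIV (\<lambda>w. f (y - w))"
    using continuous_on_compose2[OF smooth_continuous[OF smooth] continuous_torus_reflect] by auto
  moreover have "(\<lambda>t. f (y - (x + abs_torus (t *\<^sub>R v)))) differentiable at 0" for v x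
  proof -
    have "y - (x + abs_torus (t *\<^sub>R v)) = y - x + abs_torus (t *\<^sub>R (- v))" for t
      by (transfer, simp add: torus_rel_def)
    then show ?thesis
      using DERIV_dirderiv[OF smooth, of "y - x" "- v"]
      by (simp only: real_differentiable_def) blast
  qed
  ultimately show ?case
    using dirderiv_reflect[OF smooth] smooth_dirderiv[OF smooth] by blast
qed

section \<open>The Sobolev space \<open>H\<^sup>-\<^sup>1\<close>\<close>

typedef test = "{f. smooth f}"
  morphisms test_fun Abs_test
  using smooth_const by auto

lifting_forget torus.lifting
setup_lifting type_definition_test

lemma abs_torus_measurable [measurable]: "abs_torus \<in> borel_measurable borel"
  by (rule borel_measurable_continuous_onI) (rule continuous_abs_torus)

lemma sets_torus_lebesgue [measurable_cong, simp]: "sets torus_lebesgue = sets borel"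
  by (simp add: torus_lebesgue_def)

lemma space_torus_lebesgue [simp]: "space torus_lebesgue = UNIV"
  by (simp add: torus_lebesgue_def)

lemma abs_torus_measurable_restrict:
  "abs_torus \<in> restrict_space lborel ({0..<1} \<times> {0..<1}) \<rightarrow>\<^sub>M borel"
  by (intro measurable_restrict_space1) simp

lemma abs_torus_unit_square:
  obtains p where "p \<in> {0..<1} \<times> {0..<1}" "abs_torus p = x"
proof -
  obtain q where x: "x = abs_torus q" by (rule torus_cases)
  have "torus_rel (frac (fst q), frac (snd q)) q"
    by (auto simp: torus_rel_def frac_def)
  then have "abs_torus (frac (fst q), frac (snd q)) = x"
    by (simp add: x torus.abs_eq_iff)
  then show ?thesis
    using that[of "(frac (fst q), frac (snd q))"] by (simp add: frac_ge_0 frac_lt_1)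
qed

lemma compact_torus: "compact (UNIV :: torus set)"
proof -
  have "compact (abs_torus ` ({0..1} \<times> {0..1}))"
    by (intro compact_continuous_image continuous_on_subset[OF continuous_abs_torus])
      (auto intro: compact_Times)
  moreover have "abs_torus ` ({0..1} \<times> {0..1}) = UNIV"
  proof (intro equalityI subsetI UNIV_I)
    fix x :: torus
    obtain p where "p \<in> {0..<1} \<times> {0..<1}" "abs_torus p = x" by (rule abs_torus_unit_square)
    then show "x \<in> abs_torus ` ({0..1} \<times> {0..1})"
      by (intro image_eqI[of _ _ p]) auto
  qed
  ultimately show ?thesis by simp
qed

lemma emeasure_unit_square: "emeasure lborel ({0..<1} \<times> {0..<1} :: (real \<times> real) set) = 1"
  by (subst lborel_prod[symmetric], subst lborel.emeasure_pair_measure_Times) auto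

lemma prob_space_torus_lebesgue: "prob_space torus_lebesgue"
  unfolding torus_lebesgue_def
proof (rule prob_space.prob_space_distr[OF _ abs_torus_measurable_restrict], rule prob_spaceI)
  have "({0..<1} \<times> {0..<1} :: (real \<times> real) set) \<in> sets borel"
    by (rule borel_Times) auto
  then show "emeasure (restrict_space lborel ({0..<1} \<times> {0..<1} :: (real \<times> real) set))
      (space (restrict_space lborel ({0..<1} \<times> {0..<1}))) = 1"
    by (simp add: emeasure_restrict_space space_restrict_space emeasure_unit_square)
qed

lemma integrable_torus_continuous:
  fixes f :: "torus \<Rightarrow> real"
  assumes "continuous_on UNIV f"
  shows "integrable torus_lebesgue f"
proof -
  interpret prob_space torus_lebesgue by (rule prob_space_torus_lebesgue)
  have "compact (range f)" by (rule compact_continuous_image[OF assms compact_torus])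
  then obtain B where "\<And>x. norm (f x) \<le> B"
    using compact_imp_bounded bounded_iff by (metis rangeI)
  moreover have "f \<in> borel_measurable torus_lebesgue"
    using borel_measurable_continuous_onI[OF assms] by simp
  ultimately show ?thesis
    by (intro integrable_const_bound[of _ B]) auto
qed

lemma torus_integral_eq_0:
  fixes f :: "torus \<Rightarrow> real"
  assumes cont: "continuous_on UNIV f" and nn: "\<And>x. 0 \<le> f x"
    and int: "(\<integral>x. f x \<partial>torus_lebesgue) = 0"
  shows "f x = 0"
proof (rule ccontr)
  assume ne: "f x \<noteq> 0"
  let ?Q = "{0..<1} \<times> {0..<1} :: (real \<times> real) set"
  have Q: "?Q \<in> sets borel" by (rule borel_Times) auto
  have meas: "f \<in> borel_measurable borel" using borel_measurable_continuous_onI[OF cont] .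
  have "AE y in torus_lebesgue. f y = 0"
    using integral_nonneg_eq_0_iff_AE[OF integrable_torus_continuous[OF cont]] nn int by simp
  then have "AE p in restrict_space lborel ?Q. f (abs_torus p) = 0"
    unfolding torus_lebesgue_def
    by (rule AE_distrD[OF abs_torus_measurable_restrict])
  then have AE: "AE p in lborel. p \<in> ?Q \<longrightarrow> f (abs_torus p) = 0"
    using Q by (subst (asm) AE_restrict_space_iff) auto
  have cont': "continuous_on UNIV (\<lambda>p. f (abs_torus p))"
    using continuous_on_compose2[OF cont continuous_abs_torus] by auto
  obtain p where p: "p \<in> ?Q" "abs_torus p = x" by (rule abs_torus_unit_square)
  define U where "U = {q. f (abs_torus q) \<noteq> 0}"
  have "U = (\<lambda>q. f (abs_torus q)) -` (- {0})" by (auto simp: U_def)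
  then have U: "open U" using open_vimage[OF _ cont', of "- {0}"] by auto
  have pU: "p \<in> U" using p ne by (simp add: U_def)
  have "p \<in> closure ({0<..<1} \<times> {0<..<1})"
    using p by (auto simp: closure_Times closure_greaterThanLessThan)
  then have ne': "U \<inter> ({0<..<1} \<times> {0<..<1}) \<noteq> {}"
    using U pU by (metis closure_iff_nhds_not_empty subset_refl inf_commute)
  have op: "open (U \<inter> ({0<..<1} \<times> {0<..<1}))"
    using U by (intro open_Int open_Times) auto
  have "U \<inter> ({0<..<1} \<times> {0<..<1}) \<in> null_sets lborel"
  proof (rule AE_iff_null_sets[THEN iffD2])
    show "U \<inter> ({0<..<1} \<times> {0<..<1}) \<in> sets lborel" using op by simp
    show "AE p in lborel. p \<notin> U \<inter> ({0<..<1} \<times> {0<..<1})"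
      using AE by eventually_elim (auto simp: U_def)
  qed
  then have "negligible (U \<inter> ({0<..<1} \<times> {0<..<1}))"
    by (simp add: negligible_iff_null_sets null_sets_completionI)
  then show False
    using open_not_negligible[OF op ne'] by simp
qed

text \<open>The test functions carry the inner product of \<open>H\<^sup>1\<close>. They are dense in \<open>H\<^sup>1\<close>, so that their
  normed dual is the dual of \<open>H\<^sup>1\<close>.\<close>

instantiation test :: real_inner
begin

lift_definition zero_test :: test is "\<lambda>_. 0" by (rule smooth_const)

lift_definition plus_test :: "test \<Rightarrow> test \<Rightarrow> test" is "\<lambda>f g x. f x + g x"
  using smooth_lincomb[where r = 1 and s = 1] by simp

lift_definition minus_test :: "test \<Rightarrow> test \<Rightarrow> test" is "\<lambda>f g x. f x - g x"
  using smooth_lincomb[where r = 1 and s = "-1"] by simp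

lift_definition uminus_test :: "test \<Rightarrow> test" is "\<lambda>f x. - f x"
  using smooth_lincomb[where r = "-1" and s = 0] by simp

lift_definition scaleR_test :: "real \<Rightarrow> test \<Rightarrow> test" is "\<lambda>r f x. r * f x"
  using smooth_lincomb[where s = 0] by simp

definition inner_test :: "test \<Rightarrow> test \<Rightarrow> real" where
  "inner_test f g = (\<integral>x. test_fun f x * test_fun g x
      + dirderiv (1,0) (test_fun f) x * dirderiv (1,0) (test_fun g) x
      + dirderiv (0,1) (test_fun f) x * dirderiv (0,1) (test_fun g) x \<partial>torus_lebesgue)"

definition norm_test :: "test \<Rightarrow> real" where
  "norm_test f = sqrt (inner f f)"

definition dist_test :: "test \<Rightarrow> test \<Rightarrow> real" where
  "dist_test f g = norm (f - g)"

definition sgn_test :: "test \<Rightarrow> test" where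
  "sgn_test f = inverse (norm f) *\<^sub>R f"

definition uniformity_test :: "(test \<times> test) filter" where
  "uniformity_test = (INF e\<in>{0<..}. principal {(f, g). dist f g < e})"

definition open_test :: "test set \<Rightarrow> bool" where
  "open_test U \<longleftrightarrow> (\<forall>f\<in>U. eventually (\<lambda>(f', g). f' = f \<longrightarrow> g \<in> U) uniformity)"

instance
proof
  have sm: "smooth (test_fun f)" for f using test_fun by auto
  have ct: "continuous_on UNIV (test_fun f)" "continuous_on UNIV (dirderiv v (test_fun f))" for f v
    using smooth_continuous sm smooth_dirderiv by blast+
  let ?i = "\<lambda>f g x. test_fun f x * test_fun g x
      + dirderiv (1,0) (test_fun f) x * dirderiv (1,0) (test_fun g) x
      + dirderiv (0,1) (test_fun f) x * dirderiv (0,1) (test_fun g) x"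
  have ci: "continuous_on UNIV (?i f g)" for f g
    by (intro continuous_intros ct)
  note ii = integrable_torus_continuous[OF ci]
  fix f g h :: test and r s :: real
  show "f + g + h = f + (g + h)" "f + g = g + f" "0 + f = f" "- f + f = 0" "f - g = f + - g"
    "r *\<^sub>R (f + g) = r *\<^sub>R f + r *\<^sub>R g" "(r + s) *\<^sub>R f = r *\<^sub>R f + s *\<^sub>R f"
    "r *\<^sub>R s *\<^sub>R f = (r * s) *\<^sub>R f" "1 *\<^sub>R f = f"
    by (transfer; simp add: algebra_simps fun_eq_iff)+
  show "dist f g = norm (f - g)" by (rule dist_test_def)
  show "sgn f = inverse (norm f) *\<^sub>R f" by (rule sgn_test_def)
  show "uniformity = (INF e\<in>{0<..}. principal {(f, g :: test). dist f g < e})"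
    by (rule uniformity_test_def)
  show "open U \<longleftrightarrow> (\<forall>f\<in>U. eventually (\<lambda>(f', g). f' = f \<longrightarrow> g \<in> U) uniformity)" for U :: "test set"
    by (rule open_test_def)
  show "norm f = sqrt (inner f f)" by (rule norm_test_def)
  show "inner f g = inner g f"
    by (simp add: inner_test_def mult.commute)
  have d_add: "dirderiv v (test_fun (f + g)) x = dirderiv v (test_fun f) x + dirderiv v (test_fun g) x" for v x
    using dirderiv_lincomb[OF sm sm, of v 1 f 1 g] by (simp add: plus_test.rep_eq)
  have d_scale: "dirderiv v (test_fun (r *\<^sub>R f)) x = r * dirderiv v (test_fun f) x" for v x
    using dirderiv_lincomb[OF sm sm, of v r f 0 f] by (simp add: scaleR_test.rep_eq)
  have "?i (f + g) h = (\<lambda>x. ?i f h x + ?i g h x)"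
    by (rule ext) (simp only: d_add, simp add: plus_test.rep_eq algebra_simps)
  then show "inner (f + g) h = inner f h + inner g h"
    unfolding inner_test_def using Bochner_Integration.integral_add[OF ii[of f h] ii[of g h]] by simp
  have "?i (r *\<^sub>R f) g = (\<lambda>x. r * ?i f g x)"
    by (rule ext) (simp only: d_scale, simp add: scaleR_test.rep_eq algebra_simps)
  then show "inner (r *\<^sub>R f) g = r * inner f g"
    unfolding inner_test_def by simp
  show "0 \<le> inner f f"
    unfolding inner_test_def by (rule Bochner_Integration.integral_nonneg) (intro add_nonneg_nonneg zero_le_square)
  show "inner f f = 0 \<longleftrightarrow> f = 0"
  proof
    assume "inner f f = 0"
    then have "?i f f x = 0" for x
      unfolding inner_test_def
      by (rule torus_integral_eq_0[OF ci, rotated]) (intro add_nonneg_nonneg zero_le_square)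
    then have "test_fun f x * test_fun f x = 0" for x
      using zero_le_square[of "test_fun f x"] zero_le_square[of "dirderiv (1,0) (test_fun f) x"]
        zero_le_square[of "dirderiv (0,1) (test_fun f) x"]
      by (metis add_nonneg_eq_0_iff add_nonneg_nonneg)
    then have "test_fun f = test_fun 0" by (auto simp: zero_test.rep_eq)
    then show "f = 0" by (simp add: test_fun_inject)
  next
    assume "f = 0"
    moreover have "dirderiv v (test_fun 0) = (\<lambda>_. 0)" for v
      by (rule ext) (simp add: dirderiv_def zero_test.rep_eq)
    ultimately show "inner f f = 0"
      by (simp add: inner_test_def zero_test.rep_eq)
  qed
qed

end

type_synonym hm1 = "test \<Rightarrow>\<^sub>L real"

text \<open>Functions act on test functions by integration against the Lebesgue measure
  \<open>\<lambda>\<close>, for every \<open>\<tau>\<close>. The value \<open>0\<close> is a convention for functions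
  that are not in \<open>H\<^sup>-\<^sup>1\<close>; those used below are square integrable.\<close>

definition fun_hm1 :: "(torus \<Rightarrow> real) \<Rightarrow> hm1" where
  "fun_hm1 h = (let u = \<lambda>f. \<integral>x. h x * test_fun f x \<partial>torus_lebesgue
     in if bounded_linear u then Blinfun u else 0)"

text \<open>Composition with a diffeomorphism \<open>T\<close> that preserves \<open>\<lambda>\<close>: for a function \<open>u\<close>,
  \<open>\<integral> (u \<circ> T) f d\<lambda> = \<integral> u (f \<circ> T\<^sup>-\<^sup>1) d\<lambda>\<close>.\<close>

definition hm1_comp :: "hm1 \<Rightarrow> (torus \<Rightarrow> torus) \<Rightarrow> hm1" where
  "hm1_comp u T = Blinfun (\<lambda>f. blinfun_apply u (Abs_test (test_fun f \<circ> inv T)))"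

section \<open>Finite positive measures with the weak topology\<close>

typedef fmeas = "{m :: torus measure. sets m = sets borel \<and> finite_measure m}"
  morphisms measure_of_fmeas Abs_fmeas
  by (rule exI[of _ "null_measure borel"]) (auto intro!: finite_measureI)

instantiation fmeas :: topological_space
begin

definition open_fmeas :: "fmeas set \<Rightarrow> bool" where
  "open_fmeas = generate_topology
     {{m. (\<integral>x. f x \<partial>measure_of_fmeas m) \<in> U} | (f :: torus \<Rightarrow> real) U.
        continuous_on UNIV f \<and> open U}"

instance
  by standard (auto simp: open_fmeas_def intro: generate_topology.intros)

end

text \<open>\<open>h dm\<close>, with the convention \<open>0\<close> if \<open>h\<close> is not \<open>m\<close>-integrable (below, an event of probability
  zero).\<close>

definition tilt :: "(torus \<Rightarrow> real) \<Rightarrow> fmeas \<Rightarrow> fmeas" where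
  "tilt h m = (let m' = density (measure_of_fmeas m) (\<lambda>x. ennreal (h x))
     in Abs_fmeas (if finite_measure m' then m' else null_measure borel))"

definition pushforward :: "(torus \<Rightarrow> torus) \<Rightarrow> fmeas \<Rightarrow> fmeas" where
  "pushforward T m = Abs_fmeas (distr (measure_of_fmeas m) borel T)"

section \<open>Green function, Gaussian Free Field and Gaussian multiplicative chaos\<close>

text \<open>\<open>G\<close> is the one-variable Green function. It is infinite at \<open>0\<close>; being real valued here, it is
  given the value \<open>0\<close> there.\<close>

definition green_function :: "complex \<Rightarrow> (torus \<Rightarrow> real) \<Rightarrow> bool" where
  "green_function \<tau> G \<longleftrightarrow>
     continuous_on (- {0}) G \<and> G 0 = 0 \<and> integrable (torus_vol \<tau>) G \<and>
     (\<forall>w. (\<integral>x. G (w - x) \<partial>torus_vol \<tau>) = 0) \<and>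
     (\<forall>w f. smooth f \<longrightarrow>
        (\<integral>x. G (w - x) * (- laplace \<tau> f x) \<partial>torus_vol \<tau>)
          = 2 * pi * (f w - 1 / Im \<tau> * (\<integral>x. f x \<partial>torus_vol \<tau>)))"

definition centered_gaussian :: "real \<Rightarrow> real measure" where
  "centered_gaussian v =
     (if v = 0 then return borel 0 else density lborel (normal_density 0 (sqrt v)))"

definition gff :: "(torus \<Rightarrow> real) \<Rightarrow> 'a measure \<Rightarrow> ('a \<Rightarrow> hm1) \<Rightarrow> bool" where
  "gff G P X \<longleftrightarrow>
     prob_space P \<and> X \<in> P \<rightarrow>\<^sub>M borel \<and>
     (\<forall>f. \<exists>v\<ge>0. distr P borel (\<lambda>\<omega>. blinfun_apply (X \<omega>) f) = centered_gaussian v) \<and>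
     (\<forall>f g. (\<integral>\<omega>. blinfun_apply (X \<omega>) f * blinfun_apply (X \<omega>) g \<partial>P)
        = (\<integral>x. \<integral>y. test_fun f x * test_fun g y * G (x - y) \<partial>torus_lebesgue \<partial>torus_lebesgue))"

definition tendsto_in_prob ::
  "'a measure \<Rightarrow> ('i \<Rightarrow> 'a \<Rightarrow> real) \<Rightarrow> ('a \<Rightarrow> real) \<Rightarrow> 'i filter \<Rightarrow> bool" where
  "tendsto_in_prob P Y Z F \<longleftrightarrow>
     (\<forall>\<delta>>0. ((\<lambda>i. measure P {\<omega> \<in> space P. \<delta> < \<bar>Y i \<omega> - Z \<omega>\<bar>}) \<longlongrightarrow> 0) F)"

definition torus_coord :: "complex \<Rightarrow> complex \<Rightarrow> torus" where
  "torus_coord \<tau> z = abs_torus (Re z - Re \<tau> / Im \<tau> * Im z, Im z / Im \<tau>)"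

definition approx_identity :: "(nat \<Rightarrow> test) \<Rightarrow> bool" where
  "approx_identity \<rho> \<longleftrightarrow>
     (\<forall>k x. 0 \<le> test_fun (\<rho> k) x) \<and> (\<forall>k. (\<integral>x. test_fun (\<rho> k) x \<partial>torus_lebesgue) = 1) \<and>
     (\<forall>U. open U \<and> 0 \<in> U \<longrightarrow> (\<forall>\<^sub>F k in sequentially. \<forall>x. x \<notin> U \<longrightarrow> test_fun (\<rho> k) x = 0))"

lift_definition reflect_test :: "torus \<Rightarrow> test \<Rightarrow> test" is "\<lambda>y f w. f (y - w)"
  by (rule smooth_reflect)

definition hm1_convolve :: "hm1 \<Rightarrow> test \<Rightarrow> torus \<Rightarrow> real" where
  "hm1_convolve u \<rho> y = blinfun_apply u (reflect_test y \<rho>)"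

text \<open>A field in \<open>H\<^sup>-\<^sup>1\<close> has no values on a circle, so that the integral defining the circle average
  is the limit in probability of the averages of the mollified fields.\<close>

definition circle_average ::
  "complex \<Rightarrow> 'a measure \<Rightarrow> ('a \<Rightarrow> hm1) \<Rightarrow> real \<Rightarrow> torus \<Rightarrow> ('a \<Rightarrow> real) \<Rightarrow> bool" where
  "circle_average \<tau> P X \<epsilon> x Y \<longleftrightarrow>
     Y \<in> borel_measurable P \<and>
     (\<forall>\<rho>. approx_identity \<rho> \<longrightarrow>
        tendsto_in_prob P
          (\<lambda>k \<omega>. 1 / (2 * pi) *
             (LINT \<theta>:{0..2*pi}|lborel. hm1_convolve (X \<omega>) (\<rho> k) (x + torus_coord \<tau> (\<epsilon> * cis \<theta>))))
          Y sequentially)"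

definition liouville_Q :: "real \<Rightarrow> real" where
  "liouville_Q \<gamma> = 2 / \<gamma> + \<gamma> / 2"

text \<open>\<open>A \<epsilon> x\<close> is the version of the circle average that is continuous in \<open>x\<close>. Convergence
  in probability is with respect to the seminorms \<open>m \<mapsto> \<bar>\<integral> f dm\<bar>\<close>, \<open>f\<close> continuous,
  which generate the weak topology.\<close>

definition gmc :: "real \<Rightarrow> complex \<Rightarrow> 'a measure \<Rightarrow> ('a \<Rightarrow> hm1) \<Rightarrow> ('a \<Rightarrow> fmeas) \<Rightarrow> bool" where
  "gmc \<gamma> \<tau> P X M \<longleftrightarrow>
     M \<in> P \<rightarrow>\<^sub>M borel \<and>
     (\<exists>A. (\<forall>\<epsilon>>0. \<forall>x. circle_average \<tau> P X \<epsilon> x (A \<epsilon> x)) \<and>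
          (\<forall>\<epsilon>>0. \<forall>\<omega>\<in>space P. continuous_on UNIV (\<lambda>x. A \<epsilon> x \<omega>)) \<and>
          (\<forall>f. continuous_on UNIV f \<longrightarrow>
             tendsto_in_prob P
               (\<lambda>\<epsilon> \<omega>. \<integral>x. f x \<partial>density (torus_vol \<tau>)
                  (\<lambda>x. ennreal (\<epsilon> powr (\<gamma>\<^sup>2 / 2) *
                     exp (\<gamma> * (A \<epsilon> x \<omega> - liouville_Q \<gamma> / 2 * ln (Im \<tau>))))))
               (\<lambda>\<omega>. \<integral>x. f x \<partial>measure_of_fmeas (M \<omega>)) (at_right 0)))"

section \<open>The Liouville field and measure\<close>

definition dedekind_eta :: "complex \<Rightarrow> complex" where
  "dedekind_eta \<tau> = exp (\<i> * pi * \<tau> / 12) * (\<Prod>n. 1 - exp (\<i> * pi * \<tau>) ^ (2 * (n + 1)))"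

definition Theta :: "complex \<Rightarrow> real" where
  "Theta \<tau> = - ln (2 * pi) - 2 * ln (cmod (dedekind_eta \<tau>))"

definition Z_FF :: "complex \<Rightarrow> real" where
  "Z_FF \<tau> = 1 / (sqrt (Im \<tau>) * (cmod (dedekind_eta \<tau>))\<^sup>2)"

definition H_insert ::
  "(torus \<Rightarrow> real) \<Rightarrow> nat \<Rightarrow> (nat \<Rightarrow> torus) \<Rightarrow> (nat \<Rightarrow> real) \<Rightarrow> torus \<Rightarrow> real" where
  "H_insert G n z \<alpha> x = (\<Sum>i<n. \<alpha> i * G (x - z i))"

definition C_insert ::
  "real \<Rightarrow> complex \<Rightarrow> (torus \<Rightarrow> real) \<Rightarrow> nat \<Rightarrow> (nat \<Rightarrow> torus) \<Rightarrow> (nat \<Rightarrow> real) \<Rightarrow> real" where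
  "C_insert \<gamma> \<tau> G n z \<alpha> =
     (\<Sum>j<n. \<Sum>i<j. \<alpha> i * \<alpha> j * G (z i - z j)) + Theta \<tau> / 2 * (\<Sum>i<n. (\<alpha> i)\<^sup>2)
     - liouville_Q \<gamma> / 2 * ln (Im \<tau>) * (\<Sum>i<n. \<alpha> i)"

definition liouville_functional ::
  "real \<Rightarrow> real \<Rightarrow> complex \<Rightarrow> (torus \<Rightarrow> real) \<Rightarrow> 'a measure \<Rightarrow> ('a \<Rightarrow> hm1) \<Rightarrow> ('a \<Rightarrow> fmeas) \<Rightarrow>
   nat \<Rightarrow> (nat \<Rightarrow> torus) \<Rightarrow> (nat \<Rightarrow> real) \<Rightarrow> (hm1 \<times> fmeas \<Rightarrow> real) \<Rightarrow> real" where
  "liouville_functional \<gamma> \<mu> \<tau> G P X M n z \<alpha> F =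
     (let H = H_insert G n z \<alpha> in
      Z_FF \<tau> * exp (C_insert \<gamma> \<tau> G n z \<alpha>) *
      (\<integral>c. exp (c * (\<Sum>i<n. \<alpha> i)) *
         (\<integral>\<omega>. F (X \<omega> + fun_hm1 (\<lambda>x. c + H x - liouville_Q \<gamma> / 2 * ln (Im \<tau>)),
                tilt (\<lambda>x. exp (\<gamma> * c) * exp (\<gamma> * H x)) (M \<omega>)) *
              exp (- \<mu> * exp (\<gamma> * c) * (\<integral>x. exp (\<gamma> * H x) \<partial>measure_of_fmeas (M \<omega>))) \<partial>P) \<partial>lborel))"

text \<open>The law of the couple, determined by the expectation \<open>\<Pi>(F) / \<Pi>(1)\<close> of indicator
  functions \<open>F\<close>.\<close>

definition liouville_law ::
  "real \<Rightarrow> real \<Rightarrow> complex \<Rightarrow> (torus \<Rightarrow> real) \<Rightarrow> 'a measure \<Rightarrow> ('a \<Rightarrow> hm1) \<Rightarrow> ('a \<Rightarrow> fmeas) \<Rightarrow>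
   nat \<Rightarrow> (nat \<Rightarrow> torus) \<Rightarrow> (nat \<Rightarrow> real) \<Rightarrow> (hm1 \<times> fmeas) measure" where
  "liouville_law \<gamma> \<mu> \<tau> G P X M n z \<alpha> =
     measure_of UNIV (sets (borel \<Otimes>\<^sub>M borel))
       (\<lambda>S. ennreal (liouville_functional \<gamma> \<mu> \<tau> G P X M n z \<alpha> (indicator S)
          / liouville_functional \<gamma> \<mu> \<tau> G P X M n z \<alpha> (\<lambda>_. 1)))"

section \<open>The modular group\<close>

definition modular_map :: "int \<Rightarrow> int \<Rightarrow> int \<Rightarrow> int \<Rightarrow> complex \<Rightarrow> complex" where
  "modular_map a b c d \<tau> = (of_int a * \<tau> + of_int b) / (of_int c * \<tau> + of_int d)"

end

theory Submission
  imports Defs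
begin

text \<open>
  Let \<open>\<tau>' = \<psi>(\<tau>)\<close>, and let \<open>A\<close> be the unimodular map of the torus attached to \<open>\<psi>\<close>.
  In complex coordinates it is multiplication by \<open>c\<tau> + d\<close>, so it is a homothety from the flat torus of \<open>\<tau>'\<close> to the flat torus of \<open>\<tau>\<close>, and all
  ingredients of the Liouville law are covariant under it. The Green functions satisfy
  \<open>G' = G \<circ> A\<close>, because their Fourier coefficients are explicit and agree
  (\<open>green_function_modular_map\<close>). Hence \<open>X \<circ> A\<close> is a free field for \<open>\<tau>'\<close> (\<open>gff_modular_map\<close>).
  Circles are mapped to circles whose radius is multiplied by \<open>\<bar>c\<tau> + d\<bar>\<close> (\<open>circle_mean_hm1_comp\<close>);
  the powers of \<open>\<bar>c\<tau> + d\<bar>\<close> from the volume form, from the radius and from the curvature term cancel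
  because \<open>\<gamma> Q = 2 + \<gamma>\<^sup>2 / 2\<close>, so that the push-forward of the chaos measure by \<open>A\<^sup>-\<^sup>1\<close> is a chaos
  measure of \<open>X \<circ> A\<close> without any further factor (\<open>gmc_modular_map\<close>).

  The pair \<open>(X', M')\<close> and the pair \<open>(X \<circ> A, A\<^sup>-\<^sup>1 * M)\<close> live on different probability spaces and are
  only known to have the same defining properties. These determine the joint law
  (\<open>gff_gmc_law_unique\<close>): the law of the field is determined by its Gaussian one-dimensional
  marginals (\<open>hm1_measure_eqI\<close>), and the chaos measure is almost surely a measurable function of the
  field, the same one on both spaces, since it is a limit in probability of Riemann sums of circle
  averages, which in turn are limits of averages of the mollified field (\<open>gmc_common_version\<close>).
  The circle averages are pinned down by their defining property because approximate identities
  exist (\<open>approx_identity_exists\<close>). The Borel structures enter through separability: the Borel sets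
  of \<open>H\<^sup>-\<^sup>1\<close> are generated by the evaluations (\<open>borel_hm1_eq_cylinders\<close>), those of the space of
  measures by countably many integrals (\<open>borel_fmeas_coords\<close>).

  It remains to compare the two functionals for a fixed value of the zero mode
  (\<open>liouville_integrand_modular_map\<close>). This uses that the insertions \<open>H\<close> are elements of \<open>H\<^sup>-\<^sup>1\<close>, which
  follows from the square summability of the Fourier coefficients of the Green function
  (\<open>green_function_L2_bound\<close>). The prefactors are nonzero constants and cancel in the quotient that
  defines the law. The quotient is a measure for one law exactly if it is one for the other, because
  the transformation of pairs is a bimeasurable bijection, so that both sides are given by the same
  set function (\<open>measure_of_image\<close>).
\<close>

section \<open>Plane waves on the torus\<close>

text \<open>The phase puts sines and cosines into one family, and makes it stable under translations and
  directional derivatives.\<close>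

definition wave :: "int \<Rightarrow> int \<Rightarrow> real \<Rightarrow> torus \<Rightarrow> real" where
  "wave k l s x = (case rep_torus x of (x1, x2) \<Rightarrow> cos (2 * pi * (of_int k * x1 + of_int l * x2) + s))"

lemma cos_int_periodic: "u - v \<in> \<int> \<Longrightarrow> cos (2 * pi * u + s) = cos (2 * pi * v + s)"
proof -
  assume "u - v \<in> \<int>"
  then obtain n where n: "u = v + of_int n" by (metis Ints_cases add.commute diff_add_cancel)
  have "2 * pi * u + s = (2 * pi * v + s) + 2 * pi * of_int n"
    by (simp add: n algebra_simps)
  then show ?thesis
    by (simp only: cos_add[of "2 * pi * v + s"] cos_int_2pin sin_int_2pin mult_1_right
        mult_zero_right diff_0_right)
qed

lemma torus_rel_rep: "torus_rel (rep_torus (abs_torus p)) p"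
  by (metis torus.abs_eq_iff Quotient3_abs_rep Quotient3_torus)

lemma wave_abs:
  "wave k l s (abs_torus (x1, x2)) = cos (2 * pi * (of_int k * x1 + of_int l * x2) + s)"
proof -
  obtain y1 y2 where y: "rep_torus (abs_torus (x1, x2)) = (y1, y2)" by fastforce
  have "y1 - x1 \<in> \<int>" "y2 - x2 \<in> \<int>"
    using torus_rel_rep[of "(x1, x2)"] by (auto simp: y torus_rel_def)
  then have "of_int k * (y1 - x1) + of_int l * (y2 - x2) \<in> \<int>" by auto
  then have "(of_int k * y1 + of_int l * y2) - (of_int k * x1 + of_int l * x2) \<in> \<int>"
    by (simp add: algebra_simps)
  then show ?thesis by (simp add: wave_def y cos_int_periodic)
qed

lemma wave_abs': "wave k l s (abs_torus p) = cos (2 * pi * (of_int k * fst p + of_int l * snd p) + s)"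
  by (cases p) (simp add: wave_abs)

lemma continuous_on_torus_iff:
  fixes f :: "torus \<Rightarrow> 'a::topological_space"
  shows "continuous_on UNIV f \<longleftrightarrow> continuous_on UNIV (\<lambda>p. f (abs_torus p))"
proof
  show "continuous_on UNIV f \<Longrightarrow> continuous_on UNIV (\<lambda>p. f (abs_torus p))"
    using continuous_on_compose2[OF _ continuous_abs_torus] by auto
  assume *: "continuous_on UNIV (\<lambda>p. f (abs_torus p))"
  have "abs_torus -` (f -` U) = (\<lambda>p. f (abs_torus p)) -` U" for U by auto
  then show "continuous_on UNIV f"
    using * by (simp add: continuous_on_open_vimage open_torus_def)
qed

lemma continuous_wave [continuous_intros]: "continuous_on UNIV (wave k l s)"
  by (simp add: continuous_on_torus_iff wave_abs') (intro continuous_intros)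

lemma wave_bound: "\<bar>wave k l s x\<bar> \<le> 1"
  by (simp add: wave_def split: prod.split)

lemma wave_translate:
  "wave k l s (x + abs_torus (p1, p2)) = wave k l (s + 2 * pi * (of_int k * p1 + of_int l * p2)) x"
  by (rule torus_cases[of x]) (auto simp: wave_abs' plus_torus.abs_eq algebra_simps)

lemma wave_reflect: "wave k l s (- x) = wave (- k) (- l) s x"
  by (rule torus_cases[of x]) (auto simp: wave_abs' uminus_torus.abs_eq algebra_simps)

lemma wave_torus_map:
  "wave k l s (torus_map a b c d x) = wave (k * d + l * c) (k * b + l * a) s x"
proof (rule torus_cases[of x])
  fix p assume "x = abs_torus p"
  then show ?thesis
    by (cases p) (simp add: wave_abs torus_map.abs_eq algebra_simps)
qed

lemma wave_mult:
  "wave k l s x * wave k' l' s' x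
    = (wave (k + k') (l + l') (s + s') x + wave (k - k') (l - l') (s - s') x) / 2"
  by (rule torus_cases[of x]) (auto simp: wave_abs' cos_times_cos algebra_simps)

lemma wave_0: "wave 0 0 s x = cos s"
  by (simp add: wave_def split: prod.split)

lemma waves_separate:
  assumes "x \<noteq> y" shows "\<exists>k l s. wave k l s x \<noteq> wave k l s y"
proof (rule ccontr)
  assume *: "\<not> ?thesis"
  obtain p where x: "x = abs_torus p" by (rule torus_cases)
  obtain q where y: "y = abs_torus q" by (rule torus_cases)
  have "cos (2 * pi * (fst q) + s) = cos (2 * pi * fst p + s)"
    "cos (2 * pi * (snd q) + s) = cos (2 * pi * snd p + s)" for s
    using *[simplified, rule_format, of 1 0 s] *[simplified, rule_format, of 0 1 s]
    by (auto simp: x y wave_abs')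
  from this[of "- (2 * pi * fst q)"] this[of "- (2 * pi * snd q)"]
  have "cos (2 * pi * (fst p - fst q)) = 1" "cos (2 * pi * (snd p - snd q)) = 1"
    by (auto simp: algebra_simps)
  then have "fst p - fst q \<in> \<int>" "snd p - snd q \<in> \<int>"
    by (auto simp: cos_one_2pi_int mult.assoc)
  then show False using assms by (simp add: x y torus.abs_eq_iff torus_rel_def)
qed

instance torus :: t2_space
proof
  fix x y :: torus assume ne: "x \<noteq> y"
  then obtain k l s where *: "wave k l s x \<noteq> wave k l s y" using waves_separate by blast
  obtain U V where UV: "open U" "open V" "wave k l s x \<in> U" "wave k l s y \<in> V" "U \<inter> V = {}"
    using hausdorff[OF *] by blast
  have "open (wave k l s -` U)" "open (wave k l s -` V)"
    using UV open_vimage continuous_wave by blast+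
  then show "\<exists>U V. open U \<and> open V \<and> x \<in> U \<and> y \<in> V \<and> U \<inter> V = {}"
    using UV by (intro exI[of _ "wave k l s -` U"] exI[of _ "wave k l s -` V"]) auto
qed

definition trig :: "(real \<times> int \<times> int \<times> real) list \<Rightarrow> torus \<Rightarrow> real" where
  "trig cs x = (\<Sum>(r, k, l, s)\<leftarrow>cs. r * wave k l s x)"

lemma trig_Nil [simp]: "trig [] x = 0" by (simp add: trig_def)

lemma trig_Cons [simp]: "trig ((r, k, l, s) # cs) x = r * wave k l s x + trig cs x"
  by (simp add: trig_def)

lemma trig_append: "trig (cs @ ds) x = trig cs x + trig ds x"
  by (simp add: trig_def)

lemma continuous_trig [continuous_intros]: "continuous_on UNIV (trig cs)"
proof (induction cs)
  case Nil then show ?case by (simp add: trig_def)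
next
  case (Cons t cs)
  obtain r k l s where t: "t = (r, k, l, s)" by (cases t) auto
  have "trig (t # cs) = (\<lambda>x. r * wave k l s x + trig cs x)" by (rule ext) (simp add: t)
  then show ?case using Cons by (auto intro!: continuous_intros)
qed

lemma trig_mult_wave: "\<exists>ds. \<forall>x. trig ds x = r * wave k l s x * trig cs x"
proof (induction cs)
  case Nil then show ?case by (intro exI[of _ "[]"]) simp
next
  case (Cons t cs)
  obtain r' k' l' s' where t: "t = (r', k', l', s')" by (cases t) auto
  from Cons obtain ds where ds: "\<forall>x. trig ds x = r * wave k l s x * trig cs x" by blast
  have "trig ((r * r' / 2, k + k', l + l', s + s') # (r * r' / 2, k - k', l - l', s - s') # ds) x
      = r * wave k l s x * trig (t # cs) x" for x
  proof -
    have "r * wave k l s x * trig (t # cs) x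
      = r * r' * (wave k l s x * wave k' l' s' x) + r * wave k l s x * trig cs x"
      by (simp add: t algebra_simps)
    also have "\<dots> = trig ((r * r' / 2, k + k', l + l', s + s') # (r * r' / 2, k - k', l - l', s - s') # ds) x"
      unfolding wave_mult by (simp add: ds algebra_simps add_divide_distrib)
    finally show ?thesis by simp
  qed
  then show ?case by blast
qed

lemma trig_mult: "\<exists>ds. \<forall>x. trig ds x = trig bs x * trig cs x"
proof (induction bs)
  case Nil then show ?case by (intro exI[of _ "[]"]) simp
next
  case (Cons t bs)
  obtain r k l s where t: "t = (r, k, l, s)" by (cases t) auto
  obtain ds where ds: "\<forall>x. trig ds x = trig bs x * trig cs x" using Cons by blast
  obtain es where es: "\<forall>x. trig es x = r * wave k l s x * trig cs x"
    using trig_mult_wave by blast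
  have "trig (es @ ds) x = trig (t # bs) x * trig cs x" for x
    by (simp add: trig_append ds es t algebra_simps)
  then show ?case by blast
qed

text \<open>Stone--Weierstrass: the trigonometric polynomials form an algebra of continuous functions that
  separates the points of the compact torus.\<close>

lemma trig_dense:
  fixes f :: "torus \<Rightarrow> real"
  assumes "continuous_on UNIV f" and "0 < e"
  obtains cs where "\<And>x. \<bar>f x - trig cs x\<bar> < e"
proof -
  have "\<exists>g. (\<exists>cs. \<forall>x. g x = trig cs x) \<and> (\<forall>x\<in>UNIV. \<bar>f x - g x\<bar> < e)"
  proof (rule Stone_Weierstrass_HOL[OF compact_torus _ _ _ _ _ assms])
    show "\<exists>cs. \<forall>x. c = trig cs x" for c
      by (intro exI[of _ "[(c, 0, 0, 0)]"]) (simp add: wave_0)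
    show "continuous_on UNIV g" if "\<exists>cs. \<forall>x. g x = trig cs x" for g
    proof -
      from that obtain cs where "g = trig cs" by auto
      then show ?thesis using continuous_trig by simp
    qed
    show "\<exists>cs. \<forall>x. f x + g x = trig cs x"
      if "(\<exists>cs. \<forall>x. f x = trig cs x) \<and> (\<exists>cs. \<forall>x. g x = trig cs x)" for f g
    proof -
      from that obtain cs ds where "\<And>x. f x = trig cs x" "\<And>x. g x = trig ds x" by auto
      then show ?thesis by (intro exI[of _ "cs @ ds"]) (simp add: trig_append)
    qed
    show "\<exists>cs. \<forall>x. f x * g x = trig cs x"
      if "(\<exists>cs. \<forall>x. f x = trig cs x) \<and> (\<exists>cs. \<forall>x. g x = trig cs x)" for f g
      using that trig_mult by metis
    show "\<exists>f. (\<exists>cs. \<forall>x. f x = trig cs x) \<and> f x \<noteq> f y" if xy: "x \<in> UNIV \<and> y \<in> UNIV \<and> x \<noteq> y" for x y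
    proof -
      from xy waves_separate obtain k l s where *: "wave k l s x \<noteq> wave k l s y" by blast
      have "\<forall>x. wave k l s x = trig [(1, k, l, s)] x" by simp
      then show ?thesis using * by blast
    qed
  qed
  then show ?thesis using that by (metis UNIV_I)
qed

text \<open>Rational amplitudes and phases suffice for density; this is the separability of the space of
  continuous functions.\<close>

definition rat_trig :: "(rat \<times> int \<times> int \<times> rat) list \<Rightarrow> torus \<Rightarrow> real" where
  "rat_trig cs = trig (map (\<lambda>(r, k, l, s). (of_rat r, k, l, of_rat s)) cs)"

lemma continuous_rat_trig [continuous_intros]: "continuous_on UNIV (rat_trig cs)"
  unfolding rat_trig_def by (rule continuous_trig)

lemma wave_phase_diff: "\<bar>wave k l s x - wave k l s' x\<bar> \<le> \<bar>s - s'\<bar>"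
proof -
  have "\<bar>cos u - cos v\<bar> \<le> \<bar>u - v\<bar>" for u v :: real
  proof -
    have "\<bar>cos u - cos v\<bar> = 2 * (\<bar>sin ((u + v) / 2)\<bar> * \<bar>sin ((v - u) / 2)\<bar>)"
      by (simp add: cos_diff_cos abs_mult)
    also have "\<dots> \<le> 2 * (1 * \<bar>(v - u) / 2\<bar>)"
      by (intro mult_left_mono mult_mono abs_sin_le_one abs_sin_x_le_abs_x) auto
    finally show ?thesis by (simp add: abs_minus_commute)
  qed
  note this[of "2 * pi * (of_int k * fst (rep_torus x) + of_int l * snd (rep_torus x)) + s"
      "2 * pi * (of_int k * fst (rep_torus x) + of_int l * snd (rep_torus x)) + s'"]
  then show ?thesis
    by (simp add: wave_def case_prod_unfold)
qed

lemma rat_approx: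
  fixes r :: real assumes "0 < e" obtains q :: rat where "\<bar>r - of_rat q\<bar> < e"
proof -
  obtain q where "r - e < of_rat q" "of_rat q < r"
    using of_rat_dense[of "r - e" r] assms by auto
  then show ?thesis using that[of q] by auto
qed

lemma rat_trig_approx_trig:
  assumes "0 < e" shows "\<exists>ds. \<forall>x. \<bar>trig cs x - rat_trig ds x\<bar> < e"
  using assms
proof (induction cs arbitrary: e)
  case Nil then show ?case by (intro exI[of _ "[]"]) (simp add: rat_trig_def)
next
  case (Cons t cs)
  obtain r k l s where t: "t = (r, k, l, s)" by (cases t) auto
  obtain ds where ds: "\<And>x. \<bar>trig cs x - rat_trig ds x\<bar> < e / 3"
    using Cons(1)[of "e / 3"] Cons(2) by auto
  obtain r' where r': "\<bar>r - of_rat r'\<bar> < e / 3" using rat_approx[of "e / 3"] Cons(2) by auto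
  define b where "b = \<bar>real_of_rat r'\<bar> + 1"
  have b: "0 < b" "\<bar>real_of_rat r'\<bar> \<le> b" unfolding b_def by linarith+
  have "0 < e / 3 / b" using b Cons(2) by auto
  from rat_approx[OF this] obtain s' where s': "\<bar>s - of_rat s'\<bar> < e / 3 / b" by blast
  have "\<bar>trig (t # cs) x - rat_trig ((r', k, l, s') # ds) x\<bar> < e" for x
  proof -
    have "\<bar>(r - of_rat r') * wave k l s x\<bar> \<le> \<bar>r - of_rat r'\<bar> * 1"
      unfolding abs_mult by (intro mult_left_mono wave_bound) auto
    then have 1: "\<bar>(r - of_rat r') * wave k l s x\<bar> < e / 3" using r' by simp
    have "\<bar>of_rat r' * (wave k l s x - wave k l (of_rat s') x)\<bar> \<le> b * (e / 3 / b)"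
      unfolding abs_mult using b s' wave_phase_diff[of k l s x "of_rat s'"] Cons(2)
      by (intro mult_mono) auto
    then have 2: "\<bar>of_rat r' * (wave k l s x - wave k l (of_rat s') x)\<bar> \<le> e / 3" using b by simp
    have "\<bar>u + v + w\<bar> < e" if "\<bar>u\<bar> < e / 3" "\<bar>v\<bar> \<le> e / 3" "\<bar>w\<bar> < e / 3" for u v w
      using that by linarith
    from this[OF 1 2 ds[of x]] show ?thesis
      by (simp add: t rat_trig_def algebra_simps)
  qed
  then show ?case by blast
qed

lemma rat_trig_dense:
  fixes f :: "torus \<Rightarrow> real"
  assumes "continuous_on UNIV f" and "0 < e"
  obtains cs where "\<And>x. \<bar>f x - rat_trig cs x\<bar> < e"
proof -
  obtain cs where cs: "\<And>x. \<bar>f x - trig cs x\<bar> < e / 2"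
    using trig_dense[OF assms(1), of "e / 2"] assms(2) by auto
  obtain ds where ds: "\<And>x. \<bar>trig cs x - rat_trig ds x\<bar> < e / 2"
    using rat_trig_approx_trig[of "e / 2" cs] assms(2) by auto
  have "\<bar>f x - rat_trig ds x\<bar> < e" for x using cs[of x] ds[of x] by linarith
  then show ?thesis using that by blast
qed

section \<open>Measures on the torus are determined by their Fourier coefficients\<close>

lemma torus_continuous_bounded:
  fixes f :: "torus \<Rightarrow> real"
  assumes "continuous_on UNIV f"
  obtains B where "0 < B" "\<And>x. \<bar>f x\<bar> \<le> B"
proof -
  have "compact (range f)" by (rule compact_continuous_image[OF assms compact_torus])
  then obtain B where "\<And>x. norm (f x) \<le> B"
    using compact_imp_bounded bounded_iff by (metis rangeI)
  then have "\<bar>f x\<bar> \<le> \<bar>B\<bar> + 1" for x by (smt (verit) real_norm_def)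
  then show ?thesis using that[of "\<bar>B\<bar> + 1"] by auto
qed

lemma finite_measure_integrable_continuous:
  fixes f :: "torus \<Rightarrow> real"
  assumes "finite_measure M" "sets M = sets borel" "continuous_on UNIV f"
  shows "integrable M f"
proof -
  interpret finite_measure M by fact
  obtain B where "\<And>x. \<bar>f x\<bar> \<le> B" using torus_continuous_bounded[OF assms(3)] by blast
  moreover have "f \<in> borel_measurable M"
    using borel_measurable_continuous_onI[OF assms(3)] assms(2) measurable_cong_sets by blast
  ultimately show ?thesis by (intro integrable_const_bound[of _ B]) auto
qed

text \<open>Every open set is the set of positivity of a continuous function: the distance to the periodic
  complement in the plane is periodic.\<close>

lemma open_torus_cozero:
  fixes U :: "torus set"
  assumes "open U"
  obtains f :: "torus \<Rightarrow> real" where "continuous_on UNIV f" "\<forall>x. 0 \<le> f x" "U = {x. 0 < f x}"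
proof (cases "U = UNIV")
  case True
  then show ?thesis using that[of "\<lambda>_. 1"] by auto
next
  case False
  define K where "K = - (abs_torus -` U)"
  have K: "closed K" "K \<noteq> {}"
  proof -
    show "closed K" using assms by (simp add: K_def open_torus_def closed_def)
    obtain x where "x \<notin> U" using False by auto
    then show "K \<noteq> {}" unfolding K_def by (metis torus_cases ComplI empty_iff vimageD)
  qed
  define f where "f x = infdist (rep_torus x) K" for x
  have per: "infdist p K = infdist q K" if "torus_rel p q" for p q
  proof -
    have le: "infdist q K \<le> infdist p K" if pq: "torus_rel p q" for p q
    proof -
      obtain y where y: "y \<in> K" "infdist p K = dist p y"
        using infdist_attains_inf[OF K] by blast
      have "torus_rel (y + (q - p)) y"
        using pq by (auto simp: torus_rel_def intro: Ints_minus_swap)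
      then have "y + (q - p) \<in> K" using y by (simp add: K_def) (metis torus.abs_eq_iff)
      then have "infdist q K \<le> dist q (y + (q - p))" by (rule infdist_le)
      also have "\<dots> = dist p y" by (simp add: dist_norm norm_minus_commute algebra_simps)
      finally show ?thesis by (simp add: y)
    qed
    have "torus_rel q p" using that by (auto simp: torus_rel_def intro: Ints_minus_swap)
    then show ?thesis using le that by (meson order_antisym)
  qed
  have f: "f (abs_torus p) = infdist p K" for p
    unfolding f_def by (rule per) (rule torus_rel_rep)
  have "continuous_on UNIV f"
    by (simp add: continuous_on_torus_iff f) (intro continuous_intros)
  moreover have "U = {x. 0 < f x}"
  proof (rule set_eqI)
    fix x obtain p where x: "x = abs_torus p" by (rule torus_cases)
    have "p \<in> K \<longleftrightarrow> infdist p K = 0" using in_closed_iff_infdist_zero[OF K] .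
    then show "x \<in> U \<longleftrightarrow> x \<in> {x. 0 < f x}"
      using infdist_nonneg[of p K] by (auto simp: x f K_def order_less_le)
  qed
  moreover have "\<forall>x. 0 \<le> f x" by (simp add: f_def infdist_nonneg)
  ultimately show ?thesis using that by blast
qed

lemma cozero_indicator_limit:
  assumes "0 \<le> (t::real)"
  shows "(\<lambda>n. min 1 (real n * t)) \<longlonglongrightarrow> indicator {0<..} t"
proof (cases "t = 0")
  case False
  then have t: "0 < t" using assms by simp
  obtain N :: nat where N: "1 / t < real N" using reals_Archimedean2 by blast
  have "min 1 (real n * t) = 1" if "N \<le> n" for n
  proof -
    have "1 \<le> real N * t" using N t by (simp add: field_simps)
    also have "\<dots> \<le> real n * t" using that t by (simp add: mult_right_mono)
    finally show ?thesis by simp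
  qed
  then have "\<forall>\<^sub>F n in sequentially. min 1 (real n * t) = indicator {0<..} t"
    using t by (auto simp: eventually_sequentially)
  then show ?thesis by (rule tendsto_eventually)
qed simp

text \<open>Dominated convergence along the truncations of the multiples of \<open>f\<close>. With the preceding lemma this
  expresses the measure of an open set through integrals of continuous functions.\<close>

lemma tendsto_integral_cozero:
  fixes f :: "torus \<Rightarrow> real"
  assumes L: "finite_measure L" "sets L = sets borel" and f: "continuous_on UNIV f" "\<forall>x. 0 \<le> f x"
  shows "(\<lambda>n. \<integral>x. min 1 (real n * f x) \<partial>L) \<longlonglongrightarrow> measure L {x. 0 < f x}"
proof -
  interpret L: finite_measure L by fact
  have "continuous_on UNIV (\<lambda>x. min 1 (real n * f x))" for n by (intro continuous_intros f)
  then have gm: "(\<lambda>x. min 1 (real n * f x)) \<in> borel_measurable borel" for n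
    by (rule borel_measurable_continuous_onI)
  have "open {x. 0 < f x}"
    using open_vimage[OF open_greaterThan f(1), of 0] by (simp add: vimage_def)
  then have X: "{x. 0 < f x} \<in> sets borel" by (rule borel_open)
  have "(\<lambda>n. \<integral>x. min 1 (real n * f x) \<partial>L) \<longlonglongrightarrow> (\<integral>x. indicator {x. 0 < f x} x \<partial>L)"
  proof (rule integral_dominated_convergence[where w = "\<lambda>_. 1"])
    show "indicat_real {x. 0 < f x} \<in> borel_measurable L"
      "(\<lambda>x. min 1 (real n * f x)) \<in> borel_measurable L" for n
      using X gm L(2) by (auto cong: measurable_cong_sets)
    show "AE x in L. (\<lambda>n. min 1 (real n * f x)) \<longlonglongrightarrow> indicat_real {x. 0 < f x} x"
      using cozero_indicator_limit f(2) by (auto simp: indicator_def)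
    show "AE x in L. norm (min 1 (real n * f x)) \<le> 1" for n using f(2) by (auto simp: min_def)
  qed simp
  then show ?thesis using L(2) X by (simp add: sets_eq_imp_space_eq)
qed

lemma torus_measure_eqI_continuous:
  fixes M N :: "torus measure"
  assumes M: "finite_measure M" "sets M = sets borel" and N: "finite_measure N" "sets N = sets borel"
    and eq: "\<And>f :: torus \<Rightarrow> real. continuous_on UNIV f \<Longrightarrow> (\<integral>x. f x \<partial>M) = (\<integral>x. f x \<partial>N)"
  shows "M = N"
proof (rule measure_eqI_generator_eq[where \<Omega> = UNIV and E = "{U. open U}" and A = "\<lambda>_. UNIV"])
  show "Int_stable {U :: torus set. open U}" by (auto simp: Int_stable_def)
  show "sets M = sigma_sets UNIV {U. open U}" "sets N = sigma_sets UNIV {U. open U}"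
    using M N by (auto simp: borel_def)
  interpret M: finite_measure M by fact
  interpret N: finite_measure N by fact
  show "emeasure M X = emeasure N X" if "X \<in> {U. open U}" for X
  proof -
    have "open X" using that by simp
    then obtain f :: "torus \<Rightarrow> real" where f: "continuous_on UNIV f" "\<forall>x. 0 \<le> f x" "X = {x. 0 < f x}"
      by (rule open_torus_cozero) blast
    have gc: "continuous_on UNIV (\<lambda>x. min 1 (real n * f x))" for n by (intro continuous_intros f(1))
    have "measure M X = measure N X"
      unfolding f(3)
      using LIMSEQ_unique[OF tendsto_integral_cozero[OF M f(1,2)] tendsto_integral_cozero[OF N f(1,2), folded eq[OF gc]]] .
    then show ?thesis by (simp add: M.emeasure_eq_measure N.emeasure_eq_measure)
  qed
  show "emeasure M UNIV \<noteq> \<infinity>" using M.emeasure_finite by simp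
qed auto

text \<open>Trigonometric polynomials are uniformly dense, and finite measures integrate uniformly close
  functions to close values.\<close>

lemma torus_measure_eqI_wave:
  fixes M N :: "torus measure"
  assumes M: "finite_measure M" "sets M = sets borel" and N: "finite_measure N" "sets N = sets borel"
    and eq: "\<And>k l s. (\<integral>x. wave k l s x \<partial>M) = (\<integral>x. wave k l s x \<partial>N)"
  shows "M = N"
proof (rule torus_measure_eqI_continuous[OF M N])
  interpret M: finite_measure M by fact
  interpret N: finite_measure N by fact
  have trig: "(\<integral>x. trig cs x \<partial>M) = (\<integral>x. trig cs x \<partial>N)" for cs
  proof (induction cs)
    case (Cons t cs)
    obtain r k l s where t: "t = (r, k, l, s)" by (cases t) auto
    have i: "integrable M (wave k l s)" "integrable N (wave k l s)"
      "integrable M (trig cs)" "integrable N (trig cs)"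
      using finite_measure_integrable_continuous M N continuous_wave continuous_trig by blast+
    then show ?case by (simp add: t eq Cons)
  qed (simp add: trig_def)
  fix f :: "torus \<Rightarrow> real" assume f: "continuous_on UNIV f"
  show "(\<integral>x. f x \<partial>M) = (\<integral>x. f x \<partial>N)"
  proof (rule ccontr)
    define C where "C = measure M UNIV + measure N UNIV"
    assume ne: "(\<integral>x. f x \<partial>M) \<noteq> (\<integral>x. f x \<partial>N)"
    define e where "e = \<bar>(\<integral>x. f x \<partial>M) - (\<integral>x. f x \<partial>N)\<bar> / 2 / (C + 1)"
    have C: "0 \<le> C" by (simp add: C_def)
    have e: "0 < e" using ne C by (simp add: e_def)
    obtain cs where cs: "\<And>x. \<bar>f x - trig cs x\<bar> < e" using trig_dense[OF f e] by blast
    have L: "\<bar>(\<integral>x. f x \<partial>L) - (\<integral>x. trig cs x \<partial>L)\<bar> \<le> e * measure L UNIV"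
      if L: "finite_measure L" "sets L = sets borel" for L
    proof -
      interpret L: finite_measure L by fact
      have sp: "space L = UNIV" using L by (simp add: sets_eq_imp_space_eq)
      have i: "integrable L f" "integrable L (trig cs)"
        using finite_measure_integrable_continuous L f continuous_trig by blast+
      have "\<bar>\<integral>x. f x - trig cs x \<partial>L\<bar> \<le> (\<integral>x. e \<partial>L)"
        by (rule order_trans[OF integral_abs_bound integral_mono])
          (use i cs in \<open>auto intro: less_imp_le\<close>)
      then show ?thesis using i by (simp add: sp mult.commute)
    qed
    have "\<bar>(\<integral>x. f x \<partial>M) - (\<integral>x. f x \<partial>N)\<bar> \<le> e * C"
      using L[OF M] L[OF N] trig[of cs] by (simp add: C_def algebra_simps)
    also have "\<dots> \<le> e * (C + 1)" using e by simp
    also have "\<dots> = \<bar>(\<integral>x. f x \<partial>M) - (\<integral>x. f x \<partial>N)\<bar> / 2"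
      unfolding e_def using C by (intro nonzero_eq_divide_eq[THEN iffD1, OF _ refl]) simp
    finally show False using ne by simp
  qed
qed

section \<open>Symmetries of the torus\<close>

lemma measurable_continuous_torus:
  "continuous_on UNIV g \<Longrightarrow> g \<in> borel \<rightarrow>\<^sub>M borel"
  by (rule borel_measurable_continuous_onI)

lemma abs_torus_add: "abs_torus (p + q) = abs_torus p + abs_torus q"
  by (simp add: plus_torus.abs_eq)

lemma continuous_torus_translate [continuous_intros]: "continuous_on UNIV (\<lambda>x :: torus. x + y)"
proof -
  obtain p where y: "y = abs_torus p" by (rule torus_cases)
  have *: "(\<lambda>q. abs_torus q + y) = (\<lambda>q. abs_torus (q + p))"
    by (auto simp: y abs_torus_add)
  show ?thesis
    unfolding continuous_on_torus_iff *
    by (intro continuous_on_compose2[OF continuous_abs_torus]) (auto intro!: continuous_intros)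
qed

lemma continuous_torus_minus [continuous_intros]: "continuous_on UNIV (\<lambda>x :: torus. x - y)"
  using continuous_torus_translate[of "- y"] by simp

lemma torus_map_abs:
  "torus_map a b c d (abs_torus (x1, x2)) = abs_torus (of_int d * x1 + of_int b * x2, of_int c * x1 + of_int a * x2)"
  by (simp add: torus_map.abs_eq)

lemma continuous_torus_map [continuous_intros]: "continuous_on UNIV (torus_map a b c d)"
proof -
  have *: "(\<lambda>q. torus_map a b c d (abs_torus q))
    = (\<lambda>q. abs_torus (of_int d * fst q + of_int b * snd q, of_int c * fst q + of_int a * snd q))"
    by (auto simp: torus_map_abs fun_eq_iff)
  show ?thesis
    unfolding continuous_on_torus_iff *
    by (intro continuous_on_compose2[OF continuous_abs_torus]) (auto intro!: continuous_intros)
qed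

lemma torus_map_add: "torus_map a b c d (x + y) = torus_map a b c d x + torus_map a b c d y"
proof -
  obtain p where x: "x = abs_torus p" by (rule torus_cases)
  obtain q where y: "y = abs_torus q" by (rule torus_cases)
  show ?thesis
    by (cases p; cases q) (simp add: x y plus_torus.abs_eq torus_map_abs algebra_simps)
qed

lemma torus_map_zero: "torus_map a b c d 0 = 0"
  using torus_map_add[of a b c d 0 0] by simp

lemma torus_map_diff: "torus_map a b c d (x - y) = torus_map a b c d x - torus_map a b c d y"
  using torus_map_add[of a b c d "x - y" y] by (simp add: algebra_simps)

lemma torus_map_inverse:
  assumes "a * d - b * c = 1"
  shows "torus_map a b c d (torus_map d (- b) (- c) a x) = x"
proof -
  obtain p where p: "x = abs_torus p" by (rule torus_cases)
  obtain p1 p2 where pp: "p = (p1, p2)" by fastforce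
  have det: "of_int a * of_int d - of_int b * of_int c = (1 :: real)"
    using assms by (metis of_int_1 of_int_diff of_int_mult)
  have "of_int d * (of_int a * p1 + of_int (- b) * p2) + of_int b * (of_int (- c) * p1 + of_int d * p2)
      = (of_int a * of_int d - of_int b * of_int c) * p1"
    "of_int c * (of_int a * p1 + of_int (- b) * p2) + of_int a * (of_int (- c) * p1 + of_int d * p2)
      = (of_int a * of_int d - of_int b * of_int c) * p2"
    by (simp_all add: algebra_simps)
  then show ?thesis by (simp only: p pp torus_map_abs det mult_1)
qed

lemma torus_map_inverse':
  assumes "a * d - b * c = 1"
  shows "torus_map d (- b) (- c) a (torus_map a b c d x) = x"
  using torus_map_inverse[of d a "- b" "- c" x] assms by (simp add: algebra_simps)

lemma inv_torus_map:
  assumes "a * d - b * c = 1"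
  shows "inv (torus_map a b c d) = torus_map d (- b) (- c) a"
  by (rule inv_unique_comp) (auto simp: fun_eq_iff torus_map_inverse torus_map_inverse' assms)

lemma torus_map_eq_0_iff:
  assumes "a * d - b * c = 1"
  shows "torus_map a b c d x = 0 \<longleftrightarrow> x = 0"
  using torus_map_inverse'[OF assms, of x] by (auto simp: torus_map_zero)

lemma lborel_integral_cos_unit:
  assumes "k \<noteq> (0 :: int)"
  shows "(\<integral>y. indicator {0..<1} y * cos (2 * pi * of_int k * y + s) \<partial>lborel) = (0 :: real)"
proof -
  have "(\<integral>y. indicator {0..<1} y * cos (2 * pi * of_int k * y + s) \<partial>lborel)
    = (\<integral>y. cos (2 * pi * of_int k * y + s) * indicator {0..1} y \<partial>lborel)"
  proof (rule integral_cong_AE)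
    show "AE y in lborel. indicator {0..<1} y * cos (2 * pi * of_int k * y + s)
        = cos (2 * pi * of_int k * y + s) * indicator {0..1} y"
      using AE_lborel_singleton[of "1 :: real"] by eventually_elim (auto simp: indicator_def)
  qed measurable
  also have "\<dots> = sin (2 * pi * of_int k * 1 + s) / (2 * pi * of_int k)
      - sin (2 * pi * of_int k * 0 + s) / (2 * pi * of_int k)"
    using assms by (intro integral_FTC_Icc_real) (auto intro!: derivative_eq_intros continuous_intros)
  also have "\<dots> = 0"
    using sin_add[of "2 * pi * of_int k" s] by (simp add: cos_int_2pin sin_int_2pin)
  finally show ?thesis .
qed

interpretation torus_lebesgue: prob_space torus_lebesgue by (rule prob_space_torus_lebesgue)

lemma torus_lebesgue_integral:
  fixes f :: "torus \<Rightarrow> real"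
  assumes f: "f \<in> borel_measurable borel"
  shows "(\<integral>x. f x \<partial>torus_lebesgue)
    = (\<integral>p. indicator ({0..<1} \<times> {0..<1}) p * f (abs_torus p) \<partial>lborel)"
proof -
  have "({0..<1} \<times> {0..<1} :: (real \<times> real) set) \<in> sets borel" by (rule borel_Times) auto
  then show ?thesis
    unfolding torus_lebesgue_def
    by (subst integral_distr[OF abs_torus_measurable_restrict f]) (simp add: integral_restrict_space)
qed

lemma torus_lebesgue_integrable:
  fixes f :: "torus \<Rightarrow> real"
  assumes f: "f \<in> borel_measurable borel"
  shows "integrable torus_lebesgue f
    \<longleftrightarrow> integrable lborel (\<lambda>p. indicator ({0..<1} \<times> {0..<1}) p * f (abs_torus p))"
proof -
  have "({0..<1} \<times> {0..<1} :: (real \<times> real) set) \<in> sets borel" by (rule borel_Times) auto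
  then show ?thesis
    unfolding torus_lebesgue_def
    by (subst integrable_distr_eq[OF abs_torus_measurable_restrict f]) (simp add: integrable_restrict_space)
qed

lemma integral_wave:
  "(\<integral>x. wave k l s x \<partial>torus_lebesgue) = (if k = 0 \<and> l = 0 then cos s else 0)"
proof (cases "k = 0 \<and> l = 0")
  case True
  then show ?thesis using torus_lebesgue.prob_space by (simp add: wave_0)
next
  case False
  let ?I = "indicator {0..<1} :: real \<Rightarrow> real"
  let ?g = "\<lambda>p. indicator ({0..<1} \<times> {0..<1}) p * wave k l s (abs_torus p)"
  have m: "wave k l s \<in> borel_measurable borel"
    by (rule borel_measurable_continuous_onI) (rule continuous_wave)
  have "integrable lborel ?g"
    by (rule torus_lebesgue_integrable[OF m, THEN iffD1, OF integrable_torus_continuous[OF continuous_wave]])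
  then have int: "integrable (lborel \<Otimes>\<^sub>M lborel) ?g" by (simp add: lborel_prod)
  have "(\<integral>x. wave k l s x \<partial>torus_lebesgue) = (\<integral>p. ?g p \<partial>(lborel \<Otimes>\<^sub>M lborel))"
    by (simp add: torus_lebesgue_integral[OF m] lborel_prod)
  also have "\<dots> = (\<integral>x. \<integral>y. ?g (x, y) \<partial>lborel \<partial>lborel)"
    using lborel_pair.integral_fst'[OF int] by simp
  also have "\<dots> = (\<integral>x. ?I x * (\<integral>y. ?I y * cos (2 * pi * of_int l * y + (2 * pi * of_int k * x + s)) \<partial>lborel) \<partial>lborel)"
  proof (rule Bochner_Integration.integral_cong[OF refl])
    fix x :: real
    have "?g (x, y) = ?I x * (?I y * cos (2 * pi * of_int l * y + (2 * pi * of_int k * x + s)))" for y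
      by (simp add: wave_abs indicator_times algebra_simps)
    then show "(\<integral>y. ?g (x, y) \<partial>lborel)
      = ?I x * (\<integral>y. ?I y * cos (2 * pi * of_int l * y + (2 * pi * of_int k * x + s)) \<partial>lborel)"
      by simp
  qed
  also have "\<dots> = 0"
  proof (cases "l = 0")
    case True
    then have "k \<noteq> 0" using False by simp
    have "(\<integral>y. ?I y * C \<partial>lborel) = C" for C :: real by simp
    then show ?thesis using lborel_integral_cos_unit[OF \<open>k \<noteq> 0\<close>, of s] by (simp add: True)
  next
    case False
    then show ?thesis by (simp add: lborel_integral_cos_unit)
  qed
  finally show ?thesis by (simp only: False if_False)
qed

text \<open>Translations, the reflection and unimodular maps permute the waves up to phases and fix the
  constants, so they preserve all Fourier coefficients of \<open>\<lambda>\<close> and hence \<open>\<lambda>\<close> itself.\<close>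

lemma torus_lebesgue_distr_eqI:
  assumes g: "continuous_on UNIV g"
    and w: "\<And>k l s. \<exists>k' l' s'. (\<forall>x. wave k l s (g x) = wave k' l' s' x)
      \<and> (k' = 0 \<and> l' = 0 \<longleftrightarrow> k = 0 \<and> l = 0) \<and> (k = 0 \<and> l = 0 \<longrightarrow> cos s' = cos s)"
  shows "distr torus_lebesgue borel g = torus_lebesgue"
proof (rule torus_measure_eqI_wave)
  have m: "g \<in> torus_lebesgue \<rightarrow>\<^sub>M borel" using measurable_continuous_torus[OF g] by simp
  show "finite_measure (distr torus_lebesgue borel g)"
    using torus_lebesgue.prob_space_distr[OF m] prob_space_def by blast
  fix k l s
  obtain k' l' s' where *: "\<forall>x. wave k l s (g x) = wave k' l' s' x"
    "k' = 0 \<and> l' = 0 \<longleftrightarrow> k = 0 \<and> l = 0" "k = 0 \<and> l = 0 \<longrightarrow> cos s' = cos s"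
    using w[of k l s] by blast
  have "(\<integral>x. wave k l s x \<partial>distr torus_lebesgue borel g) = (\<integral>x. wave k' l' s' x \<partial>torus_lebesgue)"
    by (subst integral_distr[OF m]) (auto simp: * intro!: borel_measurable_continuous_onI continuous_wave)
  then show "(\<integral>x. wave k l s x \<partial>distr torus_lebesgue borel g) = (\<integral>x. wave k l s x \<partial>torus_lebesgue)"
    using * by (auto simp: integral_wave)
qed (auto intro: torus_lebesgue.finite_measure_axioms)

lemma torus_lebesgue_translate: "distr torus_lebesgue borel (\<lambda>x. x + y) = torus_lebesgue"
proof (rule torus_lebesgue_distr_eqI[OF continuous_torus_translate])
  fix k l s
  obtain p1 p2 where y: "y = abs_torus (p1, p2)" by (metis torus_cases surj_pair)
  show "\<exists>k' l' s'. (\<forall>x. wave k l s (x + y) = wave k' l' s' x)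
      \<and> (k' = 0 \<and> l' = 0 \<longleftrightarrow> k = 0 \<and> l = 0) \<and> (k = 0 \<and> l = 0 \<longrightarrow> cos s' = cos s)"
    by (intro exI[of _ k] exI[of _ l] exI[of _ "s + 2 * pi * (of_int k * p1 + of_int l * p2)"])
      (auto simp: y wave_translate)
qed

lemma continuous_torus_uminus: "continuous_on UNIV (\<lambda>x :: torus. - x)"
  using continuous_torus_reflect[of 0] by simp

lemma torus_lebesgue_uminus: "distr torus_lebesgue borel (\<lambda>x. - x) = torus_lebesgue"
  by (rule torus_lebesgue_distr_eqI[OF continuous_torus_uminus]) (metis wave_reflect neg_equal_0_iff_equal)

lemma unimodular_row_eq_0_iff:
  assumes "a * d - b * c = (1 :: int)"
  shows "k * d + l * c = 0 \<and> k * b + l * a = 0 \<longleftrightarrow> k = 0 \<and> l = 0"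
proof
  assume *: "k * d + l * c = 0 \<and> k * b + l * a = 0"
  have "k * (a * d - b * c) = a * (k * d + l * c) - c * (k * b + l * a)"
    "l * (a * d - b * c) = d * (k * b + l * a) - b * (k * d + l * c)"
    by (auto simp: algebra_simps)
  then show "k = 0 \<and> l = 0" unfolding assms *[THEN conjunct1] *[THEN conjunct2] by simp
qed auto

lemma torus_lebesgue_torus_map:
  assumes "a * d - b * c = 1"
  shows "distr torus_lebesgue borel (torus_map a b c d) = torus_lebesgue"
proof (rule torus_lebesgue_distr_eqI[OF continuous_torus_map])
  show "\<exists>k' l' s'. (\<forall>x. wave k l s (torus_map a b c d x) = wave k' l' s' x)
      \<and> (k' = 0 \<and> l' = 0 \<longleftrightarrow> k = 0 \<and> l = 0) \<and> (k = 0 \<and> l = 0 \<longrightarrow> cos s' = cos s)" for k l s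
    using unimodular_row_eq_0_iff[OF assms, of k l]
    by (intro exI[of _ "k * d + l * c"] exI[of _ "k * b + l * a"] exI[of _ s]) (simp add: wave_torus_map)
qed

text \<open>An invertible change of variables neither creates nor destroys measurability, and where the
  integrand is not measurable the integral is \<open>0\<close> on both sides.\<close>

lemma
  fixes f :: "torus \<Rightarrow> real"
  assumes g: "continuous_on UNIV g" and h: "continuous_on UNIV h" and gh: "\<And>x. g (h x) = x"
    and inv: "distr torus_lebesgue borel g = torus_lebesgue"
  shows integral_invariant_bij: "(\<integral>x. f (g x) \<partial>torus_lebesgue) = (\<integral>x. f x \<partial>torus_lebesgue)"
    and integrable_invariant_bij: "integrable torus_lebesgue (\<lambda>x. f (g x)) \<longleftrightarrow> integrable torus_lebesgue f"
proof -
  have gm: "g \<in> torus_lebesgue \<rightarrow>\<^sub>M borel" using measurable_continuous_torus[OF g] by simp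
  have "(\<integral>x. f (g x) \<partial>torus_lebesgue) = (\<integral>x. f x \<partial>torus_lebesgue)
    \<and> (integrable torus_lebesgue (\<lambda>x. f (g x)) \<longleftrightarrow> integrable torus_lebesgue f)"
  proof (cases "f \<in> borel_measurable borel")
    case True
    then show ?thesis
      using integral_distr[OF gm True] integrable_distr_eq[OF gm True] by (simp add: inv)
  next
    case False
    have "(\<lambda>x. f (g x)) \<notin> borel_measurable borel"
    proof
      assume "(\<lambda>x. f (g x)) \<in> borel_measurable borel"
      from measurable_compose[OF measurable_continuous_torus[OF h] this]
      have "f \<in> borel_measurable borel" by (simp add: gh)
      then show False using False by simp
    qed
    then have "\<not> integrable torus_lebesgue (\<lambda>x. f (g x))" "\<not> integrable torus_lebesgue f"
      using False borel_measurable_integrable[of torus_lebesgue] by auto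
    then show ?thesis by (simp add: not_integrable_integral_eq)
  qed
  then show "(\<integral>x. f (g x) \<partial>torus_lebesgue) = (\<integral>x. f x \<partial>torus_lebesgue)"
    "integrable torus_lebesgue (\<lambda>x. f (g x)) \<longleftrightarrow> integrable torus_lebesgue f" by auto
qed

lemma integral_torus_uminus:
  fixes f :: "torus \<Rightarrow> real"
  shows "(\<integral>x. f (- x) \<partial>torus_lebesgue) = (\<integral>x. f x \<partial>torus_lebesgue)"
  using integral_invariant_bij[OF continuous_torus_uminus continuous_torus_uminus _ torus_lebesgue_uminus, of f]
  by simp

lemma
  fixes f :: "torus \<Rightarrow> real"
  assumes "a * d - b * c = 1"
  shows integral_torus_map:
      "(\<integral>x. f (torus_map a b c d x) \<partial>torus_lebesgue) = (\<integral>x. f x \<partial>torus_lebesgue)"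
    and integrable_torus_map:
      "integrable torus_lebesgue (\<lambda>x. f (torus_map a b c d x)) \<longleftrightarrow> integrable torus_lebesgue f"
  using integral_invariant_bij[OF continuous_torus_map continuous_torus_map torus_map_inverse[OF assms]
      torus_lebesgue_torus_map[OF assms], of f]
    integrable_invariant_bij[OF continuous_torus_map continuous_torus_map torus_map_inverse[OF assms]
      torus_lebesgue_torus_map[OF assms], of f]
  by auto

section \<open>The Green function\<close>

lemma torus_vol_density:
  "torus_vol \<tau> = density torus_lebesgue (\<lambda>_. ennreal (Im \<tau>))"
  unfolding torus_vol_def
  by (rule measure_eqI) (auto simp: emeasure_density_const)

lemma sets_torus_vol [simp, measurable_cong]: "sets (torus_vol \<tau>) = sets borel"
  by (simp add: torus_vol_def)

lemma
  fixes f :: "torus \<Rightarrow> real"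
  assumes "0 < Im \<tau>"
  shows integral_torus_vol: "(\<integral>x. f x \<partial>torus_vol \<tau>) = Im \<tau> * (\<integral>x. f x \<partial>torus_lebesgue)"
    and integrable_torus_vol: "integrable (torus_vol \<tau>) f \<longleftrightarrow> integrable torus_lebesgue f"
proof -
  have "(\<integral>x. f x \<partial>torus_vol \<tau>) = Im \<tau> * (\<integral>x. f x \<partial>torus_lebesgue)
    \<and> (integrable (torus_vol \<tau>) f \<longleftrightarrow> integrable torus_lebesgue f)"
  proof (cases "f \<in> borel_measurable borel")
    case True
    then have f: "f \<in> borel_measurable torus_lebesgue" by simp
    show ?thesis
      using integral_density[OF f, of "\<lambda>_. Im \<tau>"] integrable_density[OF f, of "\<lambda>_. Im \<tau>"] assms
      by (simp add: torus_vol_density)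
  next
    case False
    then have "\<not> integrable (torus_vol \<tau>) f" "\<not> integrable torus_lebesgue f"
      using borel_measurable_integrable[of torus_lebesgue] borel_measurable_integrable[of "torus_vol \<tau>" f]
      by (auto cong: measurable_cong_sets)
    then show ?thesis by (simp add: not_integrable_integral_eq)
  qed
  then show "(\<integral>x. f x \<partial>torus_vol \<tau>) = Im \<tau> * (\<integral>x. f x \<partial>torus_lebesgue)"
    "integrable (torus_vol \<tau>) f \<longleftrightarrow> integrable torus_lebesgue f" by auto
qed

lemma DERIV_wave:
  "((\<lambda>t. r * wave k l s (x + abs_torus (t *\<^sub>R v))) has_real_derivative
     r * (2 * pi * (of_int k * fst v + of_int l * snd v)) * wave k l (s + pi / 2) x) (at 0)"
proof -
  obtain p where x: "x = abs_torus p" by (rule torus_cases)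
  show ?thesis
    unfolding x abs_torus_add[symmetric] wave_abs'
    by (auto intro!: derivative_eq_intros simp: minus_sin_cos_eq algebra_simps)
qed

lemma dirderiv_wave:
  "dirderiv v (\<lambda>x. r * wave k l s x)
    = (\<lambda>x. r * (2 * pi * (of_int k * fst v + of_int l * snd v)) * wave k l (s + pi / 2) x)"
  by (rule ext) (simp only: dirderiv_def DERIV_imp_deriv[OF DERIV_wave])

lemma smooth_wave: "smooth (\<lambda>x. r * wave k l s x)"
proof (coinduction arbitrary: r k l s rule: smooth.coinduct)
  case smooth
  have "(\<lambda>t. r * wave k l s (x + abs_torus (t *\<^sub>R v))) differentiable at 0" for v x
    unfolding real_differentiable_def using DERIV_wave by blast
  moreover have "continuous_on UNIV (\<lambda>x. r * wave k l s x)" by (intro continuous_intros)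
  ultimately show ?case using dirderiv_wave by blast
qed

text \<open>The squared length of the frequency \<open>(k, l)\<close> in the dual lattice, up to normalization: the
  eigenvalue of the Laplacian on the waves of this frequency is \<open>- 4 \<pi>\<^sup>2 freq / (Im \<tau>)\<^sup>2\<close>.\<close>

definition freq :: "complex \<Rightarrow> int \<Rightarrow> int \<Rightarrow> real" where
  "freq \<tau> k l = (cmod (of_int l - of_int k * \<tau>))\<^sup>2"

lemma freq_expand:
  "freq \<tau> k l = (of_int l - of_int k * Re \<tau>)\<^sup>2 + (of_int k * Im \<tau>)\<^sup>2"
  by (simp add: freq_def cmod_power2)

lemma freq_pos:
  assumes "0 < Im \<tau>" "k \<noteq> 0 \<or> l \<noteq> 0" shows "0 < freq \<tau> k l"
  using assms by (cases "k = 0") (auto simp: freq_expand intro: add_nonneg_pos)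

lemma laplace_wave:
  "laplace \<tau> (wave k l s) x = - (4 * pi\<^sup>2 * freq \<tau> k l / (Im \<tau>)\<^sup>2 * wave k l s x)"
proof -
  have w: "wave k l s = (\<lambda>x. 1 * wave k l s x)" by simp
  have "wave k l (s + pi / 2 + pi / 2) x = - wave k l s x"
    by (simp add: wave_def cos_add sin_add split: prod.split)
  then have "laplace \<tau> (wave k l s) x
    = ((cmod \<tau>)\<^sup>2 * (2 * pi * of_int k)\<^sup>2 - 2 * Re \<tau> * (2 * pi * of_int l) * (2 * pi * of_int k)
        + (2 * pi * of_int l)\<^sup>2) / (Im \<tau>)\<^sup>2 * - wave k l s x"
    unfolding laplace_def
    by (subst (1 2 3) w) (simp only: dirderiv_wave, simp add: power2_eq_square algebra_simps)
  also have "(cmod \<tau>)\<^sup>2 * (2 * pi * of_int k)\<^sup>2 - 2 * Re \<tau> * (2 * pi * of_int l) * (2 * pi * of_int k)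
        + (2 * pi * of_int l)\<^sup>2 = 4 * pi\<^sup>2 * freq \<tau> k l"
    unfolding freq_expand cmod_power2 by (simp add: power2_eq_square algebra_simps)
  finally show ?thesis by simp
qed

lemma green_function_measurable:
  assumes "green_function \<tau> G" shows "G \<in> borel_measurable borel"
proof -
  have "integrable (torus_vol \<tau>) G" using assms by (simp add: green_function_def)
  then show ?thesis using borel_measurable_integrable by (metis measurable_cong_sets sets_torus_vol)
qed

lemma green_function_integrable:
  assumes "0 < Im \<tau>" "green_function \<tau> G" shows "integrable torus_lebesgue G"
  using assms by (simp add: green_function_def integrable_torus_vol)

text \<open>Testing the defining equation against waves, which are eigenfunctions of the Laplacian, gives
  the Fourier coefficients of the Green function.\<close>

lemma green_function_fourier:
  assumes \<tau>: "0 < Im \<tau>" and G: "green_function \<tau> G"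
  shows "(\<integral>x. G x * wave k l s x \<partial>torus_lebesgue)
    = (if k = 0 \<and> l = 0 then 0 else Im \<tau> / (2 * pi * freq \<tau> k l) * cos s)"
proof -
  have refl: "(\<integral>x. G x * wave k l s x \<partial>torus_lebesgue) = (\<integral>x. G (0 - x) * wave (- k) (- l) s x \<partial>torus_lebesgue)"
    using integral_torus_uminus[of "\<lambda>x. G x * wave k l s x"] by (simp add: wave_reflect)
  show ?thesis
  proof (cases "k = 0 \<and> l = 0")
    case True
    have "Im \<tau> * (\<integral>x. G (0 - x) \<partial>torus_lebesgue) = 0"
      using G \<tau> by (simp only: green_function_def integral_torus_vol)
    then show ?thesis using True \<tau> integral_torus_uminus[of G] by (simp add: wave_0)
  next
    case False
    define N where "N = freq \<tau> (- k) (- l)"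
    have N: "N = freq \<tau> k l" by (simp add: N_def freq_expand power2_eq_square algebra_simps)
    have Np: "0 < N" using freq_pos[OF \<tau>] False by (simp add: N)
    have "smooth (wave (- k) (- l) s)" using smooth_wave[of 1] by simp
    then have "(\<integral>x. G (0 - x) * (- laplace \<tau> (wave (- k) (- l) s) x) \<partial>torus_vol \<tau>)
          = 2 * pi * (wave (- k) (- l) s 0 - 1 / Im \<tau> * (\<integral>x. wave (- k) (- l) s x \<partial>torus_vol \<tau>))"
      using G unfolding green_function_def by blast
    moreover have "wave (- k) (- l) s 0 = cos s"
      using wave_abs[of "- k" "- l" s 0 0] by (simp add: zero_torus.abs_eq zero_prod_def)
    moreover have "(\<integral>x. wave (- k) (- l) s x \<partial>torus_vol \<tau>) = 0"
      using \<tau> False by (auto simp: integral_torus_vol integral_wave)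
    moreover have "(\<integral>x. G (0 - x) * (- laplace \<tau> (wave (- k) (- l) s) x) \<partial>torus_vol \<tau>)
      = Im \<tau> * (4 * pi\<^sup>2 * N / (Im \<tau>)\<^sup>2 * (\<integral>x. G (0 - x) * wave (- k) (- l) s x \<partial>torus_lebesgue))"
      unfolding integral_torus_vol[OF \<tau>]
      by (subst integral_mult_right_zero[symmetric])
        (simp add: laplace_wave N_def algebra_simps)
    ultimately have "Im \<tau> * (4 * pi\<^sup>2 * N / (Im \<tau>)\<^sup>2 * (\<integral>x. G x * wave k l s x \<partial>torus_lebesgue)) = 2 * pi * cos s"
      by (simp add: refl)
    then show ?thesis using False \<tau> Np N by (auto simp: field_simps power2_eq_square)
  qed
qed

lemma integrable_mult_continuous:
  fixes f g :: "torus \<Rightarrow> real"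
  assumes f: "integrable torus_lebesgue f" and g: "continuous_on UNIV g"
  shows "integrable torus_lebesgue (\<lambda>x. f x * g x)"
proof -
  obtain B where B: "\<And>x. \<bar>g x\<bar> \<le> B" using torus_continuous_bounded[OF g] by blast
  have gm: "g \<in> borel_measurable torus_lebesgue" using borel_measurable_continuous_onI[OF g] by simp
  show ?thesis
  proof (rule Bochner_Integration.integrable_bound)
    show "integrable torus_lebesgue (\<lambda>x. B * f x)" using f by simp
    show "(\<lambda>x. f x * g x) \<in> borel_measurable torus_lebesgue"
      using borel_measurable_integrable[OF f] gm by (rule borel_measurable_times)
    have "\<bar>f x * g x\<bar> \<le> \<bar>B * f x\<bar>" for x
      using mult_right_mono[OF order_trans[OF B[of x] abs_ge_self], of "\<bar>f x\<bar>"]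
      by (simp add: abs_mult mult.commute)
    then show "AE x in torus_lebesgue. norm (f x * g x) \<le> norm (B * f x)" by simp
  qed
qed

text \<open>Fourier uniqueness for integrable functions follows from the one for measures, applied to the
  densities of the positive and the negative part.\<close>

lemma AE_eq_0_if_waves_eq_0:
  fixes D :: "torus \<Rightarrow> real"
  assumes D: "integrable torus_lebesgue D"
    and eq: "\<And>k l s. (\<integral>x. D x * wave k l s x \<partial>torus_lebesgue) = 0"
  shows "AE x in torus_lebesgue. D x = 0"
proof -
  define P where "P x = max 0 (D x)" for x
  define N where "N x = max 0 (- D x)" for x
  have i: "integrable torus_lebesgue P" "integrable torus_lebesgue N"
    unfolding P_def N_def using D by auto
  then have m: "P \<in> borel_measurable torus_lebesgue" "N \<in> borel_measurable torus_lebesgue" by auto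
  have fin: "finite_measure (density torus_lebesgue (\<lambda>x. ennreal (f x)))"
    if f: "integrable torus_lebesgue f" "\<And>x. 0 \<le> f x" for f :: "torus \<Rightarrow> real"
  proof (rule finite_measureI)
    have fm: "f \<in> borel_measurable torus_lebesgue" using f by auto
    have "emeasure (density torus_lebesgue (\<lambda>x. ennreal (f x))) (space (density torus_lebesgue (\<lambda>x. ennreal (f x))))
        = (\<integral>\<^sup>+x. ennreal (f x) \<partial>torus_lebesgue)"
      using fm by (subst emeasure_density) auto
    also have "\<dots> \<noteq> \<infinity>" using f by (simp add: nn_integral_eq_integral)
    finally show "emeasure (density torus_lebesgue (\<lambda>x. ennreal (f x)))
      (space (density torus_lebesgue (\<lambda>x. ennreal (f x)))) \<noteq> \<infinity>" .
  qed
  have wm: "wave k l s \<in> borel_measurable torus_lebesgue" for k l s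
    using borel_measurable_continuous_onI[OF continuous_wave] by simp
  have "density torus_lebesgue (\<lambda>x. ennreal (P x)) = density torus_lebesgue (\<lambda>x. ennreal (N x))"
  proof (rule torus_measure_eqI_wave)
    show "finite_measure (density torus_lebesgue (\<lambda>x. ennreal (P x)))"
      "finite_measure (density torus_lebesgue (\<lambda>x. ennreal (N x)))"
      using fin[OF i(1)] fin[OF i(2)] by (auto simp: P_def N_def)
    fix k l s
    have ii: "integrable torus_lebesgue (\<lambda>x. P x * wave k l s x)" "integrable torus_lebesgue (\<lambda>x. N x * wave k l s x)"
      using i integrable_mult_continuous continuous_wave by blast+
    have "(\<integral>x. P x * wave k l s x - N x * wave k l s x \<partial>torus_lebesgue) = (\<integral>x. D x * wave k l s x \<partial>torus_lebesgue)"
      by (rule Bochner_Integration.integral_cong) (auto simp: P_def N_def max_def)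
    then have "(\<integral>x. P x * wave k l s x \<partial>torus_lebesgue) = (\<integral>x. N x * wave k l s x \<partial>torus_lebesgue)"
      using ii by (simp add: eq)
    moreover have "(\<integral>x. wave k l s x \<partial>density torus_lebesgue (\<lambda>x. ennreal (P x))) = (\<integral>x. P x * wave k l s x \<partial>torus_lebesgue)"
      using integral_density[OF wm m(1), of k l s] by (simp add: P_def)
    moreover have "(\<integral>x. wave k l s x \<partial>density torus_lebesgue (\<lambda>x. ennreal (N x))) = (\<integral>x. N x * wave k l s x \<partial>torus_lebesgue)"
      using integral_density[OF wm m(2), of k l s] by (simp add: N_def)
    ultimately show "(\<integral>x. wave k l s x \<partial>density torus_lebesgue (\<lambda>x. ennreal (P x)))
      = (\<integral>x. wave k l s x \<partial>density torus_lebesgue (\<lambda>x. ennreal (N x)))" by simp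
  qed auto
  then have "AE x in torus_lebesgue. ennreal (P x) = ennreal (N x)"
    using m by (intro torus_lebesgue.density_unique) auto
  then show ?thesis by eventually_elim (auto simp: P_def N_def max_def split: if_splits)
qed

lemma eq_0_if_AE_eq_0_punctured:
  fixes D :: "torus \<Rightarrow> real"
  assumes D: "continuous_on (- {0}) D" and ae: "AE x in torus_lebesgue. D x = 0" and "x \<noteq> 0"
  shows "D x = 0"
proof -
  have op: "open (- {0 :: torus})" by auto
  obtain \<phi> :: "torus \<Rightarrow> real" where \<phi>: "continuous_on UNIV \<phi>" "\<forall>x. 0 \<le> \<phi> x" "- {0} = {x. 0 < \<phi> x}"
    using open_torus_cozero[OF op] by auto
  have \<phi>0: "\<phi> 0 = 0" and \<phi>x: "0 < \<phi> x" using \<phi> assms(3) by (auto simp: set_eq_iff order_less_le)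
  \<comment> \<open>The cutoff by \<open>\<phi>\<close> removes the possible discontinuity at the origin.\<close>
  define f where "f y = min \<bar>D y\<bar> (\<phi> y)" for y
  have "continuous_on UNIV f"
    unfolding continuous_on_eq_continuous_at[OF open_UNIV]
  proof (intro ballI)
    fix y :: torus
    show "isCont f y"
    proof (cases "y = 0")
      case True
      have "\<phi> \<midarrow>0\<rightarrow> 0" using \<phi>(1) \<phi>0 by (metis continuous_on_def UNIV_I)
      moreover have "\<forall>\<^sub>F y in at 0. 0 \<le> f y" "\<forall>\<^sub>F y in at 0. f y \<le> \<phi> y"
        using \<phi>(2) by (auto simp: f_def)
      ultimately have "f \<midarrow>0\<rightarrow> 0" using tendsto_sandwich[OF _ _ tendsto_const] by blast
      then show ?thesis using \<phi>(2) by (simp add: True isCont_def f_def \<phi>0)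
    next
      case False
      have "isCont D y" using D op False by (simp add: continuous_on_eq_continuous_at)
      moreover have "isCont \<phi> y" using \<phi>(1) by (simp add: continuous_on_eq_continuous_at)
      ultimately show ?thesis unfolding f_def by (intro continuous_intros)
    qed
  qed
  moreover have "(\<integral>y. f y \<partial>torus_lebesgue) = 0"
  proof -
    have "AE y in torus_lebesgue. f y = 0" using ae by eventually_elim (use \<phi> in \<open>auto simp: f_def min_def order_antisym\<close>)
    then show ?thesis using integral_eq_zero_AE by blast
  qed
  moreover have "0 \<le> f y" for y using \<phi> by (simp add: f_def)
  ultimately have "f x = 0" using torus_integral_eq_0 by blast
  then show ?thesis using \<phi>x by (auto simp: f_def min_def split: if_splits)
qed

lemma green_function_continuous: "green_function \<tau> G \<Longrightarrow> continuous_on (- {0}) G"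
  unfolding green_function_def by (elim conjE)

lemma green_function_0: "green_function \<tau> G \<Longrightarrow> G 0 = 0"
  unfolding green_function_def by (elim conjE)

lemma modular_denominator_nonzero:
  assumes "0 < Im \<tau>" "a * d - b * c = 1"
  shows "of_int c * \<tau> + of_int d \<noteq> 0"
proof
  assume *: "of_int c * \<tau> + of_int d = 0"
  have "of_int c * Im \<tau> = 0" using arg_cong[OF *, of Im] by simp
  then have "c = 0" using assms by simp
  moreover have "of_int d = (0 :: real)" using arg_cong[OF *, of Re] \<open>c = 0\<close> by simp
  ultimately show False using assms by simp
qed

lemma Im_modular_map:
  assumes "0 < Im \<tau>" "a * d - b * c = 1"
  shows "Im (modular_map a b c d \<tau>) = Im \<tau> / (cmod (of_int c * \<tau> + of_int d))\<^sup>2"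
proof -
  have "(of_int a * of_int d - of_int b * of_int c) = (1 :: real)"
    using assms by (metis of_int_1 of_int_diff of_int_mult)
  then have *: "Im \<tau> * (of_int a * of_int d - of_int b * of_int c) = Im \<tau>" by simp
  show ?thesis
    unfolding modular_map_def Im_divide' using * by (simp add: algebra_simps)
qed

lemma freq_modular_map:
  assumes "0 < Im \<tau>" "a * d - b * c = 1"
  shows "freq (modular_map a b c d \<tau>) k l
    = freq \<tau> (k * a - l * c) (l * d - k * b) / (cmod (of_int c * \<tau> + of_int d))\<^sup>2"
proof -
  have "of_int l - of_int k * modular_map a b c d \<tau>
    = (of_int (l * d - k * b) - of_int (k * a - l * c) * \<tau>) / (of_int c * \<tau> + of_int d)"
    using modular_denominator_nonzero[OF assms] by (simp add: modular_map_def field_simps)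
  then show ?thesis by (simp add: freq_def norm_divide power_divide)
qed

text \<open>The unimodular map is a homothety between the two flat metrics, and in two dimensions a Green
  function is invariant under homotheties. On the Fourier side, \<open>Im \<tau> / freq \<tau>\<close> is invariant
  under the simultaneous action of the modular group on \<open>\<tau>\<close> and on the frequencies.\<close>

lemma green_function_modular_map:
  assumes \<tau>: "0 < Im \<tau>" and det: "a * d - b * c = 1" and \<tau>': "\<tau>' = modular_map a b c d \<tau>"
    and G: "green_function \<tau> G" and G': "green_function \<tau>' G'"
  shows "G' x = G (torus_map a b c d x)"
proof (cases "x = 0")
  case True
  then show ?thesis using green_function_0[OF G] green_function_0[OF G'] by (simp add: torus_map_zero)
next
  case False
  let ?r = "cmod (of_int c * \<tau> + of_int d)" and ?A = "torus_map a b c d"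
  have r: "0 < ?r" using modular_denominator_nonzero[OF \<tau> det] by simp
  have Im': "Im \<tau>' = Im \<tau> / ?r\<^sup>2" unfolding \<tau>' by (rule Im_modular_map[OF \<tau> det])
  then have \<tau>'0: "0 < Im \<tau>'" using \<tau> r by simp
  have freq': "freq \<tau>' k l = freq \<tau> (k * a - l * c) (l * d - k * b) / ?r\<^sup>2" for k l
    unfolding \<tau>' by (rule freq_modular_map[OF \<tau> det])
  have iG: "integrable torus_lebesgue (\<lambda>x. G (?A x))"
    using integrable_torus_map[OF det, of G] green_function_integrable[OF \<tau> G] by simp
  have iG': "integrable torus_lebesgue G'" by (rule green_function_integrable[OF \<tau>'0 G'])
  define D where "D x = G' x - G (?A x)" for x
  have "(\<integral>x. D x * wave k l s x \<partial>torus_lebesgue) = 0" for k l s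
  proof -
    let ?k = "k * a - l * c" and ?l = "l * d - k * b"
    have zero: "?k = 0 \<and> ?l = 0 \<longleftrightarrow> k = 0 \<and> l = 0"
      using unimodular_row_eq_0_iff[of d a "- b" "- c" k l] det by (simp add: algebra_simps)
    have wav: "wave k l s x = wave ?k ?l s (?A x)" for x
    proof -
      have "?k * d + ?l * c = k * (a * d - b * c)" "?k * b + ?l * a = l * (a * d - b * c)"
        by (auto simp: algebra_simps)
      then show ?thesis by (simp add: wave_torus_map det)
    qed
    have "(\<integral>x. G (?A x) * wave k l s x \<partial>torus_lebesgue) = (\<integral>x. G x * wave ?k ?l s x \<partial>torus_lebesgue)"
      unfolding wav by (rule integral_torus_map[OF det])
    also have "\<dots> = (\<integral>x. G' x * wave k l s x \<partial>torus_lebesgue)"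
      using r unfolding green_function_fourier[OF \<tau> G] green_function_fourier[OF \<tau>'0 G'] zero
      by (simp add: Im' freq')
    finally show ?thesis
      using integrable_mult_continuous[OF iG continuous_wave] integrable_mult_continuous[OF iG' continuous_wave]
      by (simp add: D_def left_diff_distrib)
  qed
  then have ae: "AE x in torus_lebesgue. D x = 0"
    using iG iG' by (intro AE_eq_0_if_waves_eq_0) (auto simp: D_def)
  have "continuous_on (- {0}) D"
  proof -
    have "continuous_on (- {0}) (\<lambda>x. G (?A x))"
    proof (rule continuous_on_compose2[of "- {0}" G])
      show "continuous_on (- {0}) G" using G by (rule green_function_continuous)
      show "continuous_on (- {0}) ?A" by (rule continuous_on_subset[OF continuous_torus_map]) simp
      show "?A ` (- {0}) \<subseteq> - {0}"
        using torus_map_eq_0_iff[OF det] by (metis ComplI ComplD imageE singletonD singletonI subsetI)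
    qed
    moreover have "continuous_on (- {0}) G'" using G' by (rule green_function_continuous)
    ultimately show ?thesis unfolding D_def by (intro continuous_on_diff)
  qed
  from eq_0_if_AE_eq_0_punctured[OF this ae False] show ?thesis by (simp add: D_def)
qed

section \<open>Square integrability of the Green function\<close>

text \<open>The truncated Fourier series of the Green function.\<close>

definition green_kernel :: "complex \<Rightarrow> nat \<Rightarrow> torus \<Rightarrow> real" where
  "green_kernel \<tau> N x = (\<Sum>(k, l)\<in>{- int N..int N} \<times> {- int N..int N} - {(0, 0)}.
     Im \<tau> / (2 * pi * freq \<tau> k l) * wave k l 0 x)"

lemma continuous_green_kernel: "continuous_on UNIV (green_kernel \<tau> N)"
  unfolding green_kernel_def case_prod_unfold
  by (intro continuous_on_sum continuous_on_mult_left continuous_wave)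

lemma freq_uminus: "freq \<tau> (- k) (- l) = freq \<tau> k l"
  by (simp add: freq_expand power2_eq_square algebra_simps)

lemma integral_wave_wave:
  assumes "k \<noteq> 0 \<or> l \<noteq> 0"
  shows "(\<integral>x. wave k l 0 x * wave k' l' s x \<partial>torus_lebesgue)
    = (if (k', l') = (k, l) then cos s / 2 else 0) + (if (k', l') = (- k, - l) then cos s / 2 else 0)"
proof -
  have 1: "k + k' = 0 \<and> l + l' = 0 \<longleftrightarrow> k' = - k \<and> l' = - l" "k - k' = 0 \<and> l - l' = 0 \<longleftrightarrow> k' = k \<and> l' = l"
    by auto
  have i: "integrable torus_lebesgue (wave k'' l'' s')" for k'' l'' s'
    by (rule integrable_torus_continuous[OF continuous_wave])
  show ?thesis
    using assms by (auto simp: wave_mult i integral_wave 1 add_divide_distrib)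
qed

lemma integral_green_kernel_wave:
  assumes "\<bar>k\<bar> \<le> int N" "\<bar>l\<bar> \<le> int N"
  shows "(\<integral>x. green_kernel \<tau> N x * wave k l s x \<partial>torus_lebesgue)
    = (if k = 0 \<and> l = 0 then 0 else Im \<tau> / (2 * pi * freq \<tau> k l) * cos s)"
proof -
  define B where "B = {- int N..int N} \<times> {- int N..int N} - {(0, 0)}"
  define c where "c p = Im \<tau> / (2 * pi * freq \<tau> (fst p) (snd p))" for p
  have fin: "finite B" by (simp add: B_def)
  have i: "integrable torus_lebesgue (\<lambda>x. wave (fst p) (snd p) 0 x * wave k l s x)" for p
    by (intro integrable_torus_continuous continuous_intros)
  have "(\<integral>x. green_kernel \<tau> N x * wave k l s x \<partial>torus_lebesgue)
    = (\<integral>x. (\<Sum>p\<in>B. c p * (wave (fst p) (snd p) 0 x * wave k l s x)) \<partial>torus_lebesgue)"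
    unfolding green_kernel_def B_def c_def by (simp add: sum_distrib_right case_prod_unfold mult.assoc)
  also have "\<dots> = (\<Sum>p\<in>B. c p * (\<integral>x. wave (fst p) (snd p) 0 x * wave k l s x \<partial>torus_lebesgue))"
    using i by simp
  also have "\<dots> = (\<Sum>p\<in>B. c p * ((if p = (k, l) then cos s / 2 else 0) + (if p = (- k, - l) then cos s / 2 else 0)))"
  proof (rule sum.cong[OF refl])
    fix p assume p: "p \<in> B"
    then have ne: "fst p \<noteq> 0 \<or> snd p \<noteq> 0" by (cases p) (auto simp: B_def)
    have "(k, l) = (fst p, snd p) \<longleftrightarrow> p = (k, l)" "(k, l) = (- fst p, - snd p) \<longleftrightarrow> p = (- k, - l)"
      by (cases p; auto)+
    then show "c p * (\<integral>x. wave (fst p) (snd p) 0 x * wave k l s x \<partial>torus_lebesgue)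
      = c p * ((if p = (k, l) then cos s / 2 else 0) + (if p = (- k, - l) then cos s / 2 else 0))"
      by (simp only: integral_wave_wave[OF ne])
  qed
  also have "\<dots> = (\<Sum>p\<in>B. if p = (k, l) then c p * cos s / 2 else 0) + (\<Sum>p\<in>B. if p = (- k, - l) then c p * cos s / 2 else 0)"
    unfolding sum.distrib[symmetric] by (rule sum.cong) (auto simp: distrib_left)
  also have "\<dots> = (if k = 0 \<and> l = 0 then 0 else Im \<tau> / (2 * pi * freq \<tau> k l) * cos s)"
    using assms fin by (auto simp: B_def c_def freq_uminus)
  finally show ?thesis .
qed

text \<open>The correction \<open>4 / (N + 1)\<close> makes the bound inductive by telescoping.\<close>

lemma sum_inverse_squares_bound:
  "(\<Sum>k\<in>{- int N..int N}. 1 / (1 + (real_of_int k)\<^sup>2)) \<le> 5 - 4 / (real N + 1)"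
proof (induction N)
  case (Suc N)
  have *: "{- int (Suc N)..int (Suc N)} = insert (int N + 1) (insert (- int N - 1) {- int N..int N})"
    by auto
  have "(\<Sum>k\<in>{- int (Suc N)..int (Suc N)}. 1 / (1 + (real_of_int k)\<^sup>2))
    = 2 / (1 + (real N + 1)\<^sup>2) + (\<Sum>k\<in>{- int N..int N}. 1 / (1 + (real_of_int k)\<^sup>2))"
    unfolding * by (simp add: power2_eq_square algebra_simps)
  also have "2 / (1 + (real N + 1)\<^sup>2) \<le> 4 / ((real N + 1) * (real N + 2))"
  proof -
    have "(real N + 1) * (real N + 2) \<le> 2 * (1 + (real N + 1)\<^sup>2)"
      by (simp add: power2_eq_square algebra_simps)
    then have "4 / (2 * (1 + (real N + 1)\<^sup>2)) \<le> 4 / ((real N + 1) * (real N + 2))"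
      by (intro divide_left_mono mult_pos_pos) (simp_all add: add_pos_nonneg)
    moreover have "2 / t = 4 / (2 * t)" for t :: real by simp
    ultimately show ?thesis by (simp only:)
  qed
  also have "4 / ((real N + 1) * (real N + 2)) = 4 / (real N + 1) - 4 / (real (Suc N) + 1)"
    by (simp add: diff_frac_eq add_ac)
  finally show ?case using Suc by simp
qed simp

text \<open>By orthogonality the integral is the sum of the squared coefficients. The form \<open>freq\<close> dominates a
  multiple of \<open>1 + k\<^sup>2 + l\<^sup>2\<close> away from the origin, so the squared coefficients are dominated by a
  product of two summable sequences.\<close>

lemma green_kernel_square_bound:
  assumes \<tau>: "0 < Im \<tau>"
  shows "\<exists>S\<ge>0. \<forall>N. (\<integral>x. (green_kernel \<tau> N x)\<^sup>2 \<partial>torus_lebesgue) \<le> S"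
proof -
  define m where "m = 2 * (1 / (Im \<tau>)\<^sup>2 + 2 + 2 * (Re \<tau>)\<^sup>2 / (Im \<tau>)\<^sup>2)"
  have m: "0 < m" using \<tau> by (auto simp: m_def intro!: add_pos_nonneg)
  have below: "(1 + (real_of_int k)\<^sup>2) * (1 + (real_of_int l)\<^sup>2) \<le> (m * freq \<tau> k l)\<^sup>2"
    if "k \<noteq> 0 \<or> l \<noteq> 0" for k l
  proof -
    let ?k = "real_of_int k" and ?l = "real_of_int l" and ?f = "freq \<tau> k l"
    have k2: "?k\<^sup>2 * (Im \<tau>)\<^sup>2 \<le> ?f" by (simp add: freq_expand power_mult_distrib)
    then have k: "?k\<^sup>2 \<le> ?f / (Im \<tau>)\<^sup>2" using \<tau> by (simp add: field_simps)
    have "?l\<^sup>2 \<le> 2 * (?l - ?k * Re \<tau>)\<^sup>2 + 2 * (?k * Re \<tau>)\<^sup>2"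
      using sum_power2_ge_zero[of "?l - 2 * (?k * Re \<tau>)" 0] by (simp add: power2_eq_square algebra_simps)
    also have "\<dots> \<le> 2 * ?f + 2 * (?f / (Im \<tau>)\<^sup>2 * (Re \<tau>)\<^sup>2)"
    proof -
      have "(?k * Re \<tau>)\<^sup>2 \<le> ?f / (Im \<tau>)\<^sup>2 * (Re \<tau>)\<^sup>2"
        unfolding power_mult_distrib by (rule mult_right_mono[OF k]) simp
      moreover have "(?l - ?k * Re \<tau>)\<^sup>2 \<le> ?f" by (simp add: freq_expand)
      ultimately show ?thesis by linarith
    qed
    finally have l: "?l\<^sup>2 \<le> 2 * ?f + 2 * (?f / (Im \<tau>)\<^sup>2 * (Re \<tau>)\<^sup>2)" .
    have "1 \<le> ?k\<^sup>2 + ?l\<^sup>2"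
    proof -
      have "1 \<le> k\<^sup>2 + l\<^sup>2" using that by (smt (verit) zero_less_power2 zero_le_power2)
      then have "real_of_int 1 \<le> real_of_int (k\<^sup>2 + l\<^sup>2)" by (simp only: of_int_le_iff)
      then show ?thesis by simp
    qed
    then have "1 + ?k\<^sup>2 + ?l\<^sup>2 \<le> 2 * (?k\<^sup>2 + ?l\<^sup>2)" by simp
    also have "\<dots> \<le> m * ?f" using k l by (simp add: m_def algebra_simps)
    finally have "1 + ?k\<^sup>2 + ?l\<^sup>2 \<le> m * ?f" .
    then have "(1 + ?k\<^sup>2 + ?l\<^sup>2)\<^sup>2 \<le> (m * ?f)\<^sup>2" by (intro power_mono) auto
    moreover have "(1 + ?k\<^sup>2) * (1 + ?l\<^sup>2) \<le> (1 + ?k\<^sup>2 + ?l\<^sup>2)\<^sup>2"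
    proof -
      have "(1 + ?k\<^sup>2 + ?l\<^sup>2)\<^sup>2 = (1 + ?k\<^sup>2) * (1 + ?l\<^sup>2) + (?k\<^sup>2 + ?l\<^sup>2 + ?k\<^sup>2 * ?l\<^sup>2 + (?k\<^sup>2)\<^sup>2 + (?l\<^sup>2)\<^sup>2)"
        by (simp add: power2_eq_square algebra_simps)
      then show ?thesis by simp
    qed
    ultimately show ?thesis by linarith
  qed
  define C where "C = (Im \<tau> / (2 * pi) * m)\<^sup>2"
  have sq: "(\<integral>x. (green_kernel \<tau> N x)\<^sup>2 \<partial>torus_lebesgue) \<le> C * 25" for N
  proof -
    define I where "I = {- int N..int N}"
    define B where "B = I \<times> I - {(0, 0)}"
    define c where "c p = Im \<tau> / (2 * pi * freq \<tau> (fst p) (snd p))" for p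
    have B: "finite B" "\<And>p. p \<in> B \<Longrightarrow> fst p \<noteq> 0 \<or> snd p \<noteq> 0"
      "\<And>p. p \<in> B \<Longrightarrow> \<bar>fst p\<bar> \<le> int N \<and> \<bar>snd p\<bar> \<le> int N"
      by (auto simp: B_def I_def)
    have "(\<integral>x. (green_kernel \<tau> N x)\<^sup>2 \<partial>torus_lebesgue)
      = (\<integral>x. (\<Sum>p\<in>B. c p * (green_kernel \<tau> N x * wave (fst p) (snd p) 0 x)) \<partial>torus_lebesgue)"
      unfolding power2_eq_square
      by (subst (2) green_kernel_def)
        (simp add: sum_distrib_left case_prod_unfold B_def I_def c_def mult_ac)
    also have "\<dots> = (\<Sum>p\<in>B. c p * (\<integral>x. green_kernel \<tau> N x * wave (fst p) (snd p) 0 x \<partial>torus_lebesgue))"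
      using integrable_torus_continuous[OF continuous_on_mult[OF continuous_green_kernel continuous_wave]] by simp
    also have "\<dots> = (\<Sum>p\<in>B. (c p)\<^sup>2)"
      using B by (intro sum.cong) (auto simp: integral_green_kernel_wave c_def power2_eq_square)
    also have "\<dots> \<le> (\<Sum>p\<in>B. C * (1 / (1 + (real_of_int (fst p))\<^sup>2) * (1 / (1 + (real_of_int (snd p))\<^sup>2))))"
    proof (rule sum_mono)
      fix p assume p: "p \<in> B"
      let ?w = "(1 + (real_of_int (fst p))\<^sup>2) * (1 + (real_of_int (snd p))\<^sup>2)" and ?f = "freq \<tau> (fst p) (snd p)"
      have f: "0 < ?f" by (rule freq_pos[OF \<tau> B(2)[OF p]])
      have w: "0 < ?w" by (intro mult_pos_pos add_pos_nonneg) auto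
      have "(c p)\<^sup>2 = C / (m * ?f)\<^sup>2"
        using m f by (simp add: c_def C_def power_divide power_mult_distrib)
      also have "\<dots> \<le> C / ?w"
      proof (rule divide_left_mono[OF below[OF B(2)[OF p]]])
        show "0 \<le> C" by (simp add: C_def)
        have "0 < (m * ?f)\<^sup>2" using m f by simp
        then show "0 < (m * ?f)\<^sup>2 * ?w" using w by (rule mult_pos_pos)
      qed
      finally show "(c p)\<^sup>2 \<le> C * (1 / (1 + (real_of_int (fst p))\<^sup>2) * (1 / (1 + (real_of_int (snd p))\<^sup>2)))"
        by simp
    qed
    also have "\<dots> \<le> (\<Sum>p\<in>I \<times> I. C * (1 / (1 + (real_of_int (fst p))\<^sup>2) * (1 / (1 + (real_of_int (snd p))\<^sup>2))))"
      by (rule sum_mono2) (auto simp: B_def I_def C_def)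
    also have "\<dots> = C * ((\<Sum>k\<in>I. 1 / (1 + (real_of_int k)\<^sup>2)) * (\<Sum>k\<in>I. 1 / (1 + (real_of_int k)\<^sup>2)))"
      by (subst sum_product, subst sum.cartesian_product, subst sum_distrib_left) (simp only: case_prod_unfold)
    also have "\<dots> \<le> C * (5 * 5)"
    proof -
      have "0 \<le> 4 / (real N + 1)" by simp
      then have "(\<Sum>k\<in>I. 1 / (1 + (real_of_int k)\<^sup>2)) \<le> 5"
        using sum_inverse_squares_bound[of N] unfolding I_def by linarith
      then show ?thesis by (intro mult_left_mono mult_mono sum_nonneg) (auto simp: C_def)
    qed
    finally show ?thesis by simp
  qed
  moreover have "0 \<le> C * 25" by (simp add: C_def)
  ultimately show ?thesis by blast
qed

lemma green_kernel_eventually_trig: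
  assumes \<tau>: "0 < Im \<tau>" and G: "green_function \<tau> G"
  shows "\<exists>N0. \<forall>N\<ge>N0. (\<integral>x. G x * trig cs x \<partial>torus_lebesgue) = (\<integral>x. green_kernel \<tau> N x * trig cs x \<partial>torus_lebesgue)"
proof (induction cs)
  case (Cons t cs)
  obtain r k l s where t: "t = (r, k, l, s)" by (cases t) auto
  obtain N0 where N0: "\<forall>N\<ge>N0. (\<integral>x. G x * trig cs x \<partial>torus_lebesgue) = (\<integral>x. green_kernel \<tau> N x * trig cs x \<partial>torus_lebesgue)"
    using Cons by blast
  have *: "(\<integral>x. K x * trig (t # cs) x \<partial>torus_lebesgue)
     = r * (\<integral>x. K x * wave k l s x \<partial>torus_lebesgue) + (\<integral>x. K x * trig cs x \<partial>torus_lebesgue)"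
    if K: "integrable torus_lebesgue K" for K
  proof -
    have "(\<lambda>x. K x * trig (t # cs) x) = (\<lambda>x. r * (K x * wave k l s x) + K x * trig cs x)"
      by (auto simp: t algebra_simps)
    then show ?thesis
      using integrable_mult_continuous[OF K continuous_wave] integrable_mult_continuous[OF K continuous_trig] by simp
  qed
  have "(\<integral>x. G x * trig (t # cs) x \<partial>torus_lebesgue) = (\<integral>x. green_kernel \<tau> N x * trig (t # cs) x \<partial>torus_lebesgue)"
    if N: "max N0 (nat (max \<bar>k\<bar> \<bar>l\<bar>)) \<le> N" for N
  proof -
    have "\<bar>k\<bar> \<le> int N" "\<bar>l\<bar> \<le> int N" using N by auto
    then show ?thesis
      using N N0 unfolding *[OF green_function_integrable[OF \<tau> G]]
        *[OF integrable_torus_continuous[OF continuous_green_kernel]]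
      by (simp add: green_function_fourier[OF \<tau> G] integral_green_kernel_wave)
  qed
  then show ?case by blast
qed simp

text \<open>The Green function is bounded as a functional for the \<open>L\<^sup>2\<close> norm because its Fourier coefficients
  are square summable: on trigonometric polynomials it acts as a truncated Fourier series, and
  these are dense for uniform convergence.\<close>

lemma green_function_L2_bound:
  assumes \<tau>: "0 < Im \<tau>" and G: "green_function \<tau> G"
  shows "\<exists>C\<ge>0. \<forall>f. continuous_on UNIV f \<longrightarrow>
    \<bar>\<integral>x. G x * f x \<partial>torus_lebesgue\<bar> \<le> C * sqrt (\<integral>x. (f x)\<^sup>2 \<partial>torus_lebesgue)"
proof -
  obtain S where S: "0 \<le> S" "\<And>N. (\<integral>x. (green_kernel \<tau> N x)\<^sup>2 \<partial>torus_lebesgue) \<le> S"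
    using green_kernel_square_bound[OF \<tau>] by blast
  define C where "C = (S + 1) / 2"
  have trig: "\<bar>\<integral>x. G x * trig cs x \<partial>torus_lebesgue\<bar> \<le> C * sqrt (\<integral>x. (trig cs x)\<^sup>2 \<partial>torus_lebesgue)" for cs
  proof -
    define F where "F = (\<integral>x. (trig cs x)\<^sup>2 \<partial>torus_lebesgue)"
    have c2: "continuous_on UNIV (\<lambda>x. (trig cs x)\<^sup>2)" by (intro continuous_intros)
    obtain N where N: "(\<integral>x. G x * trig cs x \<partial>torus_lebesgue) = (\<integral>x. green_kernel \<tau> N x * trig cs x \<partial>torus_lebesgue)"
      using green_kernel_eventually_trig[OF \<tau> G, of cs] order_refl by metis
    show ?thesis
    proof (cases "F = 0")
      case True
      then have "(trig cs x)\<^sup>2 = 0" for x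
        by (intro torus_integral_eq_0[OF c2]) (simp_all add: F_def)
      then show ?thesis by simp
    next
      case False
      have "0 \<le> F" by (simp add: F_def)
      then have F: "0 < F" using False by simp
      define t where "t = sqrt F"
      have t: "0 < t" "t * t = F" using F by (auto simp: t_def)
      \<comment> \<open>The Cauchy--Schwarz inequality in its additive form, with weight \<open>t\<close>.\<close>
      have "\<bar>\<integral>x. green_kernel \<tau> N x * trig cs x \<partial>torus_lebesgue\<bar>
        \<le> (\<integral>x. (t * (green_kernel \<tau> N x)\<^sup>2 + (trig cs x)\<^sup>2 / t) / 2 \<partial>torus_lebesgue)"
      proof (rule order_trans[OF integral_abs_bound integral_mono])
        fix x
        let ?u = "green_kernel \<tau> N x" and ?v = "trig cs x"
        have "0 \<le> (t * \<bar>?u\<bar> - \<bar>?v\<bar>)\<^sup>2 / t" using t by simp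
        also have "\<dots> = t * ?u\<^sup>2 + ?v\<^sup>2 / t - 2 * \<bar>?u * ?v\<bar>"
          using t by (simp add: power2_diff power_mult_distrib abs_mult field_simps) (simp add: power2_eq_square)
        finally show "\<bar>?u * ?v\<bar> \<le> (t * ?u\<^sup>2 + ?v\<^sup>2 / t) / 2" by simp
      qed (use t(1) in \<open>auto intro!: integrable_torus_continuous continuous_intros continuous_green_kernel\<close>)
      also have "\<dots> = (t * (\<integral>x. (green_kernel \<tau> N x)\<^sup>2 \<partial>torus_lebesgue) + F / t) / 2"
      proof -
        have "integrable torus_lebesgue (\<lambda>x. (green_kernel \<tau> N x)\<^sup>2)" "integrable torus_lebesgue (\<lambda>x. (trig cs x)\<^sup>2)"
          by (auto intro!: integrable_torus_continuous continuous_intros continuous_green_kernel)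
        then show ?thesis by (simp add: F_def)
      qed
      also have "\<dots> \<le> (t * S + t) / 2"
        using t S(2)[of N] by (intro divide_right_mono add_mono mult_left_mono) (auto simp: field_simps)
      also have "\<dots> = C * sqrt F" by (simp add: C_def t_def algebra_simps)
      finally show ?thesis unfolding N F_def .
    qed
  qed
  have "\<bar>\<integral>x. G x * f x \<partial>torus_lebesgue\<bar> \<le> C * sqrt (\<integral>x. (f x)\<^sup>2 \<partial>torus_lebesgue)"
    if f: "continuous_on UNIV f" for f
  proof -
    have "\<exists>cs. \<forall>x. \<bar>f x - trig cs x\<bar> < 1 / (real n + 1)" for n
      using trig_dense[OF f, of "1 / (real n + 1)"] by auto
    then obtain p where p: "\<And>n x. \<bar>f x - trig (p n) x\<bar> < 1 / (real n + 1)" by metis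
    obtain B where B: "0 < B" "\<And>x. \<bar>f x\<bar> \<le> B" using torus_continuous_bounded[OF f] by blast
    have pB: "\<bar>trig (p n) x\<bar> \<le> B + 1" for n x
    proof -
      have "1 / (real n + 1) \<le> 1" by simp
      then show ?thesis using p[of x n] B(2)[of x] by linarith
    qed
    have lim: "(\<lambda>n. trig (p n) x) \<longlonglongrightarrow> f x" for x
    proof (rule LIMSEQ_I)
      fix r :: real assume "0 < r"
      then obtain n0 where n0: "1 / (real n0 + 1) < r" using nat_approx_posE by (metis Suc_eq_plus1 of_nat_Suc add.commute)
      have "norm (trig (p n) x - f x) < r" if "n0 \<le> n" for n
      proof -
        have "1 / (real n + 1) \<le> 1 / (real n0 + 1)" using that by (simp add: frac_le)
        then show ?thesis using p[of x n] n0 by (simp add: abs_minus_commute)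
      qed
      then show "\<exists>n0. \<forall>n\<ge>n0. norm (trig (p n) x - f x) < r" by blast
    qed
    have Gm: "G \<in> borel_measurable torus_lebesgue" using green_function_measurable[OF G] by simp
    have fm: "f \<in> borel_measurable torus_lebesgue" using borel_measurable_continuous_onI[OF f] by simp
    have tm: "trig cs \<in> borel_measurable torus_lebesgue" for cs
      using borel_measurable_continuous_onI[OF continuous_trig] by simp
    have "(\<lambda>n. \<integral>x. G x * trig (p n) x \<partial>torus_lebesgue) \<longlonglongrightarrow> (\<integral>x. G x * f x \<partial>torus_lebesgue)"
    proof (rule integral_dominated_convergence[where w = "\<lambda>x. \<bar>G x\<bar> * (B + 1)"])
      show "integrable torus_lebesgue (\<lambda>x. \<bar>G x\<bar> * (B + 1))"
        using green_function_integrable[OF \<tau> G] by simp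
      show "AE x in torus_lebesgue. (\<lambda>n. G x * trig (p n) x) \<longlonglongrightarrow> G x * f x"
        using lim by (auto intro!: tendsto_intros)
      show "AE x in torus_lebesgue. norm (G x * trig (p n) x) \<le> \<bar>G x\<bar> * (B + 1)" for n
        using pB by (auto simp: abs_mult intro!: mult_left_mono)
    qed (use Gm fm tm in auto)
    moreover have "(\<lambda>n. \<integral>x. (trig (p n) x)\<^sup>2 \<partial>torus_lebesgue) \<longlonglongrightarrow> (\<integral>x. (f x)\<^sup>2 \<partial>torus_lebesgue)"
    proof (rule integral_dominated_convergence[where w = "\<lambda>x. (B + 1)\<^sup>2"])
      show "AE x in torus_lebesgue. (\<lambda>n. (trig (p n) x)\<^sup>2) \<longlonglongrightarrow> (f x)\<^sup>2"
        using lim by (auto intro!: tendsto_intros)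
      show "AE x in torus_lebesgue. norm ((trig (p n) x)\<^sup>2) \<le> (B + 1)\<^sup>2" for n
        using pB B by (auto simp: abs_le_square_iff[symmetric])
    qed (use fm tm in auto)
    ultimately show ?thesis
      by (intro tendsto_le[OF sequentially_bot _ _ always_eventually[OF allI[OF trig]]])
        (auto intro!: tendsto_intros)
  qed
  moreover have "0 \<le> C" using S by (simp add: C_def)
  ultimately show ?thesis by blast
qed

section \<open>Change of variables in the Sobolev space\<close>

lemma test_fun_smooth: "smooth (test_fun f)"
  using test_fun by auto

lemma DERIV_dirderiv_at:
  assumes "smooth f"
  shows "((\<lambda>t. f (x + abs_torus (t *\<^sub>R v))) has_real_derivative dirderiv v f (x + abs_torus (t *\<^sub>R v))) (at t)"
proof -
  have "x + abs_torus (t *\<^sub>R v) + abs_torus (s *\<^sub>R v) = x + abs_torus ((s + t) *\<^sub>R v)" for s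
    by (simp add: scaleR_left_distrib abs_torus_add add_ac)
  then have "((\<lambda>s. f (x + abs_torus ((s + t) *\<^sub>R v))) has_real_derivative
      dirderiv v f (x + abs_torus (t *\<^sub>R v))) (at 0)"
    using DERIV_dirderiv[OF assms, of "x + abs_torus (t *\<^sub>R v)" v] by (simp only:)
  then show ?thesis
    using DERIV_shift[of "\<lambda>t. f (x + abs_torus (t *\<^sub>R v))" _ 0 t] by simp
qed

lemma continuous_torus_curve: "continuous_on UNIV (\<lambda>p :: real \<times> real. x + abs_torus (fst p *\<^sub>R v + snd p *\<^sub>R w))"
proof -
  have "continuous_on UNIV (\<lambda>p :: real \<times> real. fst p *\<^sub>R v + snd p *\<^sub>R w)" by (intro continuous_intros)
  from continuous_on_compose2[OF continuous_abs_torus this]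
  have "continuous_on UNIV (\<lambda>p :: real \<times> real. abs_torus (fst p *\<^sub>R v + snd p *\<^sub>R w))" by auto
  from continuous_on_compose2[OF continuous_torus_translate[of x] this] show ?thesis
    by (simp add: add.commute)
qed

text \<open>Smoothness is defined through one direction at a time; additivity in the direction is the
  statement that a function with continuous directional derivatives is differentiable.\<close>

lemma dirderiv_add_direction:
  assumes f: "smooth f"
  shows "dirderiv (v + w) f x = dirderiv v f x + dirderiv w f x"
proof -
  define g where "g p = dirderiv w f (x + abs_torus (fst p *\<^sub>R v + snd p *\<^sub>R w))" for p
  have g: "continuous_on UNIV g"
    using continuous_on_compose2[OF smooth_continuous[OF smooth_dirderiv[OF f]] continuous_torus_curve]
    by (auto simp: g_def)
  have x0: "x + abs_torus (0 *\<^sub>R v + 0 *\<^sub>R w) = x" "x + abs_torus 0 = x"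
    by (simp_all add: zero_torus.abs_eq[symmetric])
  define q where "q t = (f (x + abs_torus (t *\<^sub>R v + t *\<^sub>R w)) - f (x + abs_torus (t *\<^sub>R v))) / t" for t
  have mv: "\<exists>\<xi>. \<bar>\<xi>\<bar> \<le> \<bar>t\<bar> \<and> q t = g (t, \<xi>)" if t: "t \<noteq> 0" for t
  proof -
    define F where "F s = f (x + abs_torus (t *\<^sub>R v + s *\<^sub>R w))" for s
    have D: "(F has_real_derivative g (t, s)) (at s)" for s
      using DERIV_dirderiv_at[OF f, of "x + abs_torus (t *\<^sub>R v)" w s]
      by (simp add: F_def[abs_def] g_def abs_torus_add add.assoc)
    have qt: "q t = (F t - F 0) / t" by (simp add: q_def F_def)
    show ?thesis
    proof (cases "0 < t")
      case True
      obtain z where "0 < z" "z < t" "F t - F 0 = (t - 0) * g (t, z)"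
        using MVT2[of 0 t F "\<lambda>s. g (t, s)"] True D by blast
      then show ?thesis using True by (intro exI[of _ z]) (simp add: qt)
    next
      case False
      then have "t < 0" using t by simp
      then obtain z where "t < z" "z < 0" "F 0 - F t = (0 - t) * g (t, z)"
        using MVT2[of t 0 F "\<lambda>s. g (t, s)"] D by blast
      then show ?thesis using \<open>t < 0\<close> by (intro exI[of _ z]) (simp add: qt field_simps)
    qed
  qed
  have "q \<midarrow>0\<rightarrow> g (0, 0)"
  proof (rule LIM_I)
    fix r :: real assume "0 < r"
    then obtain \<delta> where \<delta>: "0 < \<delta>" "\<And>p. dist p (0, 0) < \<delta> \<Longrightarrow> dist (g p) (g (0, 0)) < r"
      using g unfolding continuous_on_iff by (metis UNIV_I)
    show "\<exists>s>0. \<forall>t. t \<noteq> 0 \<and> norm (t - 0) < s \<longrightarrow> norm (q t - g (0, 0)) < r"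
    proof (intro exI[of _ "\<delta> / 2"] conjI allI impI)
      fix t :: real assume t: "t \<noteq> 0 \<and> norm (t - 0) < \<delta> / 2"
      then obtain \<xi> where \<xi>: "\<bar>\<xi>\<bar> \<le> \<bar>t\<bar>" "q t = g (t, \<xi>)" using mv by blast
      have "dist (t, \<xi>) (0, 0) \<le> \<bar>t\<bar> + \<bar>\<xi>\<bar>"
        using sqrt_sum_squares_le_sum_abs[of t \<xi>] by (simp add: dist_Pair_Pair)
      then have "dist (t, \<xi>) (0, 0) < \<delta>" using t \<xi> by simp
      then show "norm (q t - g (0, 0)) < r" using \<delta>(2) \<xi>(2) by (simp add: dist_norm)
    qed (use \<delta> in simp)
  qed
  moreover have "(\<lambda>t. (f (x + abs_torus (t *\<^sub>R v)) - f x) / t) \<midarrow>0\<rightarrow> dirderiv v f x"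
    using DERIV_dirderiv[OF f, of x v] by (simp add: DERIV_def x0)
  ultimately have "(\<lambda>t. q t + (f (x + abs_torus (t *\<^sub>R v)) - f x) / t) \<midarrow>0\<rightarrow> g (0, 0) + dirderiv v f x"
    by (rule tendsto_add)
  then have "((\<lambda>t. f (x + abs_torus (t *\<^sub>R (v + w)))) has_real_derivative g (0, 0) + dirderiv v f x) (at 0)"
    by (simp add: DERIV_def q_def x0 scaleR_right_distrib diff_divide_distrib)
  then show ?thesis
    unfolding dirderiv_def[of "v + w"] by (simp add: DERIV_imp_deriv g_def zero_torus.abs_eq[symmetric])
qed

lemma dirderiv_scale_direction:
  assumes f: "smooth f"
  shows "dirderiv (r *\<^sub>R v) f x = r * dirderiv v f x"
proof -
  have "((\<lambda>t. f (x + abs_torus (t *\<^sub>R v))) has_real_derivative dirderiv v f x) (at (0 * r))"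
    using DERIV_dirderiv[OF f] by simp
  moreover have "((\<lambda>t. t * r) has_real_derivative r) (at 0)"
    by (auto intro!: derivative_eq_intros)
  ultimately have "((\<lambda>t. f (x + abs_torus ((t * r) *\<^sub>R v))) has_real_derivative dirderiv v f x * r) (at 0)"
    by (rule DERIV_chain'[rotated])
  then show ?thesis
    unfolding dirderiv_def[of "r *\<^sub>R v"] by (simp add: DERIV_imp_deriv mult.commute)
qed

lemma dirderiv_coordinates:
  assumes f: "smooth f"
  shows "dirderiv (v1, v2) f x = v1 * dirderiv (1, 0) f x + v2 * dirderiv (0, 1) f x"
proof -
  have "(v1, v2) = v1 *\<^sub>R (1, 0) + v2 *\<^sub>R (0, 1)" by simp
  then show ?thesis
    by (simp only: dirderiv_add_direction[OF f] dirderiv_scale_direction[OF f])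
qed

lemma torus_map_curve:
  "torus_map a b c d (x + abs_torus (t *\<^sub>R (v1, v2)))
    = torus_map a b c d x + abs_torus (t *\<^sub>R (of_int d * v1 + of_int b * v2, of_int c * v1 + of_int a * v2))"
  by (simp add: torus_map_add torus_map_abs algebra_simps)

lemma dirderiv_torus_map:
  "dirderiv (v1, v2) (\<lambda>x. f (torus_map a b c d x)) x
    = dirderiv (of_int d * v1 + of_int b * v2, of_int c * v1 + of_int a * v2) f (torus_map a b c d x)"
  unfolding dirderiv_def torus_map_curve ..

lemma smooth_torus_map:
  assumes "smooth f" shows "smooth (\<lambda>x. f (torus_map a b c d x))"
  using assms
proof (coinduction arbitrary: f rule: smooth.coinduct)
  case smooth
  have "continuous_on UNIV (\<lambda>x. f (torus_map a b c d x))"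
    using continuous_on_compose2[OF smooth_continuous[OF smooth] continuous_torus_map] by auto
  moreover have "(\<lambda>t. f (torus_map a b c d (x + abs_torus (t *\<^sub>R v)))) differentiable at 0" for v x
  proof -
    obtain v1 v2 where v: "v = (v1, v2)" by fastforce
    show ?thesis
      unfolding v torus_map_curve real_differentiable_def using DERIV_dirderiv[OF smooth] by blast
  qed
  moreover have "\<exists>f'. dirderiv v (\<lambda>x. f (torus_map a b c d x)) = (\<lambda>x. f' (torus_map a b c d x)) \<and> smooth f'" for v
  proof -
    obtain v1 v2 where v: "v = (v1, v2)" by fastforce
    show ?thesis
      unfolding v by (rule exI, rule conjI, rule ext, rule dirderiv_torus_map) (rule smooth_dirderiv[OF smooth])
  qed
  ultimately show ?case by blast
qed

lemma norm_test_square: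
  "(norm f)\<^sup>2 = (\<integral>x. (test_fun f x)\<^sup>2 + (dirderiv (1,0) (test_fun f) x)\<^sup>2 + (dirderiv (0,1) (test_fun f) x)\<^sup>2 \<partial>torus_lebesgue)"
  unfolding power2_norm_eq_inner inner_test_def by (simp add: power2_eq_square)

lemma continuous_test_fun [continuous_intros]: "continuous_on UNIV (test_fun f)"
  by (rule smooth_continuous[OF test_fun_smooth])

lemma continuous_dirderiv_test_fun [continuous_intros]: "continuous_on UNIV (dirderiv v (test_fun f))"
  by (rule smooth_continuous[OF smooth_dirderiv[OF test_fun_smooth]])

lemma L2_norm_le_norm_test: "sqrt (\<integral>x. (test_fun f x)\<^sup>2 \<partial>torus_lebesgue) \<le> norm f"
proof -
  have "(\<integral>x. (test_fun f x)\<^sup>2 \<partial>torus_lebesgue) \<le> (norm f)\<^sup>2"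
    unfolding norm_test_square
    by (intro integral_mono integrable_torus_continuous continuous_intros) (auto simp: add_nonneg_nonneg)
  then show ?thesis by (intro real_le_lsqrt) auto
qed

text \<open>Composition of fields with a unimodular map is dual to composition of test functions with the
  inverse map.\<close>

definition comp_test :: "int \<Rightarrow> int \<Rightarrow> int \<Rightarrow> int \<Rightarrow> test \<Rightarrow> test" where
  "comp_test a b c d f = Abs_test (\<lambda>x. test_fun f (torus_map a b c d x))"

lemma test_fun_comp_test: "test_fun (comp_test a b c d f) = (\<lambda>x. test_fun f (torus_map a b c d x))"
  unfolding comp_test_def by (rule Abs_test_inverse) (simp add: smooth_torus_map test_fun_smooth)

text \<open>The gradient is multiplied by the matrix of the map, whose norm is at most its
  Hilbert--Schmidt norm, and the map preserves \<open>\<lambda>\<close>.\<close>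

lemma norm_comp_test:
  assumes det: "a * d - b * c = 1"
  shows "norm (comp_test a b c d f)
    \<le> norm f * sqrt (1 + (of_int d)\<^sup>2 + (of_int c)\<^sup>2 + (of_int b)\<^sup>2 + (of_int a)\<^sup>2)" (is "_ \<le> _ * sqrt ?K")
proof -
  let ?f = "test_fun f" and ?A = "torus_map a b c d"
  let ?e = "\<lambda>x. (?f x)\<^sup>2 + (dirderiv (1,0) ?f x)\<^sup>2 + (dirderiv (0,1) ?f x)\<^sup>2"
  have cauchy: "(u * p + v * q)\<^sup>2 \<le> (u\<^sup>2 + v\<^sup>2) * (p\<^sup>2 + q\<^sup>2)" for u v p q :: real
    using zero_le_power2[of "u * q - v * p"] by (simp add: power2_eq_square algebra_simps)
  have "(norm (comp_test a b c d f))\<^sup>2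
    = (\<integral>x. (?f (?A x))\<^sup>2 + (dirderiv (of_int d, of_int c) ?f (?A x))\<^sup>2 + (dirderiv (of_int b, of_int a) ?f (?A x))\<^sup>2 \<partial>torus_lebesgue)"
    by (simp add: norm_test_square test_fun_comp_test dirderiv_torus_map)
  also have "\<dots> = (\<integral>x. (?f x)\<^sup>2 + (dirderiv (of_int d, of_int c) ?f x)\<^sup>2 + (dirderiv (of_int b, of_int a) ?f x)\<^sup>2 \<partial>torus_lebesgue)"
    by (rule integral_torus_map[OF det])
  also have "\<dots> \<le> (\<integral>x. ?K * ?e x \<partial>torus_lebesgue)"
  proof (intro integral_mono integrable_torus_continuous continuous_intros)
    fix x
    have "(dirderiv (of_int d, of_int c) ?f x)\<^sup>2 \<le> ((of_int d)\<^sup>2 + (of_int c)\<^sup>2) * ?e x"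
      unfolding dirderiv_coordinates[OF test_fun_smooth, of "of_int d"]
      by (rule order_trans[OF cauchy mult_left_mono]) auto
    moreover have "(dirderiv (of_int b, of_int a) ?f x)\<^sup>2 \<le> ((of_int b)\<^sup>2 + (of_int a)\<^sup>2) * ?e x"
      unfolding dirderiv_coordinates[OF test_fun_smooth, of "of_int b"]
      by (rule order_trans[OF cauchy mult_left_mono]) auto
    moreover have "(?f x)\<^sup>2 \<le> ?e x" by simp
    moreover have K: "?K * t = t + ((of_int d)\<^sup>2 + (of_int c)\<^sup>2) * t + ((of_int b)\<^sup>2 + (of_int a)\<^sup>2) * t" for t
      by (simp add: algebra_simps)
    ultimately show "(?f x)\<^sup>2 + (dirderiv (of_int d, of_int c) ?f x)\<^sup>2 + (dirderiv (of_int b, of_int a) ?f x)\<^sup>2 \<le> ?K * ?e x"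
      unfolding K by (intro add_mono)
  qed
  also have "\<dots> = ?K * (norm f)\<^sup>2" by (simp add: norm_test_square)
  finally have "(norm (comp_test a b c d f))\<^sup>2 \<le> (norm f * sqrt ?K)\<^sup>2"
    by (simp add: power_mult_distrib mult.commute)
  then show ?thesis by (rule power2_le_imp_le) simp
qed

lemma bounded_linear_comp_test:
  assumes det: "a * d - b * c = 1"
  shows "bounded_linear (comp_test a b c d)"
proof (rule bounded_linear_intro[OF _ _ norm_comp_test[OF det]])
  show "comp_test a b c d (f + g) = comp_test a b c d f + comp_test a b c d g" for f g
    by (simp add: test_fun_inject[symmetric] test_fun_comp_test plus_test.rep_eq)
  show "comp_test a b c d (r *\<^sub>R f) = r *\<^sub>R comp_test a b c d f" for r f
    by (simp add: test_fun_inject[symmetric] test_fun_comp_test scaleR_test.rep_eq)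
qed

lemma comp_test_inverse:
  assumes det: "a * d - b * c = 1"
  shows "comp_test a b c d (comp_test d (- b) (- c) a f) = f"
    "comp_test d (- b) (- c) a (comp_test a b c d f) = f"
  by (simp_all add: test_fun_inject[symmetric] test_fun_comp_test torus_map_inverse[OF det] torus_map_inverse'[OF det])

lemma det_inverse: "a * d - b * c = (1 :: int) \<Longrightarrow> d * a - - b * - c = 1"
  by (simp add: mult.commute)

lemma hm1_comp_apply:
  assumes det: "a * d - b * c = 1"
  shows "blinfun_apply (hm1_comp u (torus_map a b c d)) f = blinfun_apply u (comp_test d (- b) (- c) a f)"
proof -
  have "(\<lambda>f. blinfun_apply u (Abs_test (test_fun f \<circ> inv (torus_map a b c d))))
    = (\<lambda>f. blinfun_apply u (comp_test d (- b) (- c) a f))"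
    by (simp add: comp_test_def inv_torus_map[OF det] comp_def)
  moreover have "bounded_linear (\<lambda>f. blinfun_apply u (comp_test d (- b) (- c) a f))"
    using bounded_linear_compose[OF blinfun.bounded_linear_right bounded_linear_comp_test[OF det_inverse[OF det]]] .
  ultimately show ?thesis by (simp add: hm1_comp_def bounded_linear_Blinfun_apply)
qed

lemma hm1_comp_inverse:
  assumes det: "a * d - b * c = 1"
  shows "hm1_comp (hm1_comp u (torus_map a b c d)) (torus_map d (- b) (- c) a) = u"
  by (rule blinfun_eqI)
    (use hm1_comp_apply[OF det_inverse[OF det]] in \<open>simp add: hm1_comp_apply[OF det] comp_test_inverse[OF det]\<close>)

lemma hm1_comp_add:
  assumes det: "a * d - b * c = 1"
  shows "hm1_comp (u + v) (torus_map a b c d) = hm1_comp u (torus_map a b c d) + hm1_comp v (torus_map a b c d)"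
  by (rule blinfun_eqI) (simp add: hm1_comp_apply[OF det] blinfun.add_left)

lemma continuous_hm1_comp:
  assumes det: "a * d - b * c = 1"
  shows "continuous_on UNIV (\<lambda>u. hm1_comp u (torus_map a b c d))"
proof -
  define B where "B = Blinfun (comp_test d (- b) (- c) a)"
  have "blinfun_apply B = comp_test d (- b) (- c) a"
    unfolding B_def by (rule bounded_linear_Blinfun_apply[OF bounded_linear_comp_test[OF det_inverse[OF det]]])
  then have "hm1_comp u (torus_map a b c d) = u o\<^sub>L B" for u
    by (intro blinfun_eqI) (simp add: hm1_comp_apply[OF det])
  then show ?thesis by (simp add: continuous_intros)
qed

text \<open>For these functions integration against a test function is bounded, so that they define elements
  of \<open>H\<^sup>-\<^sup>1\<close>. The class is stable under sums and under changes of variables that preserve \<open>\<lambda>\<close>, and it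
  contains the translated Green functions.\<close>

definition L2_functional :: "(torus \<Rightarrow> real) \<Rightarrow> bool" where
  "L2_functional h \<longleftrightarrow> integrable torus_lebesgue h \<and>
     (\<exists>C\<ge>0. \<forall>f. continuous_on UNIV f \<longrightarrow>
        \<bar>\<integral>x. h x * f x \<partial>torus_lebesgue\<bar> \<le> C * sqrt (\<integral>x. (f x)\<^sup>2 \<partial>torus_lebesgue))"

lemma fun_hm1_apply:
  assumes "L2_functional h"
  shows "blinfun_apply (fun_hm1 h) f = (\<integral>x. h x * test_fun f x \<partial>torus_lebesgue)"
proof -
  obtain C where h: "integrable torus_lebesgue h" and C: "0 \<le> C"
    "\<And>f. continuous_on UNIV f \<Longrightarrow> \<bar>\<integral>x. h x * f x \<partial>torus_lebesgue\<bar> \<le> C * sqrt (\<integral>x. (f x)\<^sup>2 \<partial>torus_lebesgue)"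
    using assms unfolding L2_functional_def by blast
  note i = integrable_mult_continuous[OF h continuous_test_fun]
  have "bounded_linear (\<lambda>f. \<integral>x. h x * test_fun f x \<partial>torus_lebesgue)"
  proof (rule bounded_linear_intro[where K = C])
    show "(\<integral>x. h x * test_fun (f + g) x \<partial>torus_lebesgue)
      = (\<integral>x. h x * test_fun f x \<partial>torus_lebesgue) + (\<integral>x. h x * test_fun g x \<partial>torus_lebesgue)" for f g
      using i[of f] i[of g] by (simp add: plus_test.rep_eq distrib_left)
    show "(\<integral>x. h x * test_fun (r *\<^sub>R f) x \<partial>torus_lebesgue) = r *\<^sub>R (\<integral>x. h x * test_fun f x \<partial>torus_lebesgue)" for r f
      by (simp add: scaleR_test.rep_eq mult.left_commute)
    show "norm (\<integral>x. h x * test_fun f x \<partial>torus_lebesgue) \<le> norm f * C" for f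
      using order_trans[OF C(2)[OF continuous_test_fun] mult_left_mono[OF L2_norm_le_norm_test C(1)], of f]
      by (simp add: mult.commute)
  qed
  then show ?thesis by (simp add: fun_hm1_def Let_def bounded_linear_Blinfun_apply)
qed

lemma L2_functional_const: "L2_functional (\<lambda>_. k)"
proof -
  have "\<bar>\<integral>x. k * f x \<partial>torus_lebesgue\<bar> \<le> \<bar>k\<bar> * sqrt (\<integral>x. (f x)\<^sup>2 \<partial>torus_lebesgue)"
    if f: "continuous_on UNIV f" for f
  proof -
    have i: "integrable torus_lebesgue f" "integrable torus_lebesgue (\<lambda>x. (f x)\<^sup>2)"
      using f by (auto intro!: integrable_torus_continuous continuous_intros)
    \<comment> \<open>The variance of \<open>f\<close> under \<open>\<lambda>\<close> is nonnegative.\<close>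
    have "(\<integral>x. f x \<partial>torus_lebesgue)\<^sup>2 \<le> (\<integral>x. (f x)\<^sup>2 \<partial>torus_lebesgue)"
      using torus_lebesgue.variance_positive[of f] torus_lebesgue.variance_eq[OF i] by simp
    then have "\<bar>\<integral>x. f x \<partial>torus_lebesgue\<bar> \<le> sqrt (\<integral>x. (f x)\<^sup>2 \<partial>torus_lebesgue)"
      by (simp add: real_le_rsqrt)
    then show ?thesis by (simp add: abs_mult mult_left_mono)
  qed
  then show ?thesis unfolding L2_functional_def by (intro conjI exI[of _ "\<bar>k\<bar>"]) auto
qed

lemma L2_functional_add:
  assumes "L2_functional g" "L2_functional h"
  shows "L2_functional (\<lambda>x. g x + h x)"
proof -
  obtain C where g: "integrable torus_lebesgue g" and C: "0 \<le> C"
    "\<And>f. continuous_on UNIV f \<Longrightarrow> \<bar>\<integral>x. g x * f x \<partial>torus_lebesgue\<bar> \<le> C * sqrt (\<integral>x. (f x)\<^sup>2 \<partial>torus_lebesgue)"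
    using assms(1) unfolding L2_functional_def by blast
  obtain D where h: "integrable torus_lebesgue h" and D: "0 \<le> D"
    "\<And>f. continuous_on UNIV f \<Longrightarrow> \<bar>\<integral>x. h x * f x \<partial>torus_lebesgue\<bar> \<le> D * sqrt (\<integral>x. (f x)\<^sup>2 \<partial>torus_lebesgue)"
    using assms(2) unfolding L2_functional_def by blast
  have "\<bar>\<integral>x. (g x + h x) * f x \<partial>torus_lebesgue\<bar> \<le> (C + D) * sqrt (\<integral>x. (f x)\<^sup>2 \<partial>torus_lebesgue)"
    if f: "continuous_on UNIV f" for f
    using integrable_mult_continuous[OF g f] integrable_mult_continuous[OF h f] C(2)[OF f] D(2)[OF f]
    by (simp add: distrib_right)
  then show ?thesis
    unfolding L2_functional_def using g h C(1) D(1) by (intro conjI exI[of _ "C + D"]) auto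
qed

lemma L2_functional_cmult:
  assumes "L2_functional h"
  shows "L2_functional (\<lambda>x. r * h x)"
proof -
  obtain C where h: "integrable torus_lebesgue h" and C: "0 \<le> C"
    "\<And>f. continuous_on UNIV f \<Longrightarrow> \<bar>\<integral>x. h x * f x \<partial>torus_lebesgue\<bar> \<le> C * sqrt (\<integral>x. (f x)\<^sup>2 \<partial>torus_lebesgue)"
    using assms(1) unfolding L2_functional_def by blast
  have "\<bar>\<integral>x. r * h x * f x \<partial>torus_lebesgue\<bar> \<le> (\<bar>r\<bar> * C) * sqrt (\<integral>x. (f x)\<^sup>2 \<partial>torus_lebesgue)"
    if f: "continuous_on UNIV f" for f
    using mult_left_mono[OF C(2)[OF f], of "\<bar>r\<bar>"] by (simp add: mult.assoc abs_mult)
  then show ?thesis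
    unfolding L2_functional_def using h C(1) by (intro conjI exI[of _ "\<bar>r\<bar> * C"]) auto
qed

lemma L2_functional_bij:
  assumes h: "L2_functional h" and g: "continuous_on UNIV g" "continuous_on UNIV g'"
    and gg: "\<And>x. g (g' x) = x" "\<And>x. g' (g x) = x" and inv: "distr torus_lebesgue borel g = torus_lebesgue"
  shows "L2_functional (\<lambda>x. h (g x))"
proof -
  obtain C where hi: "integrable torus_lebesgue h" and C: "0 \<le> C"
    "\<And>f. continuous_on UNIV f \<Longrightarrow> \<bar>\<integral>x. h x * f x \<partial>torus_lebesgue\<bar> \<le> C * sqrt (\<integral>x. (f x)\<^sup>2 \<partial>torus_lebesgue)"
    using h unfolding L2_functional_def by blast
  have "\<bar>\<integral>x. h (g x) * f x \<partial>torus_lebesgue\<bar> \<le> C * sqrt (\<integral>x. (f x)\<^sup>2 \<partial>torus_lebesgue)"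
    if f: "continuous_on UNIV f" for f
  proof -
    have c: "continuous_on UNIV (\<lambda>x. f (g' x))" using continuous_on_compose2[OF f g(2)] by auto
    have "(\<integral>x. h (g x) * f x \<partial>torus_lebesgue) = (\<integral>x. h x * f (g' x) \<partial>torus_lebesgue)"
      using integral_invariant_bij[OF g gg(1) inv, of "\<lambda>x. h x * f (g' x)"] by (simp add: gg)
    moreover have "(\<integral>x. (f x)\<^sup>2 \<partial>torus_lebesgue) = (\<integral>x. (f (g' x))\<^sup>2 \<partial>torus_lebesgue)"
      using integral_invariant_bij[OF g gg(1) inv, of "\<lambda>x. (f (g' x))\<^sup>2"] by (simp add: gg)
    ultimately show ?thesis using C(2)[OF c] by simp
  qed
  then show ?thesis
    unfolding L2_functional_def using hi C(1) integrable_invariant_bij[OF g gg(1) inv, of h]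
    by (intro conjI exI[of _ C]) auto
qed

lemma L2_functional_green:
  assumes "0 < Im \<tau>" "green_function \<tau> G"
  shows "L2_functional (\<lambda>x. G (x - y))"
proof (rule L2_functional_bij[where g' = "\<lambda>x. x + y"])
  show "L2_functional G"
    unfolding L2_functional_def using green_function_L2_bound[OF assms] green_function_integrable[OF assms] by blast
  show "distr torus_lebesgue borel (\<lambda>x. x - y) = torus_lebesgue"
    using torus_lebesgue_translate[of "- y"] by simp
qed (auto intro: continuous_intros)

lemma L2_functional_H_insert:
  assumes "0 < Im \<tau>" "green_function \<tau> G"
  shows "L2_functional (H_insert G n z \<alpha>)"
proof (induction n)
  case 0
  then show ?case using L2_functional_const[of 0] by (simp add: H_insert_def[abs_def])
next
  case (Suc n)
  have "H_insert G (Suc n) z \<alpha> = (\<lambda>x. H_insert G n z \<alpha> x + \<alpha> n * G (x - z n))"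
    by (simp add: H_insert_def[abs_def])
  then show ?case
    using L2_functional_add[OF Suc L2_functional_cmult[OF L2_functional_green[OF assms]]] by simp
qed

lemma fun_hm1_add:
  assumes "L2_functional g" "L2_functional h"
  shows "fun_hm1 (\<lambda>x. g x + h x) = fun_hm1 g + fun_hm1 h"
proof (rule blinfun_eqI)
  fix f
  have "integrable torus_lebesgue (\<lambda>x. g x * test_fun f x)" "integrable torus_lebesgue (\<lambda>x. h x * test_fun f x)"
    using assms by (auto simp: L2_functional_def intro!: integrable_mult_continuous continuous_test_fun)
  then show "blinfun_apply (fun_hm1 (\<lambda>x. g x + h x)) f = blinfun_apply (fun_hm1 g + fun_hm1 h) f"
    using assms by (simp add: fun_hm1_apply L2_functional_add blinfun.add_left distrib_right)
qed

lemma hm1_comp_fun_hm1: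
  assumes det: "a * d - b * c = 1" and h: "L2_functional h"
  shows "hm1_comp (fun_hm1 h) (torus_map a b c d) = fun_hm1 (\<lambda>x. h (torus_map a b c d x))"
proof (rule blinfun_eqI)
  fix f
  have h': "L2_functional (\<lambda>x. h (torus_map a b c d x))"
    by (rule L2_functional_bij[OF h continuous_torus_map continuous_torus_map torus_map_inverse[OF det]
          torus_map_inverse'[OF det] torus_lebesgue_torus_map[OF det]])
  have "(\<integral>x. h x * test_fun f (torus_map d (- b) (- c) a x) \<partial>torus_lebesgue)
    = (\<integral>x. h (torus_map a b c d x) * test_fun f x \<partial>torus_lebesgue)"
    using integral_torus_map[OF det, of "\<lambda>x. h x * test_fun f (torus_map d (- b) (- c) a x)"]
    by (simp add: torus_map_inverse'[OF det])
  then show "blinfun_apply (hm1_comp (fun_hm1 h) (torus_map a b c d)) f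
      = blinfun_apply (fun_hm1 (\<lambda>x. h (torus_map a b c d x))) f"
    by (simp add: hm1_comp_apply[OF det] fun_hm1_apply h h' test_fun_comp_test)
qed

section \<open>Approximate identities\<close>

text \<open>The functions \<open>s\<^sup>-\<^sup>n exp (- 1 / s)\<close>, extended by \<open>0\<close>: a family that is closed under
  differentiation up to linear combinations, so that all its members are smooth.\<close>

definition flat :: "nat \<Rightarrow> real \<Rightarrow> real" where
  "flat n s = (if s \<le> 0 then 0 else (1 / s) ^ n / exp (1 / s))"

lemma flat_tendsto_0: "flat n \<midarrow>0\<rightarrow> 0"
proof -
  have r: "(flat n \<longlongrightarrow> 0) (at_right 0)"
  proof -
    have "((\<lambda>s :: real. (1 / s) ^ n / exp (1 / s)) \<longlongrightarrow> 0) (at_right 0)"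
      using filterlim_compose[OF tendsto_power_div_exp_0 filterlim_inverse_at_top_right] by (simp add: inverse_eq_divide)
    then show ?thesis
      by (rule Lim_transform_eventually) (auto simp: flat_def eventually_at_right_less eventually_at_filter)
  qed
  have l: "(flat n \<longlongrightarrow> 0) (at_left 0)"
    by (rule tendsto_eventually) (auto simp: flat_def eventually_at_filter)
  show ?thesis using filterlim_split_at[OF l r] by simp
qed

lemma flat_nonneg: "0 \<le> flat n s" by (simp add: flat_def)

lemma flat_pos_iff: "0 < flat n s \<longleftrightarrow> 0 < s" by (simp add: flat_def)

lemma DERIV_flat: "(flat n has_real_derivative - real n * flat (Suc n) s + flat (Suc (Suc n)) s) (at s)"
proof -
  consider "s < 0" | "s = 0" | "0 < s" by linarith
  then show ?thesis
  proof cases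
    case 1
    have "((\<lambda>_. 0) has_real_derivative 0) (at s)" by simp
    moreover have "\<forall>\<^sub>F t in nhds s. 0 = flat n t"
      using eventually_nhds_in_open[of "{..<0}" s] 1 by (auto simp: flat_def elim!: eventually_mono)
    ultimately have "(flat n has_real_derivative 0) (at s)" using DERIV_cong_ev[of s s "\<lambda>_. 0" "flat n" 0 0] by simp
    then show ?thesis using 1 by (simp add: flat_def)
  next
    case 2
    have "flat n h / h = flat (Suc n) h" for h by (simp add: flat_def)
    then have "(\<lambda>h. flat n h / h) \<midarrow>0\<rightarrow> 0" using flat_tendsto_0[of "Suc n"] by simp
    then show ?thesis by (simp add: 2 DERIV_def flat_def)
  next
    case 3
    have "((\<lambda>s. (1 / s) ^ n * exp (- (1 / s))) has_real_derivative
        - real n * ((1 / s) ^ Suc n * exp (- (1 / s))) + (1 / s) ^ Suc (Suc n) * exp (- (1 / s))) (at s)"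
    proof -
      have D1: "((\<lambda>s. 1 / s) has_real_derivative - ((1 / s) * (1 / s))) (at s)"
        using 3 by (auto intro!: derivative_eq_intros)
      have "((\<lambda>s. (1 / s) ^ n * exp (- (1 / s))) has_real_derivative
          real n * (- ((1 / s) * (1 / s)) * (1 / s) ^ (n - Suc 0)) * exp (- (1 / s))
          + exp (- (1 / s)) * (- (- ((1 / s) * (1 / s)))) * (1 / s) ^ n) (at s)"
        by (rule DERIV_mult[OF DERIV_power[OF D1] DERIV_fun_exp[OF DERIV_minus[OF D1]]])
      moreover have "real n * (- (t * t) * t ^ (n - Suc 0)) * E + E * (- (- (t * t))) * t ^ n
        = - real n * (t ^ Suc n * E) + t ^ Suc (Suc n) * E" for t E :: real
        by (cases n) (auto simp: algebra_simps)
      ultimately show ?thesis by (simp only:)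
    qed
    moreover have "\<forall>\<^sub>F t in nhds s. (1 / t) ^ n * exp (- (1 / t)) = flat n t"
      using eventually_nhds_in_open[of "{0<..}" s] 3
      by (auto simp: flat_def exp_minus divide_inverse elim!: eventually_mono)
    ultimately have "(flat n has_real_derivative
        - real n * ((1 / s) ^ Suc n * exp (- (1 / s))) + (1 / s) ^ Suc (Suc n) * exp (- (1 / s))) (at s)"
      by (rule DERIV_cong_ev[OF refl _ refl, THEN iffD1, rotated])
    then show ?thesis using 3 by (simp add: flat_def exp_minus divide_inverse)
  qed
qed

lemma continuous_flat: "continuous_on S (flat n)"
  using DERIV_continuous[OF DERIV_flat] continuous_at_imp_continuous_on by blast

text \<open>The algebra generated by waves and by the functions \<open>flat\<close> of shifted waves is closed under
  directional derivatives.\<close>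

inductive bump_algebra :: "real \<Rightarrow> (torus \<Rightarrow> real) \<Rightarrow> bool" for c where
  wave: "bump_algebra c (\<lambda>x. r * wave k l s x)"
| flat: "bump_algebra c (\<lambda>x. flat n (wave k l s x - c))"
| add: "bump_algebra c f \<Longrightarrow> bump_algebra c g \<Longrightarrow> bump_algebra c (\<lambda>x. f x + g x)"
| mult: "bump_algebra c f \<Longrightarrow> bump_algebra c g \<Longrightarrow> bump_algebra c (\<lambda>x. f x * g x)"

lemma bump_algebra_const: "bump_algebra c (\<lambda>_. r)"
  using bump_algebra.wave[of c r 0 0 0] by (simp add: wave_0)

lemma bump_algebra_continuous: "bump_algebra c f \<Longrightarrow> continuous_on UNIV f"
proof (induction rule: bump_algebra.induct)
  case (flat n k l s)
  show ?case
    by (rule continuous_on_compose2[OF continuous_flat[of UNIV]]) (auto intro!: continuous_intros)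
qed (auto intro!: continuous_intros)

lemma bump_algebra_DERIV:
  "bump_algebra c f \<Longrightarrow> \<exists>f'. bump_algebra c f' \<and>
    (\<forall>x. ((\<lambda>t. f (x + abs_torus (t *\<^sub>R v))) has_real_derivative f' x) (at 0))"
proof (induction rule: bump_algebra.induct)
  case (wave r k l s)
  show ?case using DERIV_wave bump_algebra.wave by blast
next
  case (flat n k l s)
  define w where "w = (\<lambda>x. 1 * (2 * pi * (of_int k * fst v + of_int l * snd v)) * wave k l (s + pi / 2) x)"
  let ?f = "\<lambda>x. (- real n * flat (Suc n) (wave k l s x - c) + flat (Suc (Suc n)) (wave k l s x - c)) * w x"
  have "bump_algebra c ?f"
    unfolding w_def
    by (rule bump_algebra.mult[OF bump_algebra.add[OF bump_algebra.mult[OF bump_algebra_const bump_algebra.flat]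
            bump_algebra.flat] bump_algebra.wave])
  moreover have "((\<lambda>t. flat n (wave k l s (x + abs_torus (t *\<^sub>R v)) - c)) has_real_derivative ?f x) (at 0)" for x
  proof -
    have "((\<lambda>t. wave k l s (x + abs_torus (t *\<^sub>R v)) - c) has_real_derivative w x) (at 0)"
      using DERIV_diff[OF DERIV_wave[of 1 k l s x v] DERIV_const[of c]] by (simp add: w_def)
    from DERIV_chain'[OF this DERIV_flat] show ?thesis
      by (simp add: zero_torus.abs_eq[symmetric])
  qed
  ultimately show ?case by blast
next
  case (add f g)
  then obtain f' g' where *: "bump_algebra c f'" "bump_algebra c g'"
    "\<forall>x. ((\<lambda>t. f (x + abs_torus (t *\<^sub>R v))) has_real_derivative f' x) (at 0)"
    "\<forall>x. ((\<lambda>t. g (x + abs_torus (t *\<^sub>R v))) has_real_derivative g' x) (at 0)" by blast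
  then show ?case
    using DERIV_add[OF *(3)[rule_format] *(4)[rule_format]]
    by (intro exI[of _ "\<lambda>x. f' x + g' x"] conjI bump_algebra.add allI) auto
next
  case (mult f g)
  then obtain f' g' where *: "bump_algebra c f'" "bump_algebra c g'"
    "\<forall>x. ((\<lambda>t. f (x + abs_torus (t *\<^sub>R v))) has_real_derivative f' x) (at 0)"
    "\<forall>x. ((\<lambda>t. g (x + abs_torus (t *\<^sub>R v))) has_real_derivative g' x) (at 0)" by blast
  have "((\<lambda>t. f (x + abs_torus (t *\<^sub>R v)) * g (x + abs_torus (t *\<^sub>R v))) has_real_derivative f' x * g x + g' x * f x) (at 0)" for x
    using DERIV_mult[OF *(3)[rule_format, of x] *(4)[rule_format, of x]] by (simp add: zero_torus.abs_eq[symmetric])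
  moreover have "bump_algebra c (\<lambda>x. f' x * g x + g' x * f x)"
    using * mult by (intro bump_algebra.intros)
  ultimately show ?case by blast
qed

lemma smooth_bump_algebra: "bump_algebra c f \<Longrightarrow> smooth f"
proof (coinduction arbitrary: f rule: smooth.coinduct)
  case smooth
  have "(\<lambda>t. f (x + abs_torus (t *\<^sub>R v))) differentiable at 0" for v x
    using bump_algebra_DERIV[OF smooth, of v] unfolding real_differentiable_def by blast
  moreover have "bump_algebra c (dirderiv v f)" for v
  proof -
    obtain f' where f': "bump_algebra c f'"
      "\<forall>x. ((\<lambda>t. f (x + abs_torus (t *\<^sub>R v))) has_real_derivative f' x) (at 0)"
      using bump_algebra_DERIV[OF smooth] by blast
    then have "dirderiv v f = f'" by (auto simp: dirderiv_def DERIV_imp_deriv)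
    then show ?thesis using f' by simp
  qed
  ultimately show ?case using bump_algebra_continuous[OF smooth] by blast
qed

text \<open>The product of the functions \<open>flat 0\<close> of \<open>cos (2 \<pi> x\<^sub>1) - c\<close> and \<open>cos (2 \<pi> x\<^sub>2) - c\<close> is supported where
  both cosines are at least \<open>c\<close>. By compactness these sets shrink to the origin as \<open>c\<close> tends to \<open>1\<close>.\<close>

lemma approx_identity_exists: "\<exists>\<rho>. approx_identity \<rho>"
proof -
  define c where "c k = 1 - 1 / (real k + 2)" for k :: nat
  define b where "b k x = flat 0 (wave 1 0 0 x - c k) * flat 0 (wave 0 1 0 x - c k)" for k x
  have alg: "bump_algebra (c k) (b k)" for k
    unfolding b_def by (intro bump_algebra.intros)
  have cont: "continuous_on UNIV (b k)" for k using bump_algebra_continuous[OF alg] .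
  have nn: "0 \<le> b k x" for k x by (simp add: b_def flat_nonneg)
  have w0: "wave 1 0 0 0 = 1" "wave 0 1 0 0 = 1"
    using wave_abs[of 1 0 0 0 0] wave_abs[of 0 1 0 0 0] by (simp_all add: zero_torus.abs_eq zero_prod_def)
  have pos: "0 < (\<integral>x. b k x \<partial>torus_lebesgue)" for k
  proof -
    have "0 < b k 0" by (simp add: b_def w0 c_def flat_pos_iff)
    then have "(\<integral>x. b k x \<partial>torus_lebesgue) \<noteq> 0" using torus_integral_eq_0[OF cont nn] by fastforce
    moreover have "0 \<le> (\<integral>x. b k x \<partial>torus_lebesgue)" using nn by simp
    ultimately show ?thesis by simp
  qed
  define \<rho> where "\<rho> k = Abs_test (\<lambda>x. inverse (\<integral>x. b k x \<partial>torus_lebesgue) * b k x)" for k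
  have \<rho>: "test_fun (\<rho> k) = (\<lambda>x. inverse (\<integral>x. b k x \<partial>torus_lebesgue) * b k x)" for k
    unfolding \<rho>_def
    using smooth_bump_algebra[OF bump_algebra.mult[OF bump_algebra_const alg]] by (simp add: Abs_test_inverse)
  have "approx_identity \<rho>"
    unfolding approx_identity_def
  proof (intro conjI allI impI)
    show "0 \<le> test_fun (\<rho> k) x" for k x using nn[of k x] pos[of k] by (simp add: \<rho>)
    show "(\<integral>x. test_fun (\<rho> k) x \<partial>torus_lebesgue) = 1" for k using pos[of k] by (simp add: \<rho>)
    fix U :: "torus set" assume U: "open U \<and> 0 \<in> U"
    show "\<forall>\<^sub>F k in sequentially. \<forall>x. x \<notin> U \<longrightarrow> test_fun (\<rho> k) x = 0"
    proof (cases "U = UNIV")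
      case False
      define w where "w x = min (wave 1 0 0 x) (wave 0 1 0 x)" for x
      have "compact (UNIV \<inter> - U)" using compact_torus U by (intro compact_Int_closed) auto
      then have "compact (- U)" by simp
      moreover have "continuous_on (- U) w" unfolding w_def
        by (intro continuous_on_subset[of UNIV _ "- U"] continuous_intros) auto
      ultimately obtain y where y: "y \<in> - U" "\<And>x. x \<in> - U \<Longrightarrow> w x \<le> w y"
        using continuous_attains_sup[of "- U" w] False by auto
      have "w y < 1"
      proof (rule ccontr)
        assume "\<not> w y < 1"
        then have *: "wave 1 0 0 y = 1" "wave 0 1 0 y = 1"
          using wave_bound[of 1 0 0 y] wave_bound[of 0 1 0 y] by (auto simp: w_def)
        obtain p where p: "y = abs_torus p" by (rule torus_cases)
        have "cos (2 * pi * fst p) = 1" "cos (2 * pi * snd p) = 1" using * by (auto simp: p wave_abs')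
        then have "fst p \<in> \<int>" "snd p \<in> \<int>"
          by (auto simp: cos_one_2pi_int mult.assoc)
        then have "y = 0" by (simp add: p zero_torus.abs_eq torus.abs_eq_iff torus_rel_def)
        then show False using y U by simp
      qed
      then obtain K :: nat where K: "1 / (1 - w y) < real K" using reals_Archimedean2 by blast
      have "\<forall>x. x \<notin> U \<longrightarrow> test_fun (\<rho> k) x = 0" if "K \<le> k" for k
      proof (intro allI impI)
        fix x assume "x \<notin> U"
        have "1 / (1 - w y) \<le> real k + 2" using K that by linarith
        then have "w y \<le> c k" using \<open>w y < 1\<close> by (simp add: c_def field_simps)
        then have "wave 1 0 0 x \<le> c k \<or> wave 0 1 0 x \<le> c k"
          using y(2)[of x] \<open>x \<notin> U\<close> by (auto simp: w_def min_def split: if_splits)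
        then show "test_fun (\<rho> k) x = 0" by (auto simp: \<rho> b_def flat_def)
      qed
      then show ?thesis by (auto simp: eventually_sequentially)
    qed simp
  qed
  then show ?thesis by blast
qed

lemma approx_identity_comp_test:
  assumes det: "a * d - b * c = 1" and \<rho>: "approx_identity \<rho>"
  shows "approx_identity (\<lambda>k. comp_test a b c d (\<rho> k))"
  unfolding approx_identity_def test_fun_comp_test
proof (intro conjI allI impI)
  show "0 \<le> test_fun (\<rho> k) (torus_map a b c d x)" for k x using \<rho> by (simp add: approx_identity_def)
  show "(\<integral>x. test_fun (\<rho> k) (torus_map a b c d x) \<partial>torus_lebesgue) = 1" for k
    using \<rho> by (simp add: approx_identity_def integral_torus_map[OF det])
  fix U :: "torus set" assume U: "open U \<and> 0 \<in> U"
  define V where "V = torus_map d (- b) (- c) a -` U"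
  have "open V" unfolding V_def using U by (intro open_vimage continuous_torus_map) auto
  moreover have "0 \<in> V" using U by (simp add: V_def torus_map_zero)
  ultimately have "\<forall>\<^sub>F k in sequentially. \<forall>x. x \<notin> V \<longrightarrow> test_fun (\<rho> k) x = 0"
    using \<rho> unfolding approx_identity_def by blast
  then show "\<forall>\<^sub>F k in sequentially. \<forall>x. x \<notin> U \<longrightarrow> test_fun (\<rho> k) (torus_map a b c d x) = 0"
    by eventually_elim (auto simp: V_def torus_map_inverse'[OF det])
qed

section \<open>Circle averages of mollified fields\<close>

lemma test_fun_reflect_test: "test_fun (reflect_test y f) = (\<lambda>w. test_fun f (y - w))"
  by (simp add: reflect_test.rep_eq)

text \<open>Sequential continuity, by dominated convergence in the integral that defines the norm.\<close>

lemma continuous_reflect_test: "continuous_on UNIV (\<lambda>p. reflect_test (y + abs_torus p) \<rho>)"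
proof (rule continuous_on_sequentiallyI)
  fix u :: "nat \<Rightarrow> real \<times> real" and p assume u: "u \<longlonglongrightarrow> p"
  have lim: "(\<lambda>n. h (y + abs_torus (u n) - x)) \<longlonglongrightarrow> h (y + abs_torus p - x)"
    if h: "continuous_on UNIV h" for h :: "torus \<Rightarrow> real" and x
  proof -
    have "continuous_on UNIV (\<lambda>q. h (y - x + abs_torus q))"
      using continuous_on_compose2[OF h continuous_on_compose2[OF continuous_torus_translate[of "y - x"] continuous_abs_torus]]
      by (simp add: add.commute)
    then have "isCont (\<lambda>q. h (y - x + abs_torus q)) p"
      unfolding continuous_on_eq_continuous_at[OF open_UNIV] by (rule bspec) simp
    from isCont_tendsto_compose[OF this u] show ?thesis by (simp add: algebra_simps)
  qed
  have L2: "(\<lambda>n. \<integral>x. (h (y + abs_torus (u n) - x) - h (y + abs_torus p - x))\<^sup>2 \<partial>torus_lebesgue) \<longlonglongrightarrow> 0"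
    if h: "continuous_on UNIV h" for h :: "torus \<Rightarrow> real"
  proof -
    obtain B where B: "0 < B" "\<And>x. \<bar>h x\<bar> \<le> B" using torus_continuous_bounded[OF h] by blast
    have m: "(\<lambda>x. h (z - x)) \<in> borel_measurable borel" for z
      by (rule borel_measurable_continuous_onI) (use continuous_on_compose2[OF h continuous_torus_reflect] in auto)
    have "(\<lambda>n. \<integral>x. (h (y + abs_torus (u n) - x) - h (y + abs_torus p - x))\<^sup>2 \<partial>torus_lebesgue)
      \<longlonglongrightarrow> (\<integral>x. 0 \<partial>torus_lebesgue)"
    proof (rule integral_dominated_convergence[where w = "\<lambda>_. (2 * B)\<^sup>2"])
      show "AE x in torus_lebesgue. (\<lambda>n. (h (y + abs_torus (u n) - x) - h (y + abs_torus p - x))\<^sup>2) \<longlonglongrightarrow> 0"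
      proof (intro AE_I2)
        fix x
        from tendsto_power[OF tendsto_diff[OF lim[OF h, of x] tendsto_const[of "h (y + abs_torus p - x)"]], of 2]
        show "(\<lambda>n. (h (y + abs_torus (u n) - x) - h (y + abs_torus p - x))\<^sup>2) \<longlonglongrightarrow> 0" by simp
      qed
      show "AE x in torus_lebesgue. norm ((h (y + abs_torus (u n) - x) - h (y + abs_torus p - x))\<^sup>2) \<le> (2 * B)\<^sup>2" for n
      proof (intro AE_I2)
        fix x
        have "\<bar>h (y + abs_torus (u n) - x) - h (y + abs_torus p - x)\<bar> \<le> 2 * B"
          using B(2)[of "y + abs_torus (u n) - x"] B(2)[of "y + abs_torus p - x"] by linarith
        from power_mono[OF this abs_ge_zero, of 2]
        show "norm ((h (y + abs_torus (u n) - x) - h (y + abs_torus p - x))\<^sup>2) \<le> (2 * B)\<^sup>2"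
          by simp
      qed
    qed (use m in auto)
    then show ?thesis by simp
  qed
  have "(norm (reflect_test (y + abs_torus (u n)) \<rho> - reflect_test (y + abs_torus p) \<rho>))\<^sup>2
    = (\<integral>x. (test_fun \<rho> (y + abs_torus (u n) - x) - test_fun \<rho> (y + abs_torus p - x))\<^sup>2 \<partial>torus_lebesgue)
    + (\<integral>x. (dirderiv (- (1, 0)) (test_fun \<rho>) (y + abs_torus (u n) - x) - dirderiv (- (1, 0)) (test_fun \<rho>) (y + abs_torus p - x))\<^sup>2 \<partial>torus_lebesgue)
    + (\<integral>x. (dirderiv (- (0, 1)) (test_fun \<rho>) (y + abs_torus (u n) - x) - dirderiv (- (0, 1)) (test_fun \<rho>) (y + abs_torus p - x))\<^sup>2 \<partial>torus_lebesgue)"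
    for n
  proof -
    have d: "dirderiv v (test_fun (reflect_test z \<rho> - reflect_test z' \<rho>))
      = (\<lambda>x. dirderiv (- v) (test_fun \<rho>) (z - x) - dirderiv (- v) (test_fun \<rho>) (z' - x))" for v z z'
      using dirderiv_lincomb[OF test_fun_smooth test_fun_smooth, of v 1 "reflect_test z \<rho>" "- 1" "reflect_test z' \<rho>"]
      by (simp add: minus_test.rep_eq test_fun_reflect_test dirderiv_reflect[OF test_fun_smooth])
    have i: "integrable torus_lebesgue (\<lambda>x. (h (z - x) - h (z' - x))\<^sup>2)" if "continuous_on UNIV h" for h :: "torus \<Rightarrow> real" and z z'
      by (intro integrable_torus_continuous continuous_intros continuous_on_compose2[OF that continuous_torus_reflect]) auto
    show ?thesis
      unfolding norm_test_square d
      by (simp add: minus_test.rep_eq test_fun_reflect_test i continuous_test_fun continuous_dirderiv_test_fun)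
  qed
  moreover have "(\<lambda>n. (\<integral>x. (test_fun \<rho> (y + abs_torus (u n) - x) - test_fun \<rho> (y + abs_torus p - x))\<^sup>2 \<partial>torus_lebesgue)
    + (\<integral>x. (dirderiv (- (1, 0)) (test_fun \<rho>) (y + abs_torus (u n) - x) - dirderiv (- (1, 0)) (test_fun \<rho>) (y + abs_torus p - x))\<^sup>2 \<partial>torus_lebesgue)
    + (\<integral>x. (dirderiv (- (0, 1)) (test_fun \<rho>) (y + abs_torus (u n) - x) - dirderiv (- (0, 1)) (test_fun \<rho>) (y + abs_torus p - x))\<^sup>2 \<partial>torus_lebesgue))
    \<longlonglongrightarrow> 0 + 0 + 0"
    by (intro tendsto_add L2 continuous_test_fun continuous_dirderiv_test_fun)
  ultimately have "(\<lambda>n. (norm (reflect_test (y + abs_torus (u n)) \<rho> - reflect_test (y + abs_torus p) \<rho>))\<^sup>2) \<longlonglongrightarrow> 0"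
    by simp
  from tendsto_real_sqrt[OF this]
  have "(\<lambda>n. norm (reflect_test (y + abs_torus (u n)) \<rho> - reflect_test (y + abs_torus p) \<rho>)) \<longlonglongrightarrow> 0" by simp
  then show "(\<lambda>n. reflect_test (y + abs_torus (u n)) \<rho>) \<longlonglongrightarrow> reflect_test (y + abs_torus p) \<rho>"
    by (rule LIM_zero_cancel[OF tendsto_norm_zero_cancel])
qed

definition circle_mean :: "complex \<Rightarrow> test \<Rightarrow> real \<Rightarrow> torus \<Rightarrow> hm1 \<Rightarrow> real" where
  "circle_mean \<tau> \<rho> \<epsilon> x u = 1 / (2 * pi) *
     (LINT \<theta>:{0..2*pi}|lborel. hm1_convolve u \<rho> (x + torus_coord \<tau> (\<epsilon> * cis \<theta>)))"

lemma continuous_reflect_test_circle: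
  assumes "Im \<tau> \<noteq> 0"
  shows "continuous_on S (\<lambda>\<theta>. reflect_test (x + torus_coord \<tau> (\<epsilon> * cis \<theta>)) \<rho>)"
proof -
  have "continuous_on S (\<lambda>\<theta>. (Re (\<epsilon> * cis \<theta>) - Re \<tau> / Im \<tau> * Im (\<epsilon> * cis \<theta>), Im (\<epsilon> * cis \<theta>) / Im \<tau>))"
    by (auto intro!: continuous_intros simp: assms)
  from continuous_on_compose2[OF continuous_reflect_test this] show ?thesis
    by (simp add: torus_coord_def)
qed

lemma continuous_hm1_convolve_circle:
  assumes "Im \<tau> \<noteq> 0"
  shows "continuous_on S (\<lambda>\<theta>. hm1_convolve u \<rho> (x + torus_coord \<tau> (\<epsilon> * cis \<theta>)))"
  unfolding hm1_convolve_def
  by (intro continuous_intros continuous_reflect_test_circle assms)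

lemma continuous_circle_mean:
  assumes "Im \<tau> \<noteq> 0"
  shows "continuous_on UNIV (circle_mean \<tau> \<rho> \<epsilon> x)"
proof -
  let ?r = "\<lambda>\<theta>. reflect_test (x + torus_coord \<tau> (\<epsilon> * cis \<theta>)) \<rho>"
  have "compact (?r ` {0..2*pi})"
    by (intro compact_continuous_image continuous_reflect_test_circle assms) simp
  then have "bounded (?r ` {0..2*pi})" by (rule compact_imp_bounded)
  then obtain K where "\<forall>v\<in>?r ` {0..2*pi}. norm v \<le> K" unfolding bounded_iff ..
  then have K: "norm (?r \<theta>) \<le> K" if "\<theta> \<in> {0..2*pi}" for \<theta> using that by simp
  have i: "set_integrable lborel {0..2*pi} (\<lambda>\<theta>. blinfun_apply u (?r \<theta>))" for u :: hm1
    using continuous_hm1_convolve_circle[OF assms, of "{0..2*pi}" u \<rho> x \<epsilon>]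
    by (intro borel_integrable_atLeastAtMost') (simp add: hm1_convolve_def)
  have "bounded_linear (circle_mean \<tau> \<rho> \<epsilon> x)"
  proof (rule bounded_linear_intro[where K = K])
    show "circle_mean \<tau> \<rho> \<epsilon> x (u + v) = circle_mean \<tau> \<rho> \<epsilon> x u + circle_mean \<tau> \<rho> \<epsilon> x v" for u v
      using set_integral_add(2)[OF i[of u] i[of v]]
      by (simp add: circle_mean_def hm1_convolve_def blinfun.add_left add_divide_distrib)
    show "circle_mean \<tau> \<rho> \<epsilon> x (r *\<^sub>R u) = r *\<^sub>R circle_mean \<tau> \<rho> \<epsilon> x u" for r u
      by (simp add: circle_mean_def hm1_convolve_def blinfun.scaleR_left)
    show "norm (circle_mean \<tau> \<rho> \<epsilon> x u) \<le> norm u * K" for u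
    proof -
      have "norm (LINT \<theta>:{0..2*pi}|lborel. blinfun_apply u (?r \<theta>)) \<le> (LINT \<theta>:{0..2*pi}|lborel. norm u * K)"
        unfolding set_lebesgue_integral_def
      proof (rule order_trans[OF integral_norm_bound integral_mono])
        show "integrable lborel (\<lambda>\<theta>. norm (indicat_real {0..2*pi} \<theta> *\<^sub>R blinfun_apply u (?r \<theta>)))"
          using i[of u] unfolding set_integrable_def by (rule integrable_norm)
        show "integrable lborel (\<lambda>\<theta>. indicat_real {0..2*pi} \<theta> *\<^sub>R (norm u * K))" by simp
        show "norm (indicat_real {0..2*pi} \<theta> *\<^sub>R blinfun_apply u (?r \<theta>)) \<le> indicat_real {0..2*pi} \<theta> *\<^sub>R (norm u * K)" for \<theta>
          using order_trans[OF norm_blinfun[of u "?r \<theta>"] mult_left_mono[OF K norm_ge_zero[of u]]]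
          by (auto simp: indicator_def)
      qed
      also have "\<dots> = 2 * pi * (norm u * K)" by (simp add: set_lebesgue_integral_def)
      finally show ?thesis by (simp add: circle_mean_def hm1_convolve_def field_simps abs_mult)
    qed
  qed
  then show ?thesis by (rule linear_continuous_on)
qed

lemma integral_rotate_circle:
  fixes F :: "real \<Rightarrow> real"
  assumes F: "continuous_on UNIV F" and per: "\<And>\<theta>. F (\<theta> + 2 * pi) = F \<theta>" and \<phi>: "0 \<le> \<phi>" "\<phi> \<le> 2 * pi"
  shows "(LINT \<theta>:{0..2*pi}|lborel. F (\<theta> + \<phi>)) = (LINT \<theta>:{0..2*pi}|lborel. F \<theta>)"
proof -
  have i: "F integrable_on {a..b}" for a b
    by (intro integrable_continuous_interval continuous_on_subset[OF F]) auto
  have conv: "(LINT \<theta>:{0..2*pi}|lborel. H \<theta>) = integral {0..2*pi} H" if "continuous_on UNIV H" for H :: "real \<Rightarrow> real"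
    by (intro set_borel_integral_eq_integral borel_integrable_atLeastAtMost' continuous_on_subset[OF that]) auto
  have shift: "integral {a..b} (\<lambda>\<theta>. F (\<theta> + h)) = integral {a + h..b + h} F" for a b h
    using integral_shift_Icc_real[of a b F h] by (simp add: comp_def add.commute)
  have "integral {0..2*pi} (\<lambda>\<theta>. F (\<theta> + \<phi>)) = integral {\<phi>..2*pi + \<phi>} F"
    using shift[of 0 "2 * pi" \<phi>] by simp
  also have "\<dots> = integral {\<phi>..2*pi} F + integral {2*pi..2*pi + \<phi>} F"
    using \<phi> by (intro Henstock_Kurzweil_Integration.integral_combine[symmetric] i) auto
  also have "integral {2*pi..2*pi + \<phi>} F = integral {0..\<phi>} F"
    using shift[of 0 \<phi> "2 * pi"] per by (simp add: add.commute)
  also have "integral {\<phi>..2*pi} F + integral {0..\<phi>} F = integral {0..2*pi} F"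
    using \<phi> Henstock_Kurzweil_Integration.integral_combine[of 0 \<phi> "2*pi" F] i by simp
  finally show ?thesis
    using conv[OF F] conv[of "\<lambda>\<theta>. F (\<theta> + \<phi>)"] continuous_on_compose2[OF F, of UNIV "\<lambda>\<theta>. \<theta> + \<phi>"]
    by (simp add: continuous_intros)
qed

lemma torus_map_torus_coord:
  assumes \<tau>: "0 < Im \<tau>" and det: "a * d - b * c = 1"
  shows "torus_map a b c d (torus_coord (modular_map a b c d \<tau>) z)
    = torus_coord \<tau> ((of_int c * \<tau> + of_int d) * z)"
proof -
  define \<sigma> where "\<sigma> = modular_map a b c d \<tau>"
  define D where "D = of_int c * \<tau> + of_int d"
  have D: "D \<noteq> 0" using modular_denominator_nonzero[OF assms] by (simp add: D_def)
  have \<sigma>: "0 < Im \<sigma>" using Im_modular_map[OF assms] \<tau> D by (simp add: \<sigma>_def D_def)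
  have D\<sigma>: "D * \<sigma> = of_int a * \<tau> + of_int b" using D by (simp add: \<sigma>_def modular_map_def D_def)
  define x2 where "x2 = Im z / Im \<sigma>"
  define x1 where "x1 = Re z - Re \<sigma> / Im \<sigma> * Im z"
  define y1 where "y1 = of_int d * x1 + of_int b * x2"
  define y2 where "y2 = of_int c * x1 + of_int a * x2"
  have z: "z = of_real x1 + \<sigma> * of_real x2"
    using \<sigma> by (simp add: complex_eq_iff x1_def x2_def)
  have "D * z = of_real x1 * D + of_real x2 * (D * \<sigma>)" by (simp add: z algebra_simps)
  also have "\<dots> = of_real y1 + \<tau> * of_real y2" unfolding D\<sigma> by (simp add: D_def y1_def y2_def algebra_simps)
  finally have Dz: "D * z = of_real y1 + \<tau> * of_real y2" .
  have "torus_coord \<tau> (D * z) = abs_torus (y1, y2)" using \<tau> by (simp add: Dz torus_coord_def)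
  then show ?thesis
    by (simp add: torus_coord_def torus_map_abs \<sigma>_def[symmetric] D_def[symmetric] y1_def y2_def x1_def x2_def)
qed

lemma hm1_convolve_hm1_comp:
  assumes det: "a * d - b * c = 1"
  shows "hm1_convolve (hm1_comp u (torus_map a b c d)) \<rho> y
    = hm1_convolve u (comp_test d (- b) (- c) a \<rho>) (torus_map a b c d y)"
proof -
  have "comp_test d (- b) (- c) a (reflect_test y \<rho>) = reflect_test (torus_map a b c d y) (comp_test d (- b) (- c) a \<rho>)"
    by (simp add: test_fun_inject[symmetric] test_fun_comp_test test_fun_reflect_test torus_map_diff
        torus_map_inverse'[OF det])
  then show ?thesis by (simp add: hm1_convolve_def hm1_comp_apply[OF det])
qed

text \<open>The change of variables multiplies the complex coordinate by \<open>c\<tau> + d\<close>: circles go to circles,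
  with the radius multiplied by the modulus and the parametrization rotated by the argument.\<close>

lemma circle_mean_hm1_comp:
  assumes \<tau>: "0 < Im \<tau>" and det: "a * d - b * c = 1"
  shows "circle_mean (modular_map a b c d \<tau>) \<rho> \<epsilon> x (hm1_comp u (torus_map a b c d))
    = circle_mean \<tau> (comp_test d (- b) (- c) a \<rho>) (\<epsilon> * cmod (of_int c * \<tau> + of_int d)) (torus_map a b c d x) u"
proof -
  define D where "D = of_int c * \<tau> + of_int d"
  define \<phi> where "\<phi> = Arg2pi D"
  have \<phi>: "0 \<le> \<phi>" "\<phi> \<le> 2 * pi" using Arg2pi_ge_0 Arg2pi_lt_2pi by (auto simp: \<phi>_def less_imp_le)
  have D: "D = of_real (cmod D) * cis \<phi>"
    using Arg2pi_eq[of D] by (simp add: \<phi>_def cis_conv_exp mult.commute)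
  define F where "F \<theta> = hm1_convolve u (comp_test d (- b) (- c) a \<rho>)
    (torus_map a b c d x + torus_coord \<tau> (of_real (\<epsilon> * cmod D) * cis \<theta>))" for \<theta>
  have F: "continuous_on UNIV F"
    unfolding F_def using continuous_hm1_convolve_circle[of \<tau> UNIV] \<tau> by simp
  have per: "F (\<theta> + 2 * pi) = F \<theta>" for \<theta>
    by (simp add: F_def cis_mult[symmetric])
  have "hm1_convolve (hm1_comp u (torus_map a b c d)) \<rho> (x + torus_coord (modular_map a b c d \<tau>) (of_real \<epsilon> * cis \<theta>)) = F (\<theta> + \<phi>)" for \<theta>
  proof -
    have "D * cis \<theta> = of_real (cmod D) * (cis \<phi> * cis \<theta>)"
      using arg_cong[OF D, of "\<lambda>w. w * cis \<theta>"] by (simp only: mult.assoc)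
    then have "D * (of_real \<epsilon> * cis \<theta>) = of_real \<epsilon> * of_real (cmod D) * cis (\<theta> + \<phi>)"
      by (simp only: mult.left_commute[of D] cis_mult add.commute[of \<phi>] mult.assoc)
    note * = this
    show ?thesis
      by (simp add: * hm1_convolve_hm1_comp[OF det] torus_map_add torus_map_torus_coord[OF \<tau> det] F_def D_def[symmetric])
  qed
  then have "circle_mean (modular_map a b c d \<tau>) \<rho> \<epsilon> x (hm1_comp u (torus_map a b c d))
      = 1 / (2 * pi) * (LINT \<theta>:{0..2*pi}|lborel. F \<theta>)"
    unfolding circle_mean_def by (simp add: integral_rotate_circle[OF F per \<phi>])
  then show ?thesis by (simp add: circle_mean_def F_def D_def)
qed

section \<open>Separability of the Sobolev space\<close>

text \<open>The norm of a test function is controlled by the uniform norms of the function and of its two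
  partial derivatives. Triples of continuous functions form a separable space, so one test function
  near each triple of rational trigonometric polynomials that has one nearby gives a dense set.\<close>

lemma test_separable:
  obtains D :: "test set" where "countable D" "\<And>f e. 0 < e \<Longrightarrow> \<exists>g\<in>D. norm (f - g) < e"
proof -
  define near where "near = (\<lambda>(s0, s1, s2, n :: nat) g. \<forall>x.
      \<bar>test_fun g x - rat_trig s0 x\<bar> < 1 / (real n + 1)
    \<and> \<bar>dirderiv (1,0) (test_fun g) x - rat_trig s1 x\<bar> < 1 / (real n + 1)
    \<and> \<bar>dirderiv (0,1) (test_fun g) x - rat_trig s2 x\<bar> < 1 / (real n + 1))"
  define D where "D = range (\<lambda>i. SOME g. near i g)"
  have "\<exists>g\<in>D. norm (f - g) < e" if e: "0 < e" for f e
  proof -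
    obtain n :: nat where n: "4 / e < real n" using reals_Archimedean2 by blast
    define \<delta> where "\<delta> = 1 / (real n + 1)"
    have \<delta>: "0 < \<delta>" "4 * \<delta> < e" using n e by (auto simp: \<delta>_def field_simps)
    obtain s0 where s0: "\<And>x. \<bar>test_fun f x - rat_trig s0 x\<bar> < \<delta>"
      using rat_trig_dense[OF continuous_test_fun \<delta>(1)] by blast
    obtain s1 where s1: "\<And>x. \<bar>dirderiv (1,0) (test_fun f) x - rat_trig s1 x\<bar> < \<delta>"
      using rat_trig_dense[OF continuous_dirderiv_test_fun \<delta>(1)] by blast
    obtain s2 where s2: "\<And>x. \<bar>dirderiv (0,1) (test_fun f) x - rat_trig s2 x\<bar> < \<delta>"
      using rat_trig_dense[OF continuous_dirderiv_test_fun \<delta>(1)] by blast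
    define g where "g = (SOME g. near (s0, s1, s2, n) g)"
    have "near (s0, s1, s2, n) f" using s0 s1 s2 by (simp add: near_def \<delta>_def)
    then have "near (s0, s1, s2, n) g" unfolding g_def by (rule someI)
    then have g: "\<bar>test_fun g x - rat_trig s0 x\<bar> < \<delta>" "\<bar>dirderiv (1,0) (test_fun g) x - rat_trig s1 x\<bar> < \<delta>"
      "\<bar>dirderiv (0,1) (test_fun g) x - rat_trig s2 x\<bar> < \<delta>" for x
      by (auto simp: near_def \<delta>_def)
    have d: "dirderiv v (test_fun (f - g)) x = dirderiv v (test_fun f) x - dirderiv v (test_fun g) x" for v x
      using dirderiv_lincomb[OF test_fun_smooth test_fun_smooth, of v 1 f "- 1" g] by (simp add: minus_test.rep_eq)
    have sq: "t\<^sup>2 \<le> (2 * \<delta>)\<^sup>2" if "\<bar>t\<bar> \<le> 2 * \<delta>" for t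
      using power_mono[OF that abs_ge_zero, of 2] by simp
    have "(norm (f - g))\<^sup>2 \<le> (\<integral>x. 3 * (2 * \<delta>)\<^sup>2 \<partial>torus_lebesgue)"
      unfolding norm_test_square
    proof (intro integral_mono)
      show "integrable torus_lebesgue (\<lambda>x. (test_fun (f - g) x)\<^sup>2 + (dirderiv (1, 0) (test_fun (f - g)) x)\<^sup>2
          + (dirderiv (0, 1) (test_fun (f - g)) x)\<^sup>2)"
        by (intro integrable_torus_continuous continuous_intros)
      fix x
      have "\<bar>test_fun (f - g) x\<bar> \<le> 2 * \<delta>"
        using s0[of x] g(1)[of x] by (simp add: minus_test.rep_eq)
      moreover have "\<bar>dirderiv (1,0) (test_fun (f - g)) x\<bar> \<le> 2 * \<delta>"
        using s1[of x] g(2)[of x] by (simp add: d)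
      moreover have "\<bar>dirderiv (0,1) (test_fun (f - g)) x\<bar> \<le> 2 * \<delta>"
        using s2[of x] g(3)[of x] by (simp add: d)
      ultimately show "(test_fun (f - g) x)\<^sup>2 + (dirderiv (1, 0) (test_fun (f - g)) x)\<^sup>2
          + (dirderiv (0, 1) (test_fun (f - g)) x)\<^sup>2 \<le> 3 * (2 * \<delta>)\<^sup>2"
        using sq by (smt (verit))
    qed simp
    also have "\<dots> \<le> (4 * \<delta>)\<^sup>2" using torus_lebesgue.prob_space by (simp add: power_mult_distrib)
    finally have "norm (f - g) \<le> 4 * \<delta>" by (rule power2_le_imp_le) (use \<delta> in simp)
    moreover have "g \<in> D" by (simp add: D_def g_def)
    ultimately show ?thesis using \<delta> by (intro bexI[of _ g]) auto
  qed
  moreover have "countable D" by (simp add: D_def)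
  ultimately show ?thesis using that by blast
qed

text \<open>In an inner product space that need not be complete, the Riesz map has dense image: a functional
  of norm \<open>L\<close> is nearly represented by \<open>L\<close> times a unit vector at which it nearly attains its norm.\<close>

lemma riesz_dense:
  fixes u :: "'a :: real_inner \<Rightarrow>\<^sub>L real"
  assumes e: "0 < e"
  shows "\<exists>f. norm (u - blinfun_inner_right f) \<le> e"
proof (cases "norm u \<le> e")
  case True
  then show ?thesis by (intro exI[of _ 0]) (simp add: linear_0[OF bounded_linear.linear[OF bounded_linear_blinfun_inner_right]])
next
  case False
  define L where "L = norm u"
  define \<sigma> where "\<sigma> = e / L"
  have L: "0 < L" "e < L" using False e by (auto simp: L_def)
  have \<sigma>: "0 < \<sigma>" "\<sigma> < 1" using L e by (auto simp: \<sigma>_def)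
  have \<sigma>2: "0 < \<sigma>\<^sup>2" "\<sigma>\<^sup>2 < 1" using \<sigma> by (auto simp: power_less_one_iff)
  obtain f0 where f0: "(1 - \<sigma>\<^sup>2 / 2) * L * norm f0 < \<bar>blinfun_apply u f0\<bar>"
  proof (rule ccontr)
    assume "\<not> thesis"
    then have "norm (blinfun_apply u f) \<le> (1 - \<sigma>\<^sup>2 / 2) * L * norm f" for f
      using that by (metis not_le real_norm_def)
    then have "norm u \<le> (1 - \<sigma>\<^sup>2 / 2) * L" using \<sigma>2 L by (intro norm_blinfun_bound) auto
    then show False using L \<sigma>2 by (simp add: L_def[symmetric])
  qed
  have f00: "f0 \<noteq> 0" using f0 by auto
  define f where "f = (sgn (blinfun_apply u f0) / norm f0) *\<^sub>R f0"
  have "blinfun_apply u f0 \<noteq> 0" using f0 L \<sigma>2 by (smt (verit) mult_nonneg_nonneg norm_ge_zero zero_le_power2 field_sum_of_halves abs_zero)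
  then have nf: "norm f = 1" using f00 by (simp add: f_def abs_sgn_eq)
  have uf: "L - blinfun_apply u f \<le> L * \<sigma>\<^sup>2 / 2"
  proof -
    have "blinfun_apply u f = \<bar>blinfun_apply u f0\<bar> / norm f0"
      by (simp add: f_def blinfun.scaleR_right abs_sgn mult.commute)
    then have "(1 - \<sigma>\<^sup>2 / 2) * L * norm f0 < blinfun_apply u f * norm f0"
      using f0 f00 by simp
    then have "(1 - \<sigma>\<^sup>2 / 2) * L < blinfun_apply u f"
      by (rule mult_right_less_imp_less) simp
    then show ?thesis by (simp add: algebra_simps)
  qed
  have one: "blinfun_apply u h - L * inner f h \<le> e * norm h" for h
  proof (cases "h = 0")
    case False
    then have h: "0 < norm h" by simp
    define t where "t = \<sigma> / norm h"
    have t: "0 < t" "t * norm h = \<sigma>" using \<sigma> h by (auto simp: t_def)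
    \<comment> \<open>Expanding the square root in the norm of \<open>f + t h\<close> to first order.\<close>
    have "(norm (f + t *\<^sub>R h))\<^sup>2 = 1 + 2 * (t * inner f h) + \<sigma>\<^sup>2"
      using nf t by (simp add: power2_norm_eq_inner inner_add_left inner_add_right inner_commute
          flip: t(2)) (simp add: power2_eq_square norm_eq_1 flip: power2_norm_eq_inner)
    also have "\<dots> \<le> (1 + t * inner f h + \<sigma>\<^sup>2 / 2)\<^sup>2"
      using zero_le_power2[of "t * inner f h + \<sigma>\<^sup>2 / 2"] by (simp add: power2_eq_square algebra_simps)
    finally have sq: "(norm (f + t *\<^sub>R h))\<^sup>2 \<le> (1 + t * inner f h + \<sigma>\<^sup>2 / 2)\<^sup>2" .
    have "\<bar>t * inner f h\<bar> \<le> 1"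
    proof -
      have "\<bar>inner f h\<bar> \<le> norm h" using Cauchy_Schwarz_ineq2[of f h] nf by simp
      then have "t * \<bar>inner f h\<bar> \<le> t * norm h" using t by (intro mult_left_mono) auto
      then show ?thesis using t \<sigma> by (simp add: abs_mult)
    qed
    then have "0 \<le> 1 + t * inner f h + \<sigma>\<^sup>2 / 2" using \<sigma>2 by linarith
    with sq have "norm (f + t *\<^sub>R h) \<le> 1 + t * inner f h + \<sigma>\<^sup>2 / 2" by (rule power2_le_imp_le)
    then have "L * norm (f + t *\<^sub>R h) \<le> L * (1 + t * inner f h + \<sigma>\<^sup>2 / 2)" using L by simp
    moreover have "blinfun_apply u (f + t *\<^sub>R h) \<le> L * norm (f + t *\<^sub>R h)"
      using norm_blinfun[of u "f + t *\<^sub>R h"] by (simp add: L_def)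
    ultimately have "blinfun_apply u f + t * blinfun_apply u h \<le> L + L * (t * inner f h) + L * \<sigma>\<^sup>2 / 2"
      by (simp add: blinfun.add_right blinfun.scaleR_right algebra_simps)
    then have "t * (blinfun_apply u h - L * inner f h) \<le> L * \<sigma>\<^sup>2"
      using uf by (simp add: algebra_simps)
    also have "\<dots> = (L * \<sigma>) * (t * norm h)" by (simp add: t power2_eq_square)
    also have "L * \<sigma> = e" using L by (simp add: \<sigma>_def)
    finally have "t * (blinfun_apply u h - L * inner f h) \<le> t * (e * norm h)" by (simp add: mult.left_commute)
    then show ?thesis using t by simp
  qed simp
  have "norm (u - blinfun_inner_right (L *\<^sub>R f)) \<le> e"
  proof (rule norm_blinfun_bound)
    fix h
    show "norm (blinfun_apply (u - blinfun_inner_right (L *\<^sub>R f)) h) \<le> e * norm h"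
      using one[of h] one[of "- h"] by (simp add: blinfun.diff_left blinfun.minus_right abs_le_iff)
  qed (use e in simp)
  then show ?thesis by blast
qed

lemma hm1_separable:
  obtains E :: "hm1 set" where "countable E" "\<And>u e. 0 < e \<Longrightarrow> \<exists>v\<in>E. norm (u - v) < e"
proof -
  obtain D where D: "countable D" "\<And>f e. 0 < e \<Longrightarrow> \<exists>g\<in>D. norm (f - g :: test) < e"
    using test_separable by metis
  have dense: "\<exists>v\<in>blinfun_inner_right ` D. norm (u - v) < e" if e: "0 < e" for u e
  proof -
    obtain f where f: "norm (u - blinfun_inner_right f) \<le> e / 2" using riesz_dense[of "e / 2" u] e by auto
    have "0 < e / 2" using e by simp
    from D(2)[OF this, of f] obtain g where g: "g \<in> D" "norm (f - g) < e / 2" by blast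
    have "norm (blinfun_inner_right f - blinfun_inner_right g) \<le> norm (f - g)"
      by (rule norm_blinfun_bound)
        (use Cauchy_Schwarz_ineq2[of "f - g"] in \<open>auto simp: blinfun.diff_left inner_diff_left\<close>)
    then have "norm (u - blinfun_inner_right g) < e"
      using f g norm_triangle_ineq[of "u - blinfun_inner_right f" "blinfun_inner_right f - blinfun_inner_right g"] by simp
    then show ?thesis using g by blast
  qed
  show ?thesis by (rule that[OF countable_image[OF D(1)] dense])
qed

definition hm1_cylinder :: "(test \<times> real set) list \<Rightarrow> hm1 set" where
  "hm1_cylinder l = {u. \<forall>(f, B)\<in>set l. blinfun_apply u f \<in> B}"

lemma hm1_cylinder_Nil [simp]: "hm1_cylinder [] = UNIV"
  by (simp add: hm1_cylinder_def)

lemma hm1_cylinder_Cons: "hm1_cylinder ((f, B) # l) = {u. blinfun_apply u f \<in> B} \<inter> hm1_cylinder l"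
  by (auto simp: hm1_cylinder_def)

lemma hm1_cylinder_append: "hm1_cylinder (l @ l') = hm1_cylinder l \<inter> hm1_cylinder l'"
  by (auto simp: hm1_cylinder_def)

lemma measurable_hm1_apply [measurable]: "(\<lambda>u :: hm1. blinfun_apply u f) \<in> borel_measurable borel"
  by (rule borel_measurable_continuous_onI) (intro continuous_intros)

lemma hm1_cylinder_borel:
  "(\<And>f B. (f, B) \<in> set l \<Longrightarrow> B \<in> sets borel) \<Longrightarrow> hm1_cylinder l \<in> sets borel"
proof (induction l)
  case (Cons p l)
  obtain f B where p: "p = (f, B)" by fastforce
  have "(\<lambda>u. blinfun_apply u f) -` B \<inter> space borel \<in> sets borel"
    using Cons(2)[of f B] by (intro measurable_sets[OF measurable_hm1_apply]) (auto simp: p)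
  then have "{u. blinfun_apply u f \<in> B} \<in> sets borel" by (simp add: vimage_def)
  then show ?case using Cons unfolding p hm1_cylinder_Cons by (intro sets.Int) auto
qed simp

text \<open>Separability turns open sets into countable unions of closed balls, and a closed ball of the dual
  space is a countable intersection of cylinders.\<close>

lemma borel_hm1_eq_cylinders:
  "sets (borel :: hm1 measure)
    = sigma_sets UNIV {hm1_cylinder l | l. \<forall>(f, B)\<in>set l. B \<in> sets borel}" (is "_ = sigma_sets UNIV ?C")
proof
  have "?C \<subseteq> sets borel" using hm1_cylinder_borel by fastforce
  then show "sigma_sets UNIV ?C \<subseteq> sets borel" using sets.sigma_sets_subset[of ?C borel] by simp
  interpret C: sigma_algebra UNIV "sigma_sets UNIV ?C" by (rule sigma_algebra_sigma_sets) simp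
  obtain D where D: "countable D" "\<And>f e. 0 < e \<Longrightarrow> \<exists>g\<in>D. norm (f - g :: test) < e"
    using test_separable by metis
  obtain E where E: "countable E" "\<And>u e. 0 < e \<Longrightarrow> \<exists>v\<in>E. norm (u - v :: hm1) < e"
    using hm1_separable by metis
  have ball: "cball v r \<in> sigma_sets UNIV ?C" if r: "0 \<le> r" for v r
  proof -
    have "cball v r = (\<Inter>f\<in>D. hm1_cylinder [(f, {t. \<bar>t - blinfun_apply v f\<bar> \<le> r * norm f})])"
    proof (intro equalityI subsetI)
      fix u assume "u \<in> cball v r"
      then have "norm (u - v) \<le> r" by (simp add: dist_norm norm_minus_commute)
      then have "norm (blinfun_apply (u - v) f) \<le> r * norm f" for f
        using order_trans[OF norm_blinfun mult_right_mono[OF _ norm_ge_zero]] by blast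
      then show "u \<in> (\<Inter>f\<in>D. hm1_cylinder [(f, {t. \<bar>t - blinfun_apply v f\<bar> \<le> r * norm f})])"
        by (auto simp: hm1_cylinder_def blinfun.diff_left)
    next
      fix u assume "u \<in> (\<Inter>f\<in>D. hm1_cylinder [(f, {t. \<bar>t - blinfun_apply v f\<bar> \<le> r * norm f})])"
      then have u: "norm (blinfun_apply (u - v) f) \<le> r * norm f" if "f \<in> D" for f
        using that by (auto simp: hm1_cylinder_def blinfun.diff_left)
      have "norm (u - v) \<le> r"
      proof (rule norm_blinfun_bound[OF r])
        fix f
        show "norm (blinfun_apply (u - v) f) \<le> r * norm f"
        proof (rule field_le_epsilon)
          fix e :: real assume e: "0 < e"
          define d where "d = e / (norm (u - v) + r + 1)"
          have d: "0 < d" using e r by (simp add: d_def add_nonneg_pos)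
          obtain g where g: "g \<in> D" "norm (f - g) < d" using D(2)[OF d] by blast
          have "norm (blinfun_apply (u - v) f) \<le> norm (blinfun_apply (u - v) g) + norm (blinfun_apply (u - v) (f - g))"
            using norm_triangle_ineq[of "blinfun_apply (u - v) g" "blinfun_apply (u - v) (f - g)"]
            by (simp add: blinfun.diff_right)
          also have "\<dots> \<le> r * norm g + norm (u - v) * norm (f - g)"
            by (intro add_mono u g norm_blinfun)
          also have "\<dots> \<le> r * (norm f + d) + norm (u - v) * d"
            using g r norm_triangle_ineq3[of g f] by (intro add_mono mult_left_mono) (auto simp: norm_minus_commute)
          also have "\<dots> = r * norm f + (norm (u - v) + r) * d" by (simp add: algebra_simps)
          also have "(norm (u - v) + r) * d \<le> (norm (u - v) + r + 1) * d" using d by simp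
          also have "\<dots> = e" using r by (simp add: d_def add_nonneg_pos less_imp_neq[symmetric] add_pos_pos)
          finally show "norm (blinfun_apply (u - v) f) \<le> r * norm f + e" by simp
        qed
      qed
      then show "u \<in> cball v r" by (simp add: dist_norm norm_minus_commute)
    qed
    moreover have "(\<Inter>f\<in>D. hm1_cylinder [(f, {t. \<bar>t - blinfun_apply v f\<bar> \<le> r * norm f})]) \<in> sigma_sets UNIV ?C"
    proof (rule C.countable_INT'[OF D(1)])
      show "D \<noteq> {}" using D(2)[of 1 0] by auto
      show "(\<lambda>f. hm1_cylinder [(f, {t. \<bar>t - blinfun_apply v f\<bar> \<le> r * norm f})]) ` D \<subseteq> sigma_sets UNIV ?C"
      proof (intro image_subsetI sigma_sets.Basic)
        fix f
        have "{t. \<bar>t - blinfun_apply v f\<bar> \<le> r * norm f} \<in> sets borel" by measurable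
        then show "hm1_cylinder [(f, {t. \<bar>t - blinfun_apply v f\<bar> \<le> r * norm f})] \<in> ?C" by force
      qed
    qed
    ultimately show ?thesis by simp
  qed
  have "U \<in> sigma_sets UNIV ?C" if U: "open U" for U
  proof -
    define I where "I = {(v, q :: rat). v \<in> E \<and> 0 \<le> q \<and> cball v (of_rat q) \<subseteq> U}"
    have "U = (\<Union>(v, q)\<in>I. cball v (of_rat q))"
    proof (intro equalityI subsetI)
      fix u assume "u \<in> U"
      then obtain e where e: "0 < e" "cball u e \<subseteq> U" using U open_contains_cball by blast
      obtain q :: rat where q: "e / 3 < of_rat q" "of_rat q < e / 2" using of_rat_dense[of "e / 3" "e / 2"] e by auto
      obtain v where v: "v \<in> E" "norm (u - v) < e / 3" using E(2)[of "e / 3" u] e by auto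
      have "cball v (of_rat q) \<subseteq> cball u e"
      proof
        fix w assume "w \<in> cball v (of_rat q)"
        then have "dist u w \<le> norm (u - v) + of_rat q" using dist_triangle[of u w v] by (simp add: dist_norm)
        then show "w \<in> cball u e" using v q by simp
      qed
      moreover have "u \<in> cball v (of_rat q)" using v q by (simp add: dist_norm norm_minus_commute)
      moreover have "0 \<le> q" using q e by (metis less_imp_le divide_pos_pos zero_less_numeral less_trans zero_less_of_rat_iff)
      ultimately show "u \<in> (\<Union>(v, q)\<in>I. cball v (of_rat q))" using v e by (force simp: I_def)
    qed (auto simp: I_def)
    moreover have "(\<Union>(v, q)\<in>I. cball v (of_rat q)) \<in> sigma_sets UNIV ?C"
    proof (rule C.countable_UN')
      show "countable I" by (rule countable_subset[of _ "E \<times> UNIV"]) (auto simp: I_def E(1))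
      show "(\<lambda>(v, q). cball v (of_rat q)) ` I \<subseteq> sigma_sets UNIV ?C"
        using ball by (auto simp: I_def)
    qed
    ultimately show ?thesis by simp
  qed
  then have "{U :: hm1 set. open U} \<subseteq> sigma_sets UNIV ?C" by auto
  then have "sigma_sets UNIV {U :: hm1 set. open U} \<subseteq> sigma_sets UNIV ?C" by (rule sigma_sets_mono)
  then show "sets (borel :: hm1 measure) \<subseteq> sigma_sets UNIV ?C" unfolding borel_def by simp
qed

section \<open>Laws on the Sobolev space are determined by one-dimensional marginals\<close>

lemma finite_measure_eqI_cos:
  fixes M N :: "real measure"
  assumes M: "finite_measure M" "sets M = sets borel" and N: "finite_measure N" "sets N = sets borel"
    and eq: "\<And>s \<phi>. (\<integral>x. cos (s * x + \<phi>) \<partial>M) = (\<integral>x. cos (s * x + \<phi>) \<partial>N)"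
  shows "M = N"
proof -
  interpret M: finite_measure M by fact
  interpret N: finite_measure N by fact
  have sp: "space M = UNIV" "space N = UNIV" using M N by (auto simp: sets_eq_imp_space_eq)
  define m where "m = measure M UNIV"
  have mN: "measure N UNIV = m" using eq[of 0 0] by (simp add: sp m_def)
  show ?thesis
  proof (cases "m = 0")
    case True
    show ?thesis
    proof (rule measure_eqI)
      fix A assume "A \<in> sets M"
      have "emeasure M UNIV = 0" "emeasure N UNIV = 0"
        using True mN by (simp_all add: M.emeasure_eq_measure N.emeasure_eq_measure m_def)
      then have "emeasure M A = 0" "emeasure N A = 0"
        using emeasure_mono[of A UNIV M] emeasure_mono[of A UNIV N] M N by simp_all
      then show "emeasure M A = emeasure N A" by simp
    qed (simp add: M N)
  next
    case False
    then have m: "0 < m" by (simp add: m_def order_less_le)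
    have real_dist: "real_distribution (density L (\<lambda>_. ennreal (1 / m)))"
      and cos_int: "(\<integral>x. cos (s * x + \<phi>) \<partial>density L (\<lambda>_. ennreal (1 / m))) = 1 / m * (\<integral>x. cos (s * x + \<phi>) \<partial>L)"
      if L: "finite_measure L" "sets L = sets borel" "measure L UNIV = m" for L s \<phi>
    proof -
      interpret L: finite_measure L by fact
      have spL: "space L = UNIV" using L by (auto simp: sets_eq_imp_space_eq)
      show "real_distribution (density L (\<lambda>_. ennreal (1 / m)))"
      proof (intro real_distribution.intro prob_spaceI real_distribution_axioms.intro)
        show "emeasure (density L (\<lambda>_. ennreal (1 / m))) (space (density L (\<lambda>_. ennreal (1 / m)))) = 1"
          using m L by (simp add: emeasure_density_const spL L.emeasure_eq_measure ennreal_mult[symmetric] sets.top[of L, unfolded spL])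
      qed (simp add: L)
      have "(\<lambda>x. cos (s * x + \<phi>)) \<in> borel_measurable L" using L by (simp cong: measurable_cong_sets)
      then show "(\<integral>x. cos (s * x + \<phi>) \<partial>density L (\<lambda>_. ennreal (1 / m))) = 1 / m * (\<integral>x. cos (s * x + \<phi>) \<partial>L)"
        using m by (subst integral_density) auto
    qed
    have char: "char L t = Complex (\<integral>x. cos (t * x + 0) \<partial>L) (\<integral>x. cos (t * x + (- pi / 2)) \<partial>L)"
      if "real_distribution L" for L t
    proof -
      interpret L: real_distribution L by fact
      have i: "integrable L (\<lambda>x. iexp (t * x))" by (rule L.integrable_iexp) auto
      have re: "Re (iexp u) = cos (u + 0)" and im: "Im (iexp u) = cos (u + (- pi / 2))" for u :: real
        by (simp_all add: Re_exp Im_exp cos_diff)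
      have "Re (char L t) = (\<integral>x. cos (t * x + 0) \<partial>L)"
        unfolding char_def integral_Re[OF i, symmetric] re ..
      moreover have "Im (char L t) = (\<integral>x. cos (t * x + (- pi / 2)) \<partial>L)"
        unfolding char_def integral_Im[OF i, symmetric] im ..
      ultimately show ?thesis by (simp only: complex_eq_iff complex.sel)
    qed
    have mM: "measure M UNIV = m" by (simp add: m_def)
    have "char (density M (\<lambda>_. ennreal (1 / m))) = char (density N (\<lambda>_. ennreal (1 / m)))"
      by (rule ext) (simp only: char[OF real_dist[OF M mM]] char[OF real_dist[OF N mN]] cos_int[OF M mM] cos_int[OF N mN] eq)
    then have *: "density M (\<lambda>_. ennreal (1 / m)) = density N (\<lambda>_. ennreal (1 / m))"
      by (rule Levy_uniqueness[OF real_dist[OF M mM] real_dist[OF N mN]])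
    show ?thesis
    proof (rule measure_eqI)
      fix A assume A: "A \<in> sets M"
      then have "A \<in> sets N" using M N by simp
      then have "ennreal (1 / m) * emeasure M A = ennreal (1 / m) * emeasure N A"
        using arg_cong[OF *, of "\<lambda>L. emeasure L A"] A by (simp add: emeasure_density_const)
      then show "emeasure M A = emeasure N A"
        using m by (simp add: ennreal_mult_cancel_left)
    qed (simp add: M N)
  qed
qed

text \<open>The one-dimensional uniqueness theorem for characteristic functions extends to finitely many
  coordinates one at a time: it applies to the image measures under a new coordinate after
  weighting with the nonnegative functions \<open>1 + cos\<close> of the other linear functionals.\<close>

lemma hm1_measure_eqI:
  fixes M N :: "hm1 measure"
  assumes M: "prob_space M" "sets M = sets borel" and N: "prob_space N" "sets N = sets borel"
    and eq: "\<And>f. distr M borel (\<lambda>u. blinfun_apply u f) = distr N borel (\<lambda>u. blinfun_apply u f)"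
  shows "M = N"
proof -
  interpret M: prob_space M by fact
  interpret N: prob_space N by fact
  note [measurable_cong] = M(2) N(2)
  define w where "w l g \<phi> u = indicat_real (hm1_cylinder l) u * cos (blinfun_apply u g + \<phi>)" for l g \<phi> u
  have wm [measurable]: "w l g \<phi> \<in> borel_measurable borel"
    if "\<forall>(f, B)\<in>set l. B \<in> sets borel" for l g \<phi>
  proof -
    have [measurable]: "hm1_cylinder l \<in> sets borel" using that by (intro hm1_cylinder_borel) auto
    show ?thesis unfolding w_def by measurable
  qed
  have main: "\<forall>(f, B)\<in>set l. B \<in> sets borel \<Longrightarrow> (\<integral>u. w l g \<phi> u \<partial>M) = (\<integral>u. w l g \<phi> u \<partial>N)" for l g \<phi>
  proof (induction l arbitrary: g \<phi>)
    case Nil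
    have *: "(\<integral>u. cos (blinfun_apply u g + \<phi>) \<partial>L) = (\<integral>x. cos (x + \<phi>) \<partial>distr L borel (\<lambda>u. blinfun_apply u g))"
      if [measurable_cong]: "sets L = sets borel" for L :: "hm1 measure"
      by (subst integral_distr) auto
    show ?case by (simp add: w_def *[OF M(2)] *[OF N(2)] eq)
  next
    case (Cons p l)
    obtain f B where p: "p = (f, B)" by fastforce
    have B [measurable]: "B \<in> sets borel" and l: "\<forall>(f, B)\<in>set l. B \<in> sets borel"
      using Cons(2) by (auto simp: p)
    have cyl [measurable]: "hm1_cylinder l \<in> sets borel" using l by (intro hm1_cylinder_borel) auto
    note IH = Cons(1)[OF l]
    define W where "W g \<phi> u = indicat_real (hm1_cylinder l) u * (1 + cos (blinfun_apply u g + \<phi>))" for g \<phi> u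
    have Wm [measurable]: "W g \<phi> \<in> borel_measurable borel" for g \<phi> unfolding W_def by measurable
    have "0 \<le> 1 + cos t" "1 + cos t \<le> 2" for t :: real
      using cos_ge_minus_one[of t] cos_le_one[of t] by linarith+
    then have W0: "0 \<le> W g \<phi> u" "\<bar>W g \<phi> u\<bar> \<le> 2" for g \<phi> u
      by (auto simp: W_def indicator_def)
    define \<kappa> where "\<kappa> L g \<phi> = distr (density L (\<lambda>u. ennreal (W g \<phi> u))) borel (\<lambda>u. blinfun_apply u f)" for L g \<phi>
    have int\<kappa>: "(\<integral>x. h x \<partial>\<kappa> L g \<phi>) = (\<integral>u. W g \<phi> u * h (blinfun_apply u f) \<partial>L)"
      if [measurable_cong]: "sets L = sets borel" and [measurable]: "h \<in> borel_measurable borel"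
      for L h g \<phi>
      unfolding \<kappa>_def by (subst integral_distr) (auto simp: integral_density W0)
    have fin: "finite_measure (\<kappa> L g \<phi>)" if L: "prob_space L" and [measurable_cong]: "sets L = sets borel" for L g \<phi>
    proof -
      interpret L: prob_space L by fact
      have "finite_measure (density L (\<lambda>u. ennreal (W g \<phi> u)))"
      proof (rule finite_measureI)
        have "emeasure (density L (\<lambda>u. ennreal (W g \<phi> u))) (space (density L (\<lambda>u. ennreal (W g \<phi> u))))
          = (\<integral>\<^sup>+u. ennreal (W g \<phi> u) \<partial>L)"
          by (subst emeasure_density) (auto intro!: nn_integral_cong)
        also have "\<dots> \<le> (\<integral>\<^sup>+u. 2 \<partial>L)"
          using W0(2)[of g \<phi>] by (intro nn_integral_mono) (metis abs_le_D1 ennreal_leI ennreal_numeral)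
        also have "\<dots> < \<infinity>" by (simp add: L.emeasure_space_1)
        finally show "emeasure (density L (\<lambda>u. ennreal (W g \<phi> u))) (space (density L (\<lambda>u. ennreal (W g \<phi> u)))) \<noteq> \<infinity>" by simp
      qed
      then show ?thesis unfolding \<kappa>_def by (intro finite_measure.finite_measure_distr) auto
    qed
    have \<kappa>: "\<kappa> M g \<phi> = \<kappa> N g \<phi>" for g \<phi>
    proof (rule finite_measure_eqI_cos[OF fin[OF M] _ fin[OF N]])
      fix s \<theta>
      have expand: "(\<integral>x. cos (s * x + \<theta>) \<partial>\<kappa> L g \<phi>) = (\<integral>u. w l (s *\<^sub>R f) \<theta> u \<partial>L)
          + 1 / 2 * (\<integral>u. w l (s *\<^sub>R f - g) (\<theta> - \<phi>) u \<partial>L) + 1 / 2 * (\<integral>u. w l (s *\<^sub>R f + g) (\<theta> + \<phi>) u \<partial>L)"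
        if L: "prob_space L" and [measurable_cong]: "sets L = sets borel" for L
      proof -
        interpret L: prob_space L by fact
        have "integrable L (w l h \<xi>)" for h \<xi>
          using wm[OF l] by (intro L.integrable_const_bound[of _ 1]) (auto simp: w_def indicator_def)
        note i = this
        have "W g \<phi> u * cos (s * blinfun_apply u f + \<theta>) = w l (s *\<^sub>R f) \<theta> u
          + 1 / 2 * w l (s *\<^sub>R f - g) (\<theta> - \<phi>) u + 1 / 2 * w l (s *\<^sub>R f + g) (\<theta> + \<phi>) u" for u
        proof -
          have "cos (s * blinfun_apply u f + \<theta>) * cos (blinfun_apply u g + \<phi>)
            = (cos (s * blinfun_apply u f - blinfun_apply u g + (\<theta> - \<phi>)) + cos (s * blinfun_apply u f + blinfun_apply u g + (\<theta> + \<phi>))) / 2"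
          proof -
            have "s * blinfun_apply u f - blinfun_apply u g + (\<theta> - \<phi>) = (s * blinfun_apply u f + \<theta>) - (blinfun_apply u g + \<phi>)"
              "s * blinfun_apply u f + blinfun_apply u g + (\<theta> + \<phi>) = (s * blinfun_apply u f + \<theta>) + (blinfun_apply u g + \<phi>)"
              by simp_all
            then show ?thesis by (simp only: cos_times_cos)
          qed
          then show ?thesis
            by (simp add: W_def w_def blinfun.add_right blinfun.diff_right blinfun.scaleR_right indicator_def
                distrib_right add_divide_distrib mult.commute)
        qed
        then show ?thesis using i by (subst int\<kappa>[OF that(2)]) simp_all
      qed
      show "(\<integral>x. cos (s * x + \<theta>) \<partial>\<kappa> M g \<phi>) = (\<integral>x. cos (s * x + \<theta>) \<partial>\<kappa> N g \<phi>)"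
        by (simp only: expand[OF M] expand[OF N] IH)
    qed (auto simp: \<kappa>_def)
    have red: "(\<integral>u. w (p # l) g \<phi> u \<partial>L) = (\<integral>x. indicat_real B x \<partial>\<kappa> L g \<phi>) - 1 / 2 * (\<integral>x. indicat_real B x \<partial>\<kappa> L 0 0)"
      if L: "prob_space L" and [measurable_cong]: "sets L = sets borel" for L
    proof -
      interpret L: prob_space L by fact
      have i: "integrable L (\<lambda>u. W g \<phi> u * indicat_real B (blinfun_apply u f))" for g \<phi>
        using W0 by (intro L.integrable_const_bound[of _ 2]) (auto simp: indicator_def)
      have "w (p # l) g \<phi> u = W g \<phi> u * indicat_real B (blinfun_apply u f) - 1 / 2 * (W 0 0 u * indicat_real B (blinfun_apply u f))" for u
        by (cases "u \<in> hm1_cylinder l"; cases "blinfun_apply u f \<in> B")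
          (simp_all add: w_def W_def p hm1_cylinder_Cons)
      then show ?thesis
        unfolding int\<kappa>[OF that(2) borel_measurable_indicator[OF B]] using i by simp
    qed
    show ?case by (simp only: red[OF M] red[OF N] \<kappa>)
  qed
  let ?C = "{hm1_cylinder l | l. \<forall>(f, B)\<in>set l. B \<in> sets borel}"
  show "M = N"
  proof (rule measure_eqI_generator_eq[where \<Omega> = UNIV and E = ?C and A = "\<lambda>_. UNIV"])
    show "Int_stable ?C"
    proof (rule Int_stableI)
      fix S T assume "S \<in> ?C" "T \<in> ?C"
      then obtain l l' where "S = hm1_cylinder l" "T = hm1_cylinder l'"
        "\<forall>(f, B)\<in>set l. B \<in> sets borel" "\<forall>(f, B)\<in>set l'. B \<in> sets borel" by blast
      then have "S \<inter> T = hm1_cylinder (l @ l')" "\<forall>(f, B)\<in>set (l @ l'). B \<in> sets borel"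
        by (auto simp: hm1_cylinder_append)
      then show "S \<inter> T \<in> ?C" by blast
    qed
    show "sets M = sigma_sets UNIV ?C" "sets N = sigma_sets UNIV ?C"
      using M N borel_hm1_eq_cylinders by auto
    show "range (\<lambda>_. UNIV) \<subseteq> ?C" by (auto intro!: exI[of _ "[]"])
    show "emeasure M UNIV \<noteq> \<infinity>" using M.emeasure_finite by simp
    fix S assume "S \<in> ?C"
    then obtain l where l: "S = hm1_cylinder l" "\<forall>(f, B)\<in>set l. B \<in> sets borel" by blast
    have S [measurable]: "S \<in> sets borel" unfolding l(1) using l(2) by (intro hm1_cylinder_borel) auto
    have "(\<integral>u. indicat_real S u \<partial>M) = (\<integral>u. indicat_real S u \<partial>N)"
      using main[OF l(2), of 0 0] by (simp add: w_def l(1))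
    then show "emeasure M S = emeasure N S"
      using S by (simp add: M.emeasure_eq_measure N.emeasure_eq_measure M(2) N(2) sets_eq_imp_space_eq[OF M(2)] sets_eq_imp_space_eq[OF N(2)])
  qed auto
qed

lemma centered_gaussian_second_moment:
  assumes "0 \<le> v" shows "(\<integral>x. x\<^sup>2 \<partial>centered_gaussian v) = v"
proof (cases "v = 0")
  case True
  then show ?thesis by (simp add: centered_gaussian_def integral_return)
next
  case False
  then have v: "0 < sqrt v" using assms by simp
  have "(\<integral>x. normal_density 0 (sqrt v) x * (x - 0) ^ (2 * 1) \<partial>lborel) = fact (2 * 1) / ((2 / (sqrt v)\<^sup>2) ^ 1 * fact 1)"
    using integral_normal_moment_even[OF v, of 0 1] by simp
  then show ?thesis
    using False assms by (simp add: centered_gaussian_def integral_density fact_numeral)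
qed

text \<open>The variance of the Gaussian marginal is recovered as a second moment from the covariance.\<close>

lemma gff_marginal:
  assumes "gff G P X"
  shows "distr P borel (\<lambda>\<omega>. blinfun_apply (X \<omega>) f)
    = centered_gaussian (\<integral>x. \<integral>y. test_fun f x * test_fun f y * G (x - y) \<partial>torus_lebesgue \<partial>torus_lebesgue)"
proof -
  have X [measurable]: "X \<in> P \<rightarrow>\<^sub>M borel" using assms by (simp add: gff_def)
  obtain v where v: "0 \<le> v" "distr P borel (\<lambda>\<omega>. blinfun_apply (X \<omega>) f) = centered_gaussian v"
    using assms unfolding gff_def by blast
  have "v = (\<integral>x. x\<^sup>2 \<partial>distr P borel (\<lambda>\<omega>. blinfun_apply (X \<omega>) f))"
    by (simp add: v centered_gaussian_second_moment)
  also have "\<dots> = (\<integral>\<omega>. blinfun_apply (X \<omega>) f * blinfun_apply (X \<omega>) f \<partial>P)"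
    by (subst integral_distr) (auto simp: power2_eq_square)
  also have "\<dots> = (\<integral>x. \<integral>y. test_fun f x * test_fun f y * G (x - y) \<partial>torus_lebesgue \<partial>torus_lebesgue)"
    using assms by (simp add: gff_def)
  finally show ?thesis using v by simp
qed

lemma gff_law_unique:
  assumes X: "gff G P X" and X': "gff G P' X'"
  shows "distr P borel X = distr P' borel X'"
proof (rule hm1_measure_eqI)
  have m [measurable]: "X \<in> P \<rightarrow>\<^sub>M borel" "X' \<in> P' \<rightarrow>\<^sub>M borel" using X X' by (auto simp: gff_def)
  show "prob_space (distr P borel X)" "prob_space (distr P' borel X')"
    using X X' m by (auto simp: gff_def intro!: prob_space.prob_space_distr)
  show "distr (distr P borel X) borel (\<lambda>u. blinfun_apply u f) = distr (distr P' borel X') borel (\<lambda>u. blinfun_apply u f)" for f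
    using gff_marginal[OF X, of f] gff_marginal[OF X', of f] by (simp add: distr_distr comp_def)
qed auto

section \<open>The Borel sets of the space of finite measures\<close>

lemma
  shows sets_measure_of_fmeas [simp, measurable_cong]: "sets (measure_of_fmeas m) = sets borel"
    and finite_measure_of_fmeas: "finite_measure (measure_of_fmeas m)"
  using measure_of_fmeas[of m] by auto

lemma space_measure_of_fmeas [simp]: "space (measure_of_fmeas m) = UNIV"
  using sets_eq_imp_space_eq[OF sets_measure_of_fmeas] by simp

lemma integrable_fmeas_continuous:
  fixes f :: "torus \<Rightarrow> real"
  shows "continuous_on UNIV f \<Longrightarrow> integrable (measure_of_fmeas m) f"
  by (rule finite_measure_integrable_continuous[OF finite_measure_of_fmeas sets_measure_of_fmeas])

lemma open_fmeas_basis: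
  fixes f :: "torus \<Rightarrow> real"
  assumes "continuous_on UNIV f" "open V"
  shows "open {m. (\<integral>x. f x \<partial>measure_of_fmeas m) \<in> V}"
  unfolding open_fmeas_def using assms by (intro generate_topology.Basis) blast

lemma measurable_fmeas_integral:
  fixes f :: "torus \<Rightarrow> real"
  assumes "continuous_on UNIV f"
  shows "(\<lambda>m. \<integral>x. f x \<partial>measure_of_fmeas m) \<in> borel_measurable borel"
  by (rule borel_measurable_continuous_onI)
    (use open_fmeas_basis[OF assms] in \<open>simp add: continuous_on_open_vimage vimage_def\<close>)

definition fmeas_box :: "((rat \<times> int \<times> int \<times> rat) list \<times> rat \<times> rat) set \<Rightarrow> fmeas set" where
  "fmeas_box F = {m. \<forall>(j, p, q)\<in>F. of_rat p < (\<integral>x. rat_trig j x \<partial>measure_of_fmeas m)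
     \<and> (\<integral>x. rat_trig j x \<partial>measure_of_fmeas m) < of_rat q}"

lemma fmeas_box_Un: "fmeas_box (F \<union> F') = fmeas_box F \<inter> fmeas_box F'"
  by (simp add: fmeas_box_def ball_Un Collect_conj_eq)

lemma rat_trig_one: "rat_trig [(1, 0, 0, 0)] x = 1"
  by (simp add: rat_trig_def wave_0)

text \<open>The weak topology has a countable base: a neighbourhood that tests against a continuous function
  contains one that controls the total mass and tests against a uniformly close rational
  trigonometric polynomial.\<close>

lemma fmeas_box_base:
  assumes "open U" "m \<in> U"
  shows "\<exists>F. finite F \<and> m \<in> fmeas_box F \<and> fmeas_box F \<subseteq> U"
proof -
  have "generate_topology {{m. (\<integral>x. f x \<partial>measure_of_fmeas m) \<in> V} | (f :: torus \<Rightarrow> real) V.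
        continuous_on UNIV f \<and> open V} U"
    using assms(1) by (simp add: open_fmeas_def)
  then show ?thesis using assms(2)
  proof (induction U rule: generate_topology.induct)
    case UNIV
    show ?case by (intro exI[of _ "{}"]) (simp add: fmeas_box_def)
  next
    case (Int a b)
    then obtain F F' where "finite F" "m \<in> fmeas_box F" "fmeas_box F \<subseteq> a"
      "finite F'" "m \<in> fmeas_box F'" "fmeas_box F' \<subseteq> b" by blast
    then show ?case
      by (intro exI[of _ "F \<union> F'"]) (auto simp: fmeas_box_Un)
  next
    case (UN K)
    then show ?case by (meson Union_iff Union_upper order_trans)
  next
    case (Basis s)
    then obtain f :: "torus \<Rightarrow> real" and V where f: "continuous_on UNIV f" and V: "open V"
      and s: "s = {m. (\<integral>x. f x \<partial>measure_of_fmeas m) \<in> V}" by blast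
    let ?I = "\<lambda>m' h. \<integral>x. h x \<partial>measure_of_fmeas m'" and ?one = "[(1, 0, 0, 0)] :: (rat \<times> int \<times> int \<times> rat) list"
    obtain e where e: "0 < e" "\<And>t. dist t (?I m f) < e \<Longrightarrow> t \<in> V"
      using V Basis(2) unfolding s open_dist by blast
    define C where "C = measure (measure_of_fmeas m) UNIV + 1"
    have C: "1 \<le> C" by (simp add: C_def)
    define \<delta> where "\<delta> = e / 4 / C"
    have \<delta>: "0 < \<delta>" "\<delta> * C = e / 4" using C e by (auto simp: \<delta>_def)
    obtain j where j: "\<And>x. \<bar>f x - rat_trig j x\<bar> < \<delta>" using rat_trig_dense[OF f \<delta>(1)] by blast
    have close: "\<bar>?I m' f - ?I m' (rat_trig j)\<bar> \<le> e / 4" if m': "measure (measure_of_fmeas m') UNIV \<le> C" for m'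
    proof -
      interpret m': finite_measure "measure_of_fmeas m'" by (rule finite_measure_of_fmeas)
      have i: "integrable (measure_of_fmeas m') f" "integrable (measure_of_fmeas m') (rat_trig j)"
        using integrable_fmeas_continuous f continuous_rat_trig by blast+
      have "\<bar>?I m' (\<lambda>x. f x - rat_trig j x)\<bar> \<le> ?I m' (\<lambda>_. \<delta>)"
        by (rule order_trans[OF integral_abs_bound integral_mono]) (use i j in \<open>auto intro: less_imp_le\<close>)
      also have "\<dots> \<le> C * \<delta>" using m' \<delta> by simp
      finally show ?thesis using i \<delta> by (simp add: mult.commute)
    qed
    define t where "t = ?I m (rat_trig j)"
    obtain p where p: "t - e / 4 < of_rat p" "of_rat p < t" using of_rat_dense[of "t - e / 4" t] e by auto
    obtain q where q: "t < of_rat q" "of_rat q < t + e / 4" using of_rat_dense[of t "t + e / 4"] e by auto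
    obtain r where r: "C - 1 < of_rat r" "of_rat r < C" using of_rat_dense[of "C - 1" C] by auto
    define F where "F = {(j, p, q), (?one, - 1, r)}"
    have mass: "?I m' (rat_trig ?one) = measure (measure_of_fmeas m') UNIV" for m'
      by (simp add: rat_trig_one)
    have "m \<in> fmeas_box F"
      using p q r by (simp add: fmeas_box_def F_def mass t_def[symmetric] C_def less_le_trans[OF _ measure_nonneg])
    moreover have "fmeas_box F \<subseteq> s"
    proof
      fix m' assume "m' \<in> fmeas_box F"
      then have *: "of_rat p < ?I m' (rat_trig j)" "?I m' (rat_trig j) < of_rat q"
        "measure (measure_of_fmeas m') UNIV < of_rat r"
        by (auto simp: fmeas_box_def F_def mass)
      have "\<bar>?I m' f - ?I m' (rat_trig j)\<bar> \<le> e / 4" using close[of m'] * r by simp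
      moreover have "\<bar>?I m f - t\<bar> \<le> e / 4" unfolding t_def using close[of m] by (simp add: C_def)
      ultimately have "dist (?I m' f) (?I m f) < e" using *(1,2) p q e(1)
        unfolding dist_real_def by linarith
      then show "m' \<in> s" using e by (simp add: s)
    qed
    moreover have "finite F" by (simp add: F_def)
    ultimately show ?case by blast
  qed
qed

lemma measurable_fmeasI:
  assumes Y: "\<And>j. (\<lambda>\<omega>. \<integral>x. rat_trig j x \<partial>measure_of_fmeas (Y \<omega>)) \<in> borel_measurable N"
  shows "Y \<in> N \<rightarrow>\<^sub>M borel"
proof (rule borel_measurableI)
  fix U :: "fmeas set" assume U: "open U"
  have box: "Y -` fmeas_box F \<inter> space N \<in> sets N" if "finite F" for F
    using that
  proof (induction F rule: finite_induct)
    case empty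
    then show ?case by (simp add: fmeas_box_def)
  next
    case (insert a F)
    obtain j p q where a: "a = (j, p, q)" by (cases a) auto
    have "Y -` fmeas_box (insert a F) \<inter> space N
      = ((\<lambda>\<omega>. \<integral>x. rat_trig j x \<partial>measure_of_fmeas (Y \<omega>)) -` {of_rat p<..<of_rat q} \<inter> space N)
        \<inter> (Y -` fmeas_box F \<inter> space N)"
      by (auto simp: fmeas_box_def a)
    then show ?case using insert measurable_sets[OF Y] by (metis borel_open open_greaterThanLessThan sets.Int)
  qed
  define I where "I = {F. finite F \<and> fmeas_box F \<subseteq> U}"
  have "U = (\<Union>F\<in>I. fmeas_box F)"
    using fmeas_box_base[OF U] by (auto simp: I_def)
  then have *: "Y -` U \<inter> space N = (\<Union>F\<in>I. Y -` fmeas_box F \<inter> space N)" by blast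
  show "Y -` U \<inter> space N \<in> sets N"
    unfolding *
  proof (rule sets.countable_UN')
    show "countable I"
      by (rule countable_subset[OF _ countable_Collect_finite]) (auto simp: I_def)
    show "(\<lambda>F. Y -` fmeas_box F \<inter> space N) ` I \<subseteq> sets N" using box by (auto simp: I_def)
  qed
qed

text \<open>The coordinates embed the space of measures into a countable product of real lines. By the
  countable base, its Borel sets are the traces of the product sets.\<close>

definition fmeas_coords :: "fmeas \<Rightarrow> (rat \<times> int \<times> int \<times> rat) list \<Rightarrow> real" where
  "fmeas_coords m j = (\<integral>x. rat_trig j x \<partial>measure_of_fmeas m)"

lemma borel_fmeas_coords:
  assumes "V \<in> sets borel"
  shows "\<exists>C\<in>sets (PiM UNIV (\<lambda>_. borel)). V = fmeas_coords -` C"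
proof -
  define N where "N = vimage_algebra UNIV fmeas_coords (PiM UNIV (\<lambda>_. borel :: real measure))"
  have sp: "fmeas_coords \<in> UNIV \<rightarrow> space (PiM UNIV (\<lambda>_. borel :: real measure))" by (simp add: space_PiM)
  have coords: "fmeas_coords \<in> N \<rightarrow>\<^sub>M PiM UNIV (\<lambda>_. borel)"
    unfolding N_def by (rule measurable_vimage_algebra1[OF sp])
  have "(\<lambda>m. m) \<in> N \<rightarrow>\<^sub>M borel"
  proof (rule measurable_fmeasI)
    fix j
    show "(\<lambda>m. \<integral>x. rat_trig j x \<partial>measure_of_fmeas m) \<in> borel_measurable N"
      using measurable_compose[OF coords measurable_component_singleton[of j]] by (simp add: fmeas_coords_def)
  qed
  from measurable_sets[OF this assms] have "V \<in> sets N" by (simp add: N_def)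
  then show ?thesis unfolding N_def sets_vimage_algebra2[OF sp] by auto
qed

section \<open>Measurability of tilting and of push-forward\<close>

lemma measurable_fmeas_emeasure:
  assumes "B \<in> sets borel"
  shows "(\<lambda>m. emeasure (measure_of_fmeas m) B) \<in> borel_measurable borel"
proof -
  have op: "(\<lambda>m. emeasure (measure_of_fmeas m) U) \<in> borel_measurable borel" if U: "open U" for U
  proof -
    obtain f :: "torus \<Rightarrow> real" where f: "continuous_on UNIV f" "\<forall>x. 0 \<le> f x" "U = {x. 0 < f x}"
      using U by (rule open_torus_cozero)
    have gc: "continuous_on UNIV (\<lambda>x. min 1 (real n * f x))" for n by (intro continuous_intros f(1))
    have "(\<lambda>m. measure (measure_of_fmeas m) U) \<in> borel_measurable borel"
      unfolding f(3)
      by (rule borel_measurable_LIMSEQ_real[OF tendsto_integral_cozero[OF finite_measure_of_fmeas sets_measure_of_fmeas f(1,2)]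
            measurable_fmeas_integral[OF gc]])
    then show ?thesis
      by (simp add: finite_measure.emeasure_eq_measure[OF finite_measure_of_fmeas])
  qed
  have "Int_stable {U :: torus set. open U}" by (auto simp: Int_stable_def)
  moreover have "{U :: torus set. open U} \<subseteq> Pow UNIV" by simp
  moreover have "B \<in> sigma_sets UNIV {U. open U}" using assms by (simp add: borel_def)
  ultimately show ?thesis
  proof (induction rule: sigma_sets_induct_disjoint)
    case (basic A) then show ?case using op by simp
  next
    case (compl A)
    then have A: "A \<in> sets borel" by (simp add: borel_def)
    have "emeasure (measure_of_fmeas m) (UNIV - A) = emeasure (measure_of_fmeas m) UNIV - emeasure (measure_of_fmeas m) A" for m
      using emeasure_compl[of A "measure_of_fmeas m"] A
        finite_measure.emeasure_finite[OF finite_measure_of_fmeas, of m A] by simp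
    then show ?case using compl op[of UNIV] by simp
  next
    case (union A)
    then have "range A \<subseteq> sets borel" by (auto simp: borel_def)
    then have "emeasure (measure_of_fmeas m) (\<Union>i. A i) = (\<Sum>i. emeasure (measure_of_fmeas m) (A i))" for m
      using suminf_emeasure[of A "measure_of_fmeas m"] union by simp
    then show ?case using union by simp
  qed auto
qed

lemma measurable_fmeas_nn_integral:
  assumes "h \<in> borel_measurable borel"
  shows "(\<lambda>m. \<integral>\<^sup>+x. h x \<partial>measure_of_fmeas m) \<in> borel_measurable borel"
  using assms
proof (induction h rule: borel_measurable_induct)
  case (cong f g)
  then have "f = g" by auto
  then show ?case using cong by simp
next
  case (set A)
  then show ?case using measurable_fmeas_emeasure[of A] by simp
next
  case (mult u c)
  then have "(\<integral>\<^sup>+x. c * u x \<partial>measure_of_fmeas m) = c * (\<integral>\<^sup>+x. u x \<partial>measure_of_fmeas m)" for m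
    by (intro nn_integral_cmult) (simp cong: measurable_cong_sets)
  then show ?case using mult by simp
next
  case (add u v)
  then have "(\<integral>\<^sup>+x. v x + u x \<partial>measure_of_fmeas m) = (\<integral>\<^sup>+x. v x \<partial>measure_of_fmeas m) + (\<integral>\<^sup>+x. u x \<partial>measure_of_fmeas m)" for m
    by (intro nn_integral_add) (simp_all cong: measurable_cong_sets)
  then show ?case using add by simp
next
  case (seq U)
  have "(\<integral>\<^sup>+x. (SUP i. U i x) \<partial>measure_of_fmeas m) = (SUP i. \<integral>\<^sup>+x. U i x \<partial>measure_of_fmeas m)" for m
    using seq by (intro nn_integral_monotone_convergence_SUP) (simp_all cong: measurable_cong_sets)
  then have "(\<lambda>m. \<integral>\<^sup>+x. (SUP i. U i) x \<partial>measure_of_fmeas m) = (\<lambda>m. SUP i. \<integral>\<^sup>+x. U i x \<partial>measure_of_fmeas m)"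
    by (simp add: image_comp comp_def)
  then show ?case using seq by simp
qed

lemma measurable_fmeas_integral_borel:
  fixes h :: "torus \<Rightarrow> real"
  assumes h [measurable]: "h \<in> borel_measurable borel"
  shows "(\<lambda>m. \<integral>x. h x \<partial>measure_of_fmeas m) \<in> borel_measurable borel"
proof -
  have [measurable]: "(\<lambda>m. \<integral>\<^sup>+x. ennreal (h x) \<partial>measure_of_fmeas m) \<in> borel_measurable borel"
    "(\<lambda>m. \<integral>\<^sup>+x. ennreal (- h x) \<partial>measure_of_fmeas m) \<in> borel_measurable borel"
    "(\<lambda>m. \<integral>\<^sup>+x. ennreal \<bar>h x\<bar> \<partial>measure_of_fmeas m) \<in> borel_measurable borel"
    by (intro measurable_fmeas_nn_integral; measurable)+
  have "(\<integral>x. h x \<partial>measure_of_fmeas m) = (if (\<integral>\<^sup>+x. ennreal \<bar>h x\<bar> \<partial>measure_of_fmeas m) < \<infinity>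
    then enn2real (\<integral>\<^sup>+x. ennreal (h x) \<partial>measure_of_fmeas m) - enn2real (\<integral>\<^sup>+x. ennreal (- h x) \<partial>measure_of_fmeas m) else 0)" for m
  proof -
    have hm: "h \<in> borel_measurable (measure_of_fmeas m)" by measurable
    show ?thesis
    proof (cases "integrable (measure_of_fmeas m) h")
      case True
      then show ?thesis by (simp add: real_lebesgue_integral_def integrable_iff_bounded)
    next
      case False
      then show ?thesis using hm by (simp add: integrable_iff_bounded not_integrable_integral_eq)
    qed
  qed
  note * = this
  show ?thesis unfolding * by measurable
qed

lemma finite_measure_density_fmeas_iff:
  fixes h :: "torus \<Rightarrow> real"
  assumes h [measurable]: "h \<in> borel_measurable borel"
  shows "finite_measure (density (measure_of_fmeas m) (\<lambda>x. ennreal (h x)))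
    \<longleftrightarrow> (\<integral>\<^sup>+x. ennreal (h x) \<partial>measure_of_fmeas m) < \<infinity>"
proof -
  have *: "emeasure (density (measure_of_fmeas m) (\<lambda>x. ennreal (h x))) UNIV = (\<integral>\<^sup>+x. ennreal (h x) \<partial>measure_of_fmeas m)"
    by (subst emeasure_density) auto
  show ?thesis
  proof
    assume "finite_measure (density (measure_of_fmeas m) (\<lambda>x. ennreal (h x)))"
    from finite_measure.emeasure_finite[OF this, of UNIV]
    show "(\<integral>\<^sup>+x. ennreal (h x) \<partial>measure_of_fmeas m) < \<infinity>" by (simp add: * less_top)
  qed (auto intro!: finite_measureI simp: *)
qed

lemma measure_of_fmeas_tilt:
  assumes h: "h \<in> borel_measurable borel"
  shows "measure_of_fmeas (tilt h m) = (if (\<integral>\<^sup>+x. ennreal (h x) \<partial>measure_of_fmeas m) < \<infinity>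
    then density (measure_of_fmeas m) (\<lambda>x. ennreal (h x)) else null_measure borel)"
proof -
  have "finite_measure (null_measure (borel :: torus measure))" by (auto intro!: finite_measureI)
  then show ?thesis
    by (auto simp: tilt_def Let_def finite_measure_density_fmeas_iff[OF h] Abs_fmeas_inverse)
qed

lemma measurable_tilt:
  assumes h [measurable]: "h \<in> borel_measurable borel" and nn: "\<And>x. 0 \<le> h x"
  shows "tilt h \<in> borel \<rightarrow>\<^sub>M borel"
proof (rule measurable_fmeasI)
  fix j
  have r [measurable]: "rat_trig j \<in> borel_measurable borel"
    by (rule borel_measurable_continuous_onI) (rule continuous_rat_trig)
  have [measurable]: "(\<lambda>m. \<integral>x. h x * rat_trig j x \<partial>measure_of_fmeas m) \<in> borel_measurable borel"
    by (intro measurable_fmeas_integral_borel) measurable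
  have [measurable]: "(\<lambda>m. \<integral>\<^sup>+x. ennreal (h x) \<partial>measure_of_fmeas m) \<in> borel_measurable borel"
    by (intro measurable_fmeas_nn_integral) measurable
  have "(\<integral>x. rat_trig j x \<partial>measure_of_fmeas (tilt h m)) = (if (\<integral>\<^sup>+x. ennreal (h x) \<partial>measure_of_fmeas m) < \<infinity>
    then (\<integral>x. h x * rat_trig j x \<partial>measure_of_fmeas m) else 0)" for m
    using nn by (simp add: measure_of_fmeas_tilt integral_density)
  then show "(\<lambda>m. \<integral>x. rat_trig j x \<partial>measure_of_fmeas (tilt h m)) \<in> borel_measurable borel"
    by simp
qed

lemma measure_of_fmeas_pushforward:
  assumes T: "T \<in> borel \<rightarrow>\<^sub>M borel"
  shows "measure_of_fmeas (pushforward T m) = distr (measure_of_fmeas m) borel T"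
proof -
  have "T \<in> measure_of_fmeas m \<rightarrow>\<^sub>M borel" using T by simp
  then show ?thesis
    unfolding pushforward_def using finite_measure.finite_measure_distr[OF finite_measure_of_fmeas]
    by (intro Abs_fmeas_inverse) auto
qed

lemma integral_pushforward:
  fixes f :: "torus \<Rightarrow> real"
  assumes T: "T \<in> borel \<rightarrow>\<^sub>M borel" and f: "f \<in> borel_measurable borel"
  shows "(\<integral>x. f x \<partial>measure_of_fmeas (pushforward T m)) = (\<integral>x. f (T x) \<partial>measure_of_fmeas m)"
  unfolding measure_of_fmeas_pushforward[OF T] using T f by (intro integral_distr) simp_all

lemma measurable_pushforward:
  assumes T: "continuous_on UNIV T"
  shows "pushforward T \<in> borel \<rightarrow>\<^sub>M borel"
proof (rule measurable_fmeasI)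
  fix j
  have "rat_trig j \<in> borel_measurable borel"
    by (rule borel_measurable_continuous_onI) (rule continuous_rat_trig)
  then show "(\<lambda>m. \<integral>x. rat_trig j x \<partial>measure_of_fmeas (pushforward T m)) \<in> borel_measurable borel"
    using measurable_fmeas_integral[OF continuous_on_compose2[OF continuous_rat_trig T]]
    by (simp add: integral_pushforward measurable_continuous_torus[OF T])
qed

lemma pushforward_inverse:
  assumes S: "continuous_on UNIV S" and T: "continuous_on UNIV T" and ST: "\<And>x. S (T x) = x"
  shows "pushforward S (pushforward T m) = m"
proof -
  note m = measurable_continuous_torus[OF S] measurable_continuous_torus[OF T]
  have "distr (distr (measure_of_fmeas m) borel T) borel S = distr (measure_of_fmeas m) borel (\<lambda>x. x)"
    using m by (subst distr_distr) (auto simp: comp_def ST)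
  also have "\<dots> = measure_of_fmeas m" by (rule measure_eqI) (auto simp: emeasure_distr)
  finally show ?thesis
    by (simp add: measure_of_fmeas_inject[symmetric] measure_of_fmeas_pushforward m)
qed

text \<open>Outside the finite case both sides are the null measure, since the total masses agree.\<close>

lemma pushforward_tilt:
  assumes S: "continuous_on UNIV S" and T: "continuous_on UNIV T" and ST: "\<And>x. S (T x) = x"
    and h [measurable]: "h \<in> borel_measurable borel"
  shows "pushforward T (tilt h m) = tilt (\<lambda>x. h (S x)) (pushforward T m)"
proof -
  have m [measurable]: "S \<in> borel \<rightarrow>\<^sub>M borel" "T \<in> borel \<rightarrow>\<^sub>M borel"
    using measurable_continuous_torus S T by auto
  have hS [measurable]: "(\<lambda>x. h (S x)) \<in> borel_measurable borel" by measurable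
  have mass: "(\<integral>\<^sup>+x. ennreal (h (S x)) \<partial>distr (measure_of_fmeas m) borel T) = (\<integral>\<^sup>+x. ennreal (h x) \<partial>measure_of_fmeas m)"
    by (subst nn_integral_distr) (auto simp: ST)
  have d: "distr (density (measure_of_fmeas m) (\<lambda>x. ennreal (h x))) borel T
    = density (distr (measure_of_fmeas m) borel T) (\<lambda>x. ennreal (h (S x)))"
  proof (rule measure_eqI)
    fix A assume "A \<in> sets (distr (density (measure_of_fmeas m) (\<lambda>x. ennreal (h x))) borel T)"
    then have A [measurable]: "A \<in> sets borel" by simp
    have TA: "T -` A \<in> sets borel" using measurable_sets[OF m(2) A] by simp
    have "emeasure (distr (density (measure_of_fmeas m) (\<lambda>x. ennreal (h x))) borel T) A
      = (\<integral>\<^sup>+x. ennreal (h x) * indicator (T -` A) x \<partial>measure_of_fmeas m)"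
      using TA by (simp add: emeasure_distr emeasure_density)
    also have "\<dots> = (\<integral>\<^sup>+x. ennreal (h (S x)) * indicator A x \<partial>distr (measure_of_fmeas m) borel T)"
      by (subst nn_integral_distr) (auto simp: ST indicator_def intro!: nn_integral_cong)
    finally show "emeasure (distr (density (measure_of_fmeas m) (\<lambda>x. ennreal (h x))) borel T) A
      = emeasure (density (distr (measure_of_fmeas m) borel T) (\<lambda>x. ennreal (h (S x)))) A"
      by (simp add: emeasure_density)
  qed simp
  have null: "distr (null_measure (borel :: torus measure)) borel T = null_measure borel"
    by (rule measure_eqI) (auto simp: emeasure_distr)
  show ?thesis
    by (simp add: measure_of_fmeas_inject[symmetric] measure_of_fmeas_pushforward[OF m(2)]
        measure_of_fmeas_tilt[OF h] measure_of_fmeas_tilt[OF hS] mass d null)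
qed

section \<open>The chaos measure is a function of the field\<close>

lemma tendsto_in_prob_AE_subseq:
  assumes "prob_space P"
    and Y: "\<And>n. Y n \<in> borel_measurable P" and Z: "Z \<in> borel_measurable P"
    and lim: "tendsto_in_prob P Y Z sequentially"
  shows "\<exists>r. strict_mono r \<and> (AE \<omega> in P. (\<lambda>n. Y (r n) \<omega>) \<longlonglongrightarrow> Z \<omega>)"
proof -
  interpret prob_space P by fact
  note [measurable] = Y Z
  \<comment> \<open>Truncation turns convergence in probability into convergence in \<open>L\<^sup>1\<close>.\<close>
  define u where "u n \<omega> = min 1 \<bar>Y n \<omega> - Z \<omega>\<bar>" for n \<omega>
  have um [measurable]: "u n \<in> borel_measurable P" for n unfolding u_def by measurable
  have i: "integrable P (u n)" for n
    by (intro integrable_const_bound[of _ 1]) (auto simp: u_def)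
  have "(\<lambda>n. \<integral>\<omega>. norm (u n \<omega>) \<partial>P) \<longlonglongrightarrow> 0"
  proof (rule LIMSEQ_I)
    fix e :: real assume e: "0 < e"
    have "(\<lambda>n. measure P {\<omega> \<in> space P. e / 3 < \<bar>Y n \<omega> - Z \<omega>\<bar>}) \<longlonglongrightarrow> 0"
      using lim divide_pos_pos[OF e zero_less_numeral] unfolding tendsto_in_prob_def by blast
    from LIMSEQ_D[OF this, of "e / 3"] e
    obtain N where "\<forall>n\<ge>N. norm (measure P {\<omega> \<in> space P. e / 3 < \<bar>Y n \<omega> - Z \<omega>\<bar>} - 0) < e / 3" by auto
    then have N: "norm (measure P {\<omega> \<in> space P. e / 3 < \<bar>Y n \<omega> - Z \<omega>\<bar>} - 0) < e / 3" if "N \<le> n" for n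
      using that by blast
    have "norm ((\<integral>\<omega>. norm (u n \<omega>) \<partial>P) - 0) < e" if n: "N \<le> n" for n
    proof -
      let ?S = "{\<omega> \<in> space P. e / 3 < \<bar>Y n \<omega> - Z \<omega>\<bar>}"
      have S [measurable]: "?S \<in> sets P" by measurable
      have "(\<integral>\<omega>. norm (u n \<omega>) \<partial>P) \<le> (\<integral>\<omega>. e / 3 + indicat_real ?S \<omega> \<partial>P)"
      proof (rule integral_mono)
        show "integrable P (\<lambda>\<omega>. norm (u n \<omega>))" using i by (rule integrable_norm)
        show "integrable P (\<lambda>\<omega>. e / 3 + indicat_real ?S \<omega>)"
          by (intro integrable_const_bound[of _ "e / 3 + 1"]) (use e in \<open>auto simp: indicator_def\<close>)
        show "norm (u n \<omega>) \<le> e / 3 + indicat_real ?S \<omega>" if "\<omega> \<in> space P" for \<omega>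
          using that e by (cases "e / 3 < \<bar>Y n \<omega> - Z \<omega>\<bar>") (auto simp: u_def min_def)
      qed
      also have "\<dots> = e / 3 + measure P ?S"
      proof -
        have "integrable P (indicat_real ?S)"
          by (intro integrable_const_bound[of _ 1]) (auto simp: indicator_def)
        moreover have "?S \<inter> space P = ?S" by auto
        ultimately show ?thesis by (simp add: prob_space)
      qed
      also have "\<dots> < e" using N[OF n] e by simp
      finally show ?thesis by simp
    qed
    then show "\<exists>N. \<forall>n\<ge>N. norm ((\<integral>\<omega>. norm (u n \<omega>) \<partial>P) - 0) < e" by blast
  qed
  from tendsto_L1_AE_subseq[OF i this] obtain r where r: "strict_mono r" "AE \<omega> in P. (\<lambda>n. u (r n) \<omega>) \<longlonglongrightarrow> 0"
    by blast
  have "AE \<omega> in P. (\<lambda>n. Y (r n) \<omega>) \<longlonglongrightarrow> Z \<omega>"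
    using r(2)
  proof eventually_elim
    case (elim \<omega>)
    have "\<forall>\<^sub>F n in sequentially. u (r n) \<omega> < 1"
      using elim by (rule order_tendstoD) simp
    then have "\<forall>\<^sub>F n in sequentially. u (r n) \<omega> = \<bar>Y (r n) \<omega> - Z \<omega>\<bar>"
      by eventually_elim (auto simp: u_def min_def split: if_splits)
    then have "(\<lambda>n. \<bar>Y (r n) \<omega> - Z \<omega>\<bar>) \<longlonglongrightarrow> 0" using elim by (rule Lim_transform_eventually[rotated])
    then show ?case by (rule LIM_zero_cancel[OF tendsto_rabs_zero_cancel])
  qed
  then show ?thesis using r by blast
qed

text \<open>The relation makes it possible to compare random variables on different probability spaces without
  naming the function of the field that they represent. It survives limits in probability, and it
  determines the joint law with the field.\<close>

definition common_version ::
  "'a measure \<Rightarrow> ('a \<Rightarrow> hm1) \<Rightarrow> 'b measure \<Rightarrow> ('b \<Rightarrow> hm1) \<Rightarrow> ('a \<Rightarrow> real) \<Rightarrow> ('b \<Rightarrow> real) \<Rightarrow> bool" where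
  "common_version P X P' X' Y Y' \<longleftrightarrow>
     Y \<in> borel_measurable P \<and> Y' \<in> borel_measurable P' \<and>
     (\<exists>y\<in>borel_measurable borel. (AE \<omega> in P. Y \<omega> = y (X \<omega>)) \<and> (AE \<omega> in P'. Y' \<omega> = y (X' \<omega>)))"

lemma common_version_function:
  assumes "X \<in> P \<rightarrow>\<^sub>M borel" "X' \<in> P' \<rightarrow>\<^sub>M borel" "y \<in> borel_measurable borel"
  shows "common_version P X P' X' (\<lambda>\<omega>. y (X \<omega>)) (\<lambda>\<omega>. y (X' \<omega>))"
  unfolding common_version_def using assms by (intro conjI bexI[of _ y]) auto

lemma common_version_compose:
  assumes "common_version P X P' X' Y Y'" and h [measurable]: "h \<in> borel_measurable borel"
  shows "common_version P X P' X' (\<lambda>\<omega>. h (Y \<omega>)) (\<lambda>\<omega>. h (Y' \<omega>))"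
proof -
  obtain y where y [measurable]: "y \<in> borel_measurable borel" "Y \<in> borel_measurable P" "Y' \<in> borel_measurable P'"
    and ae: "AE \<omega> in P. Y \<omega> = y (X \<omega>)" "AE \<omega> in P'. Y' \<omega> = y (X' \<omega>)"
    using assms(1) unfolding common_version_def by blast
  have "AE \<omega> in P. h (Y \<omega>) = h (y (X \<omega>))" using ae(1) by eventually_elim simp
  moreover have "AE \<omega> in P'. h (Y' \<omega>) = h (y (X' \<omega>))" using ae(2) by eventually_elim simp
  moreover have "(\<lambda>u. h (y u)) \<in> borel_measurable borel" by measurable
  ultimately show ?thesis unfolding common_version_def by (intro conjI bexI[of _ "\<lambda>u. h (y u)"]) auto
qed

lemma common_version_add:
  assumes "common_version P X P' X' Y Y'" "common_version P X P' X' Z Z'"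
  shows "common_version P X P' X' (\<lambda>\<omega>. Y \<omega> + Z \<omega>) (\<lambda>\<omega>. Y' \<omega> + Z' \<omega>)"
proof -
  obtain y where y [measurable]: "y \<in> borel_measurable borel" "Y \<in> borel_measurable P" "Y' \<in> borel_measurable P'"
    and ae: "AE \<omega> in P. Y \<omega> = y (X \<omega>)" "AE \<omega> in P'. Y' \<omega> = y (X' \<omega>)"
    using assms(1) unfolding common_version_def by blast
  obtain z where z [measurable]: "z \<in> borel_measurable borel" "Z \<in> borel_measurable P" "Z' \<in> borel_measurable P'"
    and ae': "AE \<omega> in P. Z \<omega> = z (X \<omega>)" "AE \<omega> in P'. Z' \<omega> = z (X' \<omega>)"
    using assms(2) unfolding common_version_def by blast
  have "AE \<omega> in P. Y \<omega> + Z \<omega> = y (X \<omega>) + z (X \<omega>)" using ae(1) ae'(1) by eventually_elim simp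
  moreover have "AE \<omega> in P'. Y' \<omega> + Z' \<omega> = y (X' \<omega>) + z (X' \<omega>)" using ae(2) ae'(2) by eventually_elim simp
  moreover have "(\<lambda>u. y u + z u) \<in> borel_measurable borel" by measurable
  ultimately show ?thesis unfolding common_version_def by (intro conjI bexI[of _ "\<lambda>u. y u + z u"]) auto
qed

lemma common_version_sum:
  assumes "finite I" "\<And>i. i \<in> I \<Longrightarrow> common_version P X P' X' (Y i) (Y' i)"
  shows "common_version P X P' X' (\<lambda>\<omega>. \<Sum>i\<in>I. Y i \<omega>) (\<lambda>\<omega>. \<Sum>i\<in>I. Y' i \<omega>)"
  using assms
proof (induction I rule: finite_induct)
  case empty
  then show ?case unfolding common_version_def by (intro conjI bexI[of _ "\<lambda>_. 0"]) auto
next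
  case (insert i I)
  then show ?case using common_version_add[of P X P' X' "Y i" "Y' i"] by simp
qed

lemma common_version_lim_AE:
  assumes c: "\<And>n. common_version P X P' X' (Y n) (Y' n)"
    and Z: "Z \<in> borel_measurable P" "Z' \<in> borel_measurable P'"
    and lim: "AE \<omega> in P. (\<lambda>n. Y n \<omega>) \<longlonglongrightarrow> Z \<omega>" "AE \<omega> in P'. (\<lambda>n. Y' n \<omega>) \<longlonglongrightarrow> Z' \<omega>"
  shows "common_version P X P' X' Z Z'"
proof -
  have "\<exists>y\<in>borel_measurable borel. (AE \<omega> in P. Y n \<omega> = y (X \<omega>)) \<and> (AE \<omega> in P'. Y' n \<omega> = y (X' \<omega>))" for n
    using c unfolding common_version_def by blast
  then obtain y where y: "\<And>n. y n \<in> borel_measurable borel"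
    "\<And>n. AE \<omega> in P. Y n \<omega> = y n (X \<omega>)" "\<And>n. AE \<omega> in P'. Y' n \<omega> = y n (X' \<omega>)" by metis
  have "AE \<omega> in P. \<forall>n. Y n \<omega> = y n (X \<omega>)" using y(2) by (simp add: AE_all_countable)
  then have "AE \<omega> in P. Z \<omega> = lim (\<lambda>n. y n (X \<omega>))"
    using lim(1) by eventually_elim (simp add: limI)
  moreover have "AE \<omega> in P'. \<forall>n. Y' n \<omega> = y n (X' \<omega>)" using y(3) by (simp add: AE_all_countable)
  then have "AE \<omega> in P'. Z' \<omega> = lim (\<lambda>n. y n (X' \<omega>))"
    using lim(2) by eventually_elim (simp add: limI)
  moreover have "(\<lambda>u. lim (\<lambda>n. y n u)) \<in> borel_measurable borel"
    using y(1) by (rule borel_measurable_lim_metric)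
  ultimately show ?thesis
    unfolding common_version_def using Z by (intro conjI bexI[of _ "\<lambda>u. lim (\<lambda>n. y n u)"]) auto
qed

lemma tendsto_in_prob_compose:
  assumes "tendsto_in_prob P Y Z F" "filterlim r F F'"
  shows "tendsto_in_prob P (\<lambda>i. Y (r i)) Z F'"
  using assms unfolding tendsto_in_prob_def by (auto intro: filterlim_compose)

text \<open>A subsequence of a subsequence converges almost surely on both spaces.\<close>

lemma common_version_lim_prob:
  assumes P: "prob_space P" "prob_space P'" and c: "\<And>n. common_version P X P' X' (Y n) (Y' n)"
    and Z: "Z \<in> borel_measurable P" "Z' \<in> borel_measurable P'"
    and lim: "tendsto_in_prob P Y Z sequentially" "tendsto_in_prob P' Y' Z' sequentially"
  shows "common_version P X P' X' Z Z'"
proof -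
  have m: "Y n \<in> borel_measurable P" "Y' n \<in> borel_measurable P'" for n
    using c unfolding common_version_def by auto
  obtain r where r: "strict_mono r" "AE \<omega> in P. (\<lambda>n. Y (r n) \<omega>) \<longlonglongrightarrow> Z \<omega>"
    using tendsto_in_prob_AE_subseq[OF P(1) m(1) Z(1) lim(1)] by blast
  have "tendsto_in_prob P' (\<lambda>n. Y' (r n)) Z' sequentially"
    by (rule tendsto_in_prob_compose[OF lim(2) filterlim_subseq[OF r(1)]])
  then obtain s where s: "strict_mono s" "AE \<omega> in P'. (\<lambda>n. Y' (r (s n)) \<omega>) \<longlonglongrightarrow> Z' \<omega>"
    using tendsto_in_prob_AE_subseq[OF P(2) m(2) Z(2)] by blast
  have "AE \<omega> in P. (\<lambda>n. Y (r (s n)) \<omega>) \<longlonglongrightarrow> Z \<omega>"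
    using r(2) by eventually_elim (rule LIMSEQ_subseq_LIMSEQ[OF _ s(1), unfolded comp_def])
  from common_version_lim_AE[OF c Z this s(2)] show ?thesis .
qed

text \<open>The weights do not depend on the function, so that Riemann sums of a random function are finite
  combinations of its values.\<close>

lemma torus_riemann_sums:
  obtains I :: "nat \<Rightarrow> torus set" and c :: "nat \<Rightarrow> torus \<Rightarrow> real"
  where "\<And>N. finite (I N)"
    "\<And>f :: torus \<Rightarrow> real. continuous_on UNIV f \<Longrightarrow> (\<lambda>N. \<Sum>q\<in>I N. c N q * f q) \<longlonglongrightarrow> (\<integral>x. f x \<partial>torus_lebesgue)"
proof -
  let ?Q = "{0..<1} \<times> {0..<1} :: (real \<times> real) set"
  have Q [measurable]: "?Q \<in> sets borel" by (rule borel_Times) auto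
  define s where "s N p = (real_of_int \<lfloor>real (Suc N) * fst p\<rfloor> / real (Suc N), real_of_int \<lfloor>real (Suc N) * snd p\<rfloor> / real (Suc N))"
    for N and p :: "real \<times> real"
  have sm [measurable]: "s N \<in> borel_measurable borel" for N
  proof -
    have "(\<lambda>p. real_of_int \<lfloor>real (Suc N) * h p\<rfloor> / real (Suc N)) \<in> borel_measurable borel"
      if [measurable]: "h \<in> borel_measurable borel" for h :: "real \<times> real \<Rightarrow> real" by measurable
    moreover have "(fst :: real \<times> real \<Rightarrow> real) \<in> borel_measurable borel" "(snd :: real \<times> real \<Rightarrow> real) \<in> borel_measurable borel"
      by (intro borel_measurable_continuous_onI continuous_intros)+
    ultimately show ?thesis unfolding s_def by (intro borel_measurable_Pair)
  qed
  define J where "J N = s N ` ?Q" for N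
  have finJ: "finite (J N)" for N
  proof (rule finite_subset)
    let ?g = "\<lambda>(i :: int, j :: int). (real_of_int i / real (Suc N), real_of_int j / real (Suc N))"
    show "J N \<subseteq> ?g ` ({0..int N} \<times> {0..int N})"
    proof
      fix q assume "q \<in> J N"
      then obtain p where p: "p \<in> ?Q" "q = s N p" by (auto simp: J_def)
      have "\<lfloor>real (Suc N) * t\<rfloor> \<in> {0..int N}" if "0 \<le> t" "t < 1" for t
      proof -
        have "real (Suc N) * t < real (Suc N) * 1" by (rule mult_strict_left_mono) (use that in auto)
        then have "\<lfloor>real (Suc N) * t\<rfloor> < int (Suc N)" by (simp add: floor_less_iff)
        moreover have "0 \<le> \<lfloor>real (Suc N) * t\<rfloor>" using that by simp
        ultimately show ?thesis by simp
      qed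
      then have "(\<lfloor>real (Suc N) * fst p\<rfloor>, \<lfloor>real (Suc N) * snd p\<rfloor>) \<in> {0..int N} \<times> {0..int N}"
        using p by (auto simp: mem_Times_iff)
      then show "q \<in> ?g ` ({0..int N} \<times> {0..int N})" unfolding p(2) s_def by (rule rev_image_eqI) simp
    qed
  qed simp
  have slim: "(\<lambda>N. s N p) \<longlonglongrightarrow> p" for p
  proof -
    have "(\<lambda>N. real_of_int \<lfloor>real (Suc N) * t\<rfloor> / real (Suc N)) \<longlonglongrightarrow> t" for t
    proof (rule tendsto_sandwich[of "\<lambda>N. t - 1 / real (Suc N)" _ _ "\<lambda>_. t"])
      show "\<forall>\<^sub>F N in sequentially. t - 1 / real (Suc N) \<le> real_of_int \<lfloor>real (Suc N) * t\<rfloor> / real (Suc N)"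
      proof (intro always_eventually allI)
        fix N
        have "real (Suc N) * t - 1 \<le> real_of_int \<lfloor>real (Suc N) * t\<rfloor>" by linarith
        then have "(real (Suc N) * t - 1) / real (Suc N) \<le> real_of_int \<lfloor>real (Suc N) * t\<rfloor> / real (Suc N)"
          by (rule divide_right_mono) simp
        then show "t - 1 / real (Suc N) \<le> real_of_int \<lfloor>real (Suc N) * t\<rfloor> / real (Suc N)"
          by (simp add: diff_divide_distrib)
      qed
      show "\<forall>\<^sub>F N in sequentially. real_of_int \<lfloor>real (Suc N) * t\<rfloor> / real (Suc N) \<le> t"
      proof (intro always_eventually allI)
        fix N
        have "real_of_int \<lfloor>real (Suc N) * t\<rfloor> \<le> t * real (Suc N)"
          using of_int_floor_le[of "real (Suc N) * t"] by (simp only: mult.commute)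
        then show "real_of_int \<lfloor>real (Suc N) * t\<rfloor> / real (Suc N) \<le> t" by (subst pos_divide_le_eq) auto
      qed
      show "(\<lambda>N. t - 1 / real (Suc N)) \<longlonglongrightarrow> t"
        using tendsto_diff[OF tendsto_const LIMSEQ_Suc[OF lim_1_over_n], of t] by simp
    qed simp
    then have "(\<lambda>N. s N p) \<longlonglongrightarrow> (fst p, snd p)" unfolding s_def by (intro tendsto_Pair)
    then show ?thesis by simp
  qed
  define w where "w N q = measure lborel (?Q \<inter> s N -` {q})" for N q
  have wm [measurable]: "?Q \<inter> s N -` {q} \<in> sets borel" for N q
    using measurable_sets[OF sm, of "{q}" N] by auto
  have wfin: "emeasure lborel (?Q \<inter> s N -` {q}) < \<infinity>" for N q
    using order_le_less_trans[OF emeasure_mono[of "?Q \<inter> s N -` {q}" ?Q lborel]] emeasure_unit_square by simp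
  have conv: "(\<lambda>N. \<Sum>q\<in>J N. w N q * f (abs_torus q)) \<longlonglongrightarrow> (\<integral>x. f x \<partial>torus_lebesgue)"
    if f: "continuous_on UNIV f" for f :: "torus \<Rightarrow> real"
  proof -
    have fm [measurable]: "f \<in> borel_measurable borel" using borel_measurable_continuous_onI[OF f] .
    have fa: "continuous_on UNIV (\<lambda>p. f (abs_torus p))" using f by (simp add: continuous_on_torus_iff)
    have fam [measurable]: "(\<lambda>p. f (abs_torus p)) \<in> borel_measurable borel" using borel_measurable_continuous_onI[OF fa] .
    obtain B where B: "0 < B" "\<And>x. \<bar>f x\<bar> \<le> B" using torus_continuous_bounded[OF f] by blast
    have "(\<Sum>q\<in>J N. w N q * f (abs_torus q)) = (\<integral>p. indicator ?Q p * f (abs_torus (s N p)) \<partial>lborel)" for N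
    proof -
      have "indicator ?Q p * f (abs_torus (s N p)) = (\<Sum>q\<in>J N. f (abs_torus q) * indicat_real (?Q \<inter> s N -` {q}) p)" for p
      proof (cases "p \<in> ?Q")
        case True
        then have "s N p \<in> J N" by (simp add: J_def)
        have "(\<Sum>q\<in>J N. f (abs_torus q) * indicat_real (?Q \<inter> s N -` {q}) p)
          = (\<Sum>q\<in>J N. if q = s N p then f (abs_torus q) else 0)"
          by (rule sum.cong) (use True in \<open>auto simp: indicator_def\<close>)
        then show ?thesis using True finJ \<open>s N p \<in> J N\<close> by simp
      qed simp
      then have "(\<integral>p. indicator ?Q p * f (abs_torus (s N p)) \<partial>lborel)
        = (\<Sum>q\<in>J N. f (abs_torus q) * (\<integral>p. indicat_real (?Q \<inter> s N -` {q}) p \<partial>lborel))"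
        using wm wfin by (simp add: integral_sum del: indicator_inter_arith)
      also have "\<dots> = (\<Sum>q\<in>J N. w N q * f (abs_torus q))"
        using wm by (simp add: w_def mult.commute)
      finally show ?thesis by simp
    qed
    moreover have "(\<lambda>N. \<integral>p. indicator ?Q p * f (abs_torus (s N p)) \<partial>lborel)
      \<longlonglongrightarrow> (\<integral>p. indicator ?Q p * f (abs_torus p) \<partial>lborel)"
    proof (rule integral_dominated_convergence[where w = "\<lambda>p. indicator ?Q p * B"])
      have "emeasure lborel ?Q < \<infinity>" by (simp add: emeasure_unit_square)
      then show "integrable lborel (\<lambda>p. indicat_real ?Q p * B)"
        using Q by (intro integrable_mult_left integrable_real_indicator) auto
      show "AE p in lborel. (\<lambda>N. indicat_real ?Q p * f (abs_torus (s N p))) \<longlonglongrightarrow> indicat_real ?Q p * f (abs_torus p)"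
      proof (intro AE_I2 tendsto_mult_left)
        fix p
        have "isCont (\<lambda>p. f (abs_torus p)) p" using fa unfolding continuous_on_eq_continuous_at[OF open_UNIV] by (rule bspec) simp
        from isCont_tendsto_compose[OF this slim] show "(\<lambda>N. f (abs_torus (s N p))) \<longlonglongrightarrow> f (abs_torus p)" .
      qed
      show "AE p in lborel. norm (indicat_real ?Q p * f (abs_torus (s N p))) \<le> indicat_real ?Q p * B" for N
        using B by (auto simp: indicator_def)
      have "(\<lambda>p. f (abs_torus (s N p))) \<in> borel_measurable borel" for N
        using measurable_compose[OF sm fam] .
      then show "(\<lambda>p. indicat_real ?Q p * f (abs_torus (s N p))) \<in> borel_measurable lborel" for N
        using Q by simp
    qed (use Q in simp)
    ultimately show ?thesis by (simp add: torus_lebesgue_integral[OF fm])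
  qed
  define I where "I N = abs_torus ` J N" for N
  define c where "c N x = (\<Sum>q\<in>{q\<in>J N. abs_torus q = x}. w N q)" for N x
  have "(\<Sum>x\<in>I N. c N x * f x) = (\<Sum>q\<in>J N. w N q * f (abs_torus q))" for N and f :: "torus \<Rightarrow> real"
  proof -
    have "(\<Sum>q\<in>J N. w N q * f (abs_torus q)) = (\<Sum>x\<in>I N. \<Sum>q\<in>{q\<in>J N. abs_torus q = x}. w N q * f (abs_torus q))"
      unfolding I_def by (rule sum.image_gen[OF finJ])
    also have "\<dots> = (\<Sum>x\<in>I N. c N x * f x)"
      unfolding c_def sum_distrib_right by (intro sum.cong) auto
    finally show ?thesis by simp
  qed
  then show ?thesis using that[of I c] finJ conv by (simp add: I_def)
qed

lemma circle_average_circle_mean: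
  assumes "circle_average \<tau> P X \<epsilon> x Y" "approx_identity \<rho>"
  shows "tendsto_in_prob P (\<lambda>k \<omega>. circle_mean \<tau> (\<rho> k) \<epsilon> x (X \<omega>)) Y sequentially"
  using assms unfolding circle_average_def circle_mean_def by blast

definition regularized_chaos ::
  "real \<Rightarrow> complex \<Rightarrow> (torus \<Rightarrow> real) \<Rightarrow> real \<Rightarrow> (torus \<Rightarrow> real) \<Rightarrow> real" where
  "regularized_chaos \<gamma> \<tau> f \<epsilon> v = (\<integral>x. f x \<partial>density (torus_vol \<tau>)
     (\<lambda>x. ennreal (\<epsilon> powr (\<gamma>\<^sup>2 / 2) * exp (\<gamma> * (v x - liouville_Q \<gamma> / 2 * ln (Im \<tau>))))))"

lemma regularized_chaos_eq:
  assumes \<tau>: "0 < Im \<tau>" and f: "continuous_on UNIV f" and v: "continuous_on UNIV v"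
  shows "regularized_chaos \<gamma> \<tau> f \<epsilon> v = (\<integral>x. Im \<tau> *
    (f x * (\<epsilon> powr (\<gamma>\<^sup>2 / 2) * exp (\<gamma> * (v x - liouville_Q \<gamma> / 2 * ln (Im \<tau>))))) \<partial>torus_lebesgue)"
proof -
  define w where "w x = \<epsilon> powr (\<gamma>\<^sup>2 / 2) * exp (\<gamma> * (v x - liouville_Q \<gamma> / 2 * ln (Im \<tau>)))" for x
  have "continuous_on UNIV w" unfolding w_def by (intro continuous_intros v)
  then have m: "f \<in> borel_measurable (torus_vol \<tau>)" "w \<in> borel_measurable (torus_vol \<tau>)"
    using borel_measurable_continuous_onI f by (auto cong: measurable_cong_sets)
  have "(\<integral>x. f x \<partial>density (torus_vol \<tau>) (\<lambda>x. ennreal (w x))) = (\<integral>x. w x *\<^sub>R f x \<partial>torus_vol \<tau>)"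
    by (rule integral_density[OF m]) (simp add: w_def)
  then have "(\<integral>x. f x \<partial>density (torus_vol \<tau>) (\<lambda>x. ennreal (w x))) = (\<integral>x. Im \<tau> * (f x * w x) \<partial>torus_lebesgue)"
    by (simp add: integral_torus_vol[OF \<tau>] mult.commute)
  then show ?thesis unfolding regularized_chaos_def w_def .
qed

text \<open>Each regularization of the chaos measure is a limit of Riemann sums of circle averages, and circle
  averages are limits of functions of the field.\<close>

lemma gmc_common_version:
  assumes \<tau>: "0 < Im \<tau>" and X: "gff G P X" and M: "gmc \<gamma> \<tau> P X M"
    and X': "gff G P' X'" and M': "gmc \<gamma> \<tau> P' X' M'" and f: "continuous_on UNIV f"
  shows "common_version P X P' X' (\<lambda>\<omega>. \<integral>x. f x \<partial>measure_of_fmeas (M \<omega>)) (\<lambda>\<omega>. \<integral>x. f x \<partial>measure_of_fmeas (M' \<omega>))"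
proof -
  have P: "prob_space P" "prob_space P'" and Xm: "X \<in> P \<rightarrow>\<^sub>M borel" "X' \<in> P' \<rightarrow>\<^sub>M borel"
    using X X' by (auto simp: gff_def)
  have Mm: "M \<in> P \<rightarrow>\<^sub>M borel" "M' \<in> P' \<rightarrow>\<^sub>M borel" using M M' by (auto simp: gmc_def)
  obtain A where A: "\<And>\<epsilon> x. 0 < \<epsilon> \<Longrightarrow> circle_average \<tau> P X \<epsilon> x (A \<epsilon> x)"
    "\<And>\<epsilon> \<omega>. 0 < \<epsilon> \<Longrightarrow> \<omega> \<in> space P \<Longrightarrow> continuous_on UNIV (\<lambda>x. A \<epsilon> x \<omega>)"
    "tendsto_in_prob P (\<lambda>\<epsilon> \<omega>. regularized_chaos \<gamma> \<tau> f \<epsilon> (\<lambda>x. A \<epsilon> x \<omega>))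
       (\<lambda>\<omega>. \<integral>x. f x \<partial>measure_of_fmeas (M \<omega>)) (at_right 0)"
    using M f unfolding gmc_def regularized_chaos_def by blast
  obtain A' where A': "\<And>\<epsilon> x. 0 < \<epsilon> \<Longrightarrow> circle_average \<tau> P' X' \<epsilon> x (A' \<epsilon> x)"
    "\<And>\<epsilon> \<omega>. 0 < \<epsilon> \<Longrightarrow> \<omega> \<in> space P' \<Longrightarrow> continuous_on UNIV (\<lambda>x. A' \<epsilon> x \<omega>)"
    "tendsto_in_prob P' (\<lambda>\<epsilon> \<omega>. regularized_chaos \<gamma> \<tau> f \<epsilon> (\<lambda>x. A' \<epsilon> x \<omega>))
       (\<lambda>\<omega>. \<integral>x. f x \<partial>measure_of_fmeas (M' \<omega>)) (at_right 0)"
    using M' f unfolding gmc_def regularized_chaos_def by blast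
  obtain \<rho> where \<rho>: "approx_identity \<rho>" using approx_identity_exists by blast
  have avg: "common_version P X P' X' (A \<epsilon> x) (A' \<epsilon> x)" if \<epsilon>: "0 < \<epsilon>" for \<epsilon> x
  proof (rule common_version_lim_prob[OF P])
    show "A \<epsilon> x \<in> borel_measurable P" "A' \<epsilon> x \<in> borel_measurable P'"
      using A(1)[OF \<epsilon>] A'(1)[OF \<epsilon>] by (auto simp: circle_average_def)
    show "common_version P X P' X' (\<lambda>\<omega>. circle_mean \<tau> (\<rho> k) \<epsilon> x (X \<omega>)) (\<lambda>\<omega>. circle_mean \<tau> (\<rho> k) \<epsilon> x (X' \<omega>))" for k
      using \<tau> by (intro common_version_function[OF Xm] borel_measurable_continuous_onI continuous_circle_mean) simp
  qed (rule circle_average_circle_mean[OF A(1)[OF \<epsilon>] \<rho>] circle_average_circle_mean[OF A'(1)[OF \<epsilon>] \<rho>])+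
  obtain I :: "nat \<Rightarrow> torus set" and c where I: "\<And>N. finite (I N)"
    and Ic: "\<And>f :: torus \<Rightarrow> real. continuous_on UNIV f \<Longrightarrow> (\<lambda>N. \<Sum>q\<in>I N. c N q * f q) \<longlonglongrightarrow> (\<integral>x. f x \<partial>torus_lebesgue)"
    using torus_riemann_sums by metis
  define g where "g \<epsilon> x t = Im \<tau> * (f x * (\<epsilon> powr (\<gamma>\<^sup>2 / 2) * exp (\<gamma> * (t - liouville_Q \<gamma> / 2 * ln (Im \<tau>)))))" for \<epsilon> x t
  have riem: "(\<lambda>N. \<Sum>q\<in>I N. c N q * g \<epsilon> q (v q)) \<longlonglongrightarrow> regularized_chaos \<gamma> \<tau> f \<epsilon> v"
    if v: "continuous_on UNIV v" for v \<epsilon>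
    unfolding regularized_chaos_eq[OF \<tau> f v] g_def by (rule Ic) (intro continuous_intros f v)
  have reg: "common_version P X P' X' (\<lambda>\<omega>. regularized_chaos \<gamma> \<tau> f \<epsilon> (\<lambda>x. A \<epsilon> x \<omega>))
      (\<lambda>\<omega>. regularized_chaos \<gamma> \<tau> f \<epsilon> (\<lambda>x. A' \<epsilon> x \<omega>))" if \<epsilon>: "0 < \<epsilon>" for \<epsilon>
  proof (rule common_version_lim_AE)
    show cv: "common_version P X P' X' (\<lambda>\<omega>. \<Sum>q\<in>I N. c N q * g \<epsilon> q (A \<epsilon> q \<omega>)) (\<lambda>\<omega>. \<Sum>q\<in>I N. c N q * g \<epsilon> q (A' \<epsilon> q \<omega>))" for N
      by (intro common_version_sum I common_version_compose[OF avg[OF \<epsilon>], where h = "\<lambda>t. c N q * g \<epsilon> q t" for q])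
        (unfold g_def, measurable)
    note lim = riem[OF A(2)[OF \<epsilon>]] riem[OF A'(2)[OF \<epsilon>]]
    show "(\<lambda>\<omega>. regularized_chaos \<gamma> \<tau> f \<epsilon> (\<lambda>x. A \<epsilon> x \<omega>)) \<in> borel_measurable P"
      by (rule borel_measurable_LIMSEQ_real[OF lim(1) cv[unfolded common_version_def, THEN conjunct1]])
    show "(\<lambda>\<omega>. regularized_chaos \<gamma> \<tau> f \<epsilon> (\<lambda>x. A' \<epsilon> x \<omega>)) \<in> borel_measurable P'"
      by (rule borel_measurable_LIMSEQ_real[OF lim(2) cv[unfolded common_version_def, THEN conjunct2, THEN conjunct1]])
  qed (rule AE_I2, erule riem[OF A(2)[OF \<epsilon>]] riem[OF A'(2)[OF \<epsilon>]])+
  have seq: "filterlim (\<lambda>n. 1 / real (Suc n)) (at_right 0) sequentially"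
    unfolding filterlim_at using LIMSEQ_Suc[OF lim_1_over_n] by auto
  show ?thesis
  proof (rule common_version_lim_prob[OF P])
    show "(\<lambda>\<omega>. \<integral>x. f x \<partial>measure_of_fmeas (M \<omega>)) \<in> borel_measurable P"
      "(\<lambda>\<omega>. \<integral>x. f x \<partial>measure_of_fmeas (M' \<omega>)) \<in> borel_measurable P'"
      using measurable_compose[OF Mm(1) measurable_fmeas_integral[OF f]]
        measurable_compose[OF Mm(2) measurable_fmeas_integral[OF f]] by auto
    show "common_version P X P' X'
      (\<lambda>\<omega>. regularized_chaos \<gamma> \<tau> f (1 / real (Suc n)) (\<lambda>x. A (1 / real (Suc n)) x \<omega>))
      (\<lambda>\<omega>. regularized_chaos \<gamma> \<tau> f (1 / real (Suc n)) (\<lambda>x. A' (1 / real (Suc n)) x \<omega>))" for n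
      by (rule reg) simp
  qed (rule tendsto_in_prob_compose[OF A(3) seq] tendsto_in_prob_compose[OF A'(3) seq])+
qed

text \<open>A countable family of integrals separates finite measures, so that almost surely all of them are
  simultaneously functions of the field, the same ones on both probability spaces. The joint law is
  therefore a function of the law of the field.\<close>

lemma gff_gmc_law_unique:
  assumes \<tau>: "0 < Im \<tau>" and X: "gff G P X" and M: "gmc \<gamma> \<tau> P X M"
    and X': "gff G P' X'" and M': "gmc \<gamma> \<tau> P' X' M'"
  shows "distr P (borel \<Otimes>\<^sub>M borel) (\<lambda>\<omega>. (X \<omega>, M \<omega>)) = distr P' (borel \<Otimes>\<^sub>M borel) (\<lambda>\<omega>. (X' \<omega>, M' \<omega>))"
proof -
  have Xm [measurable]: "X \<in> P \<rightarrow>\<^sub>M borel" "X' \<in> P' \<rightarrow>\<^sub>M borel" using X X' by (auto simp: gff_def)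
  have Mm [measurable]: "M \<in> P \<rightarrow>\<^sub>M borel" "M' \<in> P' \<rightarrow>\<^sub>M borel" using M M' by (auto simp: gmc_def)
  interpret P: prob_space P using X by (simp add: gff_def)
  interpret P': prob_space P' using X' by (simp add: gff_def)
  have "\<forall>j. \<exists>y. y \<in> borel_measurable borel \<and> (AE \<omega> in P. fmeas_coords (M \<omega>) j = y (X \<omega>))
      \<and> (AE \<omega> in P'. fmeas_coords (M' \<omega>) j = y (X' \<omega>))"
    using gmc_common_version[OF assms continuous_rat_trig] unfolding common_version_def fmeas_coords_def by blast
  from choice[OF this] obtain y where "\<forall>j. y j \<in> borel_measurable borel \<and> (AE \<omega> in P. fmeas_coords (M \<omega>) j = y j (X \<omega>))
      \<and> (AE \<omega> in P'. fmeas_coords (M' \<omega>) j = y j (X' \<omega>))" ..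
  then have y: "\<And>j. y j \<in> borel_measurable borel"
    "\<And>j. AE \<omega> in P. fmeas_coords (M \<omega>) j = y j (X \<omega>)" "\<And>j. AE \<omega> in P'. fmeas_coords (M' \<omega>) j = y j (X' \<omega>)"
    by simp_all
  define Y where "Y u = (\<lambda>j. y j u)" for u
  have Ym [measurable]: "Y \<in> borel \<rightarrow>\<^sub>M PiM UNIV (\<lambda>_. borel)"
    unfolding Y_def by (rule measurable_PiM_single') (auto simp: y(1))
  have ae: "AE \<omega> in P. fmeas_coords (M \<omega>) = Y (X \<omega>)" "AE \<omega> in P'. fmeas_coords (M' \<omega>) = Y (X' \<omega>)"
  proof -
    have "AE \<omega> in P. \<forall>j. fmeas_coords (M \<omega>) j = y j (X \<omega>)" using y(2) by (simp add: AE_all_countable)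
    then show "AE \<omega> in P. fmeas_coords (M \<omega>) = Y (X \<omega>)" by eventually_elim (auto simp: Y_def)
    have "AE \<omega> in P'. \<forall>j. fmeas_coords (M' \<omega>) j = y j (X' \<omega>)" using y(3) by (simp add: AE_all_countable)
    then show "AE \<omega> in P'. fmeas_coords (M' \<omega>) = Y (X' \<omega>)" by eventually_elim (auto simp: Y_def)
  qed
  let ?E = "{B \<times> V | B V. B \<in> sets (borel :: hm1 measure) \<and> V \<in> sets (borel :: fmeas measure)}"
  show ?thesis
  proof (rule measure_eqI_generator_eq[OF Int_stable_pair_measure_generator, where \<Omega> = UNIV and A = "\<lambda>_. UNIV"])
    show "?E \<subseteq> Pow UNIV" by simp
    show "sets (distr P (borel \<Otimes>\<^sub>M borel) (\<lambda>\<omega>. (X \<omega>, M \<omega>))) = sigma_sets UNIV ?E"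
      "sets (distr P' (borel \<Otimes>\<^sub>M borel) (\<lambda>\<omega>. (X' \<omega>, M' \<omega>))) = sigma_sets UNIV ?E"
      by (simp_all add: sets_pair_measure)
    show "range (\<lambda>_. UNIV) \<subseteq> ?E" by (auto intro!: exI[of _ UNIV])
    show "emeasure (distr P (borel \<Otimes>\<^sub>M borel) (\<lambda>\<omega>. (X \<omega>, M \<omega>))) UNIV \<noteq> \<infinity>"
      by (subst emeasure_distr) (auto simp: space_pair_measure[symmetric] sets.top[of "borel \<Otimes>\<^sub>M borel", simplified space_pair_measure, simplified])
    fix S assume "S \<in> ?E"
    then obtain B V where S: "S = B \<times> V" and B [measurable]: "B \<in> sets borel" and V: "V \<in> sets borel" by blast
    obtain C where C [measurable]: "C \<in> sets (PiM UNIV (\<lambda>_. borel))" and VC: "V = fmeas_coords -` C"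
      using borel_fmeas_coords[OF V] by blast
    have key: "emeasure (distr L (borel \<Otimes>\<^sub>M borel) (\<lambda>\<omega>. (Z \<omega>, N \<omega>))) S = emeasure (distr L borel Z) (B \<inter> Y -` C)"
      if [measurable]: "Z \<in> L \<rightarrow>\<^sub>M borel" "N \<in> L \<rightarrow>\<^sub>M borel" and ae: "AE \<omega> in L. fmeas_coords (N \<omega>) = Y (Z \<omega>)" for L :: "'z measure" and Z N
    proof -
      have YC [measurable]: "Y -` C \<in> sets borel" using measurable_sets[OF Ym C] by simp
      have "S \<in> sets (borel \<Otimes>\<^sub>M borel)" unfolding S using B V by (rule pair_measureI)
      then have "emeasure (distr L (borel \<Otimes>\<^sub>M borel) (\<lambda>\<omega>. (Z \<omega>, N \<omega>))) S = emeasure L ((\<lambda>\<omega>. (Z \<omega>, N \<omega>)) -` S \<inter> space L)"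
        by (subst emeasure_distr) auto
      also have "\<dots> = emeasure L (Z -` (B \<inter> Y -` C) \<inter> space L)"
      proof (rule emeasure_eq_AE)
        show "AE \<omega> in L. \<omega> \<in> (\<lambda>\<omega>. (Z \<omega>, N \<omega>)) -` S \<inter> space L \<longleftrightarrow> \<omega> \<in> Z -` (B \<inter> Y -` C) \<inter> space L"
          using ae by eventually_elim (auto simp: S VC)
        show "(\<lambda>\<omega>. (Z \<omega>, N \<omega>)) -` S \<inter> space L \<in> sets L"
          using \<open>S \<in> sets (borel \<Otimes>\<^sub>M borel)\<close> by measurable
        show "Z -` (B \<inter> Y -` C) \<inter> space L \<in> sets L" by measurable
      qed
      also have "\<dots> = emeasure (distr L borel Z) (B \<inter> Y -` C)" by (subst emeasure_distr) auto
      finally show ?thesis .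
    qed
    show "emeasure (distr P (borel \<Otimes>\<^sub>M borel) (\<lambda>\<omega>. (X \<omega>, M \<omega>))) S = emeasure (distr P' (borel \<Otimes>\<^sub>M borel) (\<lambda>\<omega>. (X' \<omega>, M' \<omega>))) S"
      by (simp only: key[OF Xm(1) Mm(1) ae(1)] key[OF Xm(2) Mm(2) ae(2)] gff_law_unique[OF X X'])
  qed auto
qed

section \<open>Modular covariance of the free field and of the chaos measure\<close>

text \<open>The covariances match because \<open>G'\<close> is \<open>G\<close> composed with the map and the map preserves \<open>\<lambda>\<close>.\<close>

lemma gff_modular_map:
  assumes det: "a * d - b * c = 1" and G': "\<And>x. G' x = G (torus_map a b c d x)" and X: "gff G P X"
  shows "gff G' P (\<lambda>\<omega>. hm1_comp (X \<omega>) (torus_map a b c d))"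
proof -
  let ?A = "torus_map a b c d" and ?t = "comp_test d (- b) (- c) a"
  have Xm: "X \<in> P \<rightarrow>\<^sub>M borel" using X by (simp add: gff_def)
  have "(\<lambda>\<omega>. hm1_comp (X \<omega>) ?A) \<in> P \<rightarrow>\<^sub>M borel"
    using measurable_compose[OF Xm borel_measurable_continuous_onI[OF continuous_hm1_comp[OF det]]] .
  moreover have "(\<integral>x. \<integral>y. test_fun (?t f) x * test_fun (?t g) y * G (x - y) \<partial>torus_lebesgue \<partial>torus_lebesgue)
    = (\<integral>x. \<integral>y. test_fun f x * test_fun g y * G' (x - y) \<partial>torus_lebesgue \<partial>torus_lebesgue)" for f g
  proof -
    define h where "h x = (\<integral>y. test_fun (?t f) x * test_fun (?t g) y * G (x - y) \<partial>torus_lebesgue)" for x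
    have "(\<integral>y. test_fun f x * test_fun g y * G' (x - y) \<partial>torus_lebesgue) = h (?A x)" for x
      using integral_torus_map[OF det, of "\<lambda>y. test_fun f x * test_fun (?t g) y * G (?A x - y)"]
      by (simp add: h_def G' torus_map_diff test_fun_comp_test torus_map_inverse'[OF det])
    then show ?thesis using integral_torus_map[OF det, of h] by (simp add: h_def)
  qed
  ultimately show ?thesis
    using X unfolding gff_def hm1_comp_apply[OF det] by simp
qed

text \<open>The powers of the dilation factor \<open>\<bar>c\<tau> + d\<bar>\<close> that come from the volume form, from the radius of
  the circles and from the conformal shift cancel exactly, because \<open>\<gamma> Q = 2 + \<gamma>\<^sup>2 / 2\<close>.\<close>

lemma chaos_weight_modular_map:
  assumes \<tau>: "0 < Im \<tau>" and det: "a * d - b * c = 1" and \<gamma>: "0 < \<gamma>" and \<epsilon>: "0 < \<epsilon>"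
  defines "\<tau>' \<equiv> modular_map a b c d \<tau>" and "r \<equiv> cmod (of_int c * \<tau> + of_int d)"
  shows "Im \<tau>' * (\<epsilon> powr (\<gamma>\<^sup>2 / 2) * exp (\<gamma> * (t - liouville_Q \<gamma> / 2 * ln (Im \<tau>'))))
    = Im \<tau> * ((\<epsilon> * r) powr (\<gamma>\<^sup>2 / 2) * exp (\<gamma> * (t - liouville_Q \<gamma> / 2 * ln (Im \<tau>))))"
proof -
  have r: "0 < r" unfolding r_def using modular_denominator_nonzero[OF \<tau> det] by simp
  have Im': "Im \<tau>' = Im \<tau> / r\<^sup>2" unfolding \<tau>'_def r_def by (rule Im_modular_map[OF \<tau> det])
  have lnI: "ln (Im \<tau>') = ln (Im \<tau>) - 2 * ln r"
    unfolding Im' using \<tau> r by (simp add: ln_div ln_realpow)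
  have \<gamma>Q: "2 + \<gamma>\<^sup>2 / 2 = \<gamma> * liouville_Q \<gamma>"
    using \<gamma> by (simp add: liouville_Q_def field_simps power2_eq_square)
  have "\<gamma> * (t - liouville_Q \<gamma> / 2 * ln (Im \<tau>'))
    = \<gamma> * (t - liouville_Q \<gamma> / 2 * ln (Im \<tau>)) + (2 + \<gamma>\<^sup>2 / 2) * ln r"
    unfolding lnI \<gamma>Q by (simp add: algebra_simps)
  moreover have "exp ((2 + \<gamma>\<^sup>2 / 2) * ln r) = r\<^sup>2 * r powr (\<gamma>\<^sup>2 / 2)"
    using r by (simp add: distrib_right exp_add powr_def exp_of_nat_mult[of 2, simplified])
  ultimately show ?thesis
    using r \<epsilon> by (simp add: Im' exp_add powr_mult)
qed

lemma tendsto_in_prob_cong: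
  assumes "\<forall>\<^sub>F i in F. \<forall>\<omega>\<in>space P. Y i \<omega> = Y' i \<omega>" and "\<And>\<omega>. \<omega> \<in> space P \<Longrightarrow> Z \<omega> = Z' \<omega>"
    and "tendsto_in_prob P Y Z F"
  shows "tendsto_in_prob P Y' Z' F"
  unfolding tendsto_in_prob_def
proof (intro allI impI)
  fix \<delta> :: real assume "0 < \<delta>"
  then have "((\<lambda>i. measure P {\<omega> \<in> space P. \<delta> < \<bar>Y i \<omega> - Z \<omega>\<bar>}) \<longlongrightarrow> 0) F"
    using assms(3) by (simp add: tendsto_in_prob_def)
  moreover have "\<forall>\<^sub>F i in F. measure P {\<omega> \<in> space P. \<delta> < \<bar>Y i \<omega> - Z \<omega>\<bar>} = measure P {\<omega> \<in> space P. \<delta> < \<bar>Y' i \<omega> - Z' \<omega>\<bar>}"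
    using assms(1) by eventually_elim (rule arg_cong[of _ _ "measure P"], use assms(2) in auto)
  ultimately show "((\<lambda>i. measure P {\<omega> \<in> space P. \<delta> < \<bar>Y' i \<omega> - Z' \<omega>\<bar>}) \<longlongrightarrow> 0) F"
    by (rule Lim_transform_eventually)
qed

text \<open>The circle averages of the transformed field at radius \<open>\<epsilon>\<close> are those of the original field at radius
  \<open>\<epsilon> \<bar>c\<tau> + d\<bar>\<close>, and the regularized measures coincide before any limit is taken.\<close>

lemma gmc_modular_map:
  assumes \<tau>: "0 < Im \<tau>" and det: "a * d - b * c = 1" and \<gamma>: "0 < \<gamma>" and M: "gmc \<gamma> \<tau> P X M"
  shows "gmc \<gamma> (modular_map a b c d \<tau>) P (\<lambda>\<omega>. hm1_comp (X \<omega>) (torus_map a b c d))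
    (\<lambda>\<omega>. pushforward (inv (torus_map a b c d)) (M \<omega>))"
proof -
  let ?A = "torus_map a b c d" and ?B = "torus_map d (- b) (- c) a"
  define r where "r = cmod (of_int c * \<tau> + of_int d)"
  define \<tau>' where "\<tau>' = modular_map a b c d \<tau>"
  have r: "0 < r" unfolding r_def using modular_denominator_nonzero[OF \<tau> det] by simp
  have \<tau>'0: "0 < Im \<tau>'" using Im_modular_map[OF \<tau> det] r \<tau> by (simp add: \<tau>'_def r_def)
  have Mm: "M \<in> P \<rightarrow>\<^sub>M borel" using M by (simp add: gmc_def)
  obtain V where V: "\<And>\<epsilon> x. 0 < \<epsilon> \<Longrightarrow> circle_average \<tau> P X \<epsilon> x (V \<epsilon> x)"
    "\<And>\<epsilon> \<omega>. 0 < \<epsilon> \<Longrightarrow> \<omega> \<in> space P \<Longrightarrow> continuous_on UNIV (\<lambda>x. V \<epsilon> x \<omega>)"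
    "\<And>f. continuous_on UNIV f \<Longrightarrow> tendsto_in_prob P
       (\<lambda>\<epsilon> \<omega>. regularized_chaos \<gamma> \<tau> f \<epsilon> (\<lambda>x. V \<epsilon> x \<omega>))
       (\<lambda>\<omega>. \<integral>x. f x \<partial>measure_of_fmeas (M \<omega>)) (at_right 0)"
    using M unfolding gmc_def regularized_chaos_def by blast
  define W where "W \<epsilon> x = V (\<epsilon> * r) (?A x)" for \<epsilon> x
  have 1: "(\<lambda>\<omega>. pushforward (inv ?A) (M \<omega>)) \<in> P \<rightarrow>\<^sub>M borel"
    unfolding inv_torus_map[OF det] by (rule measurable_compose[OF Mm measurable_pushforward[OF continuous_torus_map]])
  have 2: "circle_average \<tau>' P (\<lambda>\<omega>. hm1_comp (X \<omega>) ?A) \<epsilon> x (W \<epsilon> x)" if \<epsilon>: "0 < \<epsilon>" for \<epsilon> x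
    unfolding circle_average_def circle_mean_def[symmetric]
  proof (intro conjI allI impI)
    have \<epsilon>r: "0 < \<epsilon> * r" using \<epsilon> r by simp
    show "W \<epsilon> x \<in> borel_measurable P" using V(1)[OF \<epsilon>r] by (simp add: circle_average_def W_def)
    fix \<rho> assume "approx_identity \<rho>"
    from circle_average_circle_mean[OF V(1)[OF \<epsilon>r] approx_identity_comp_test[OF det_inverse[OF det] this]]
    show "tendsto_in_prob P (\<lambda>k \<omega>. circle_mean \<tau>' (\<rho> k) \<epsilon> x (hm1_comp (X \<omega>) ?A)) (W \<epsilon> x) sequentially"
      unfolding \<tau>'_def circle_mean_hm1_comp[OF \<tau> det] W_def r_def .
  qed
  have cW: "continuous_on UNIV (\<lambda>x. W \<epsilon> x \<omega>)" if "0 < \<epsilon>" "\<omega> \<in> space P" for \<epsilon> \<omega>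
    unfolding W_def using continuous_on_compose2[OF V(2)[of "\<epsilon> * r" \<omega>] continuous_torus_map] that r by auto
  have 3: "tendsto_in_prob P (\<lambda>\<epsilon> \<omega>. regularized_chaos \<gamma> \<tau>' f \<epsilon> (\<lambda>x. W \<epsilon> x \<omega>))
       (\<lambda>\<omega>. \<integral>x. f x \<partial>measure_of_fmeas (pushforward (inv ?A) (M \<omega>))) (at_right 0)"
    if f: "continuous_on UNIV f" for f
  proof -
    have fB: "continuous_on UNIV (\<lambda>x. f (?B x))" using continuous_on_compose2[OF f continuous_torus_map] by auto
    have dil: "filterlim (\<lambda>\<epsilon>. \<epsilon> * r) (at_right 0) (at_right 0)"
      unfolding filterlim_at using r
      by (auto intro!: tendsto_eq_intros simp: eventually_at_filter)
    note lim = tendsto_in_prob_compose[OF V(3)[OF fB] dil]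
    have eq: "regularized_chaos \<gamma> \<tau> (\<lambda>x. f (?B x)) (\<epsilon> * r) (\<lambda>x. V (\<epsilon> * r) x \<omega>)
      = regularized_chaos \<gamma> \<tau>' f \<epsilon> (\<lambda>x. W \<epsilon> x \<omega>)" if \<epsilon>: "0 < \<epsilon>" and \<omega>: "\<omega> \<in> space P" for \<epsilon> \<omega>
    proof -
      define v where "v x = (\<epsilon> * r) powr (\<gamma>\<^sup>2 / 2) * exp (\<gamma> * (V (\<epsilon> * r) x \<omega> - liouville_Q \<gamma> / 2 * ln (Im \<tau>)))" for x
      define w where "w x = \<epsilon> powr (\<gamma>\<^sup>2 / 2) * exp (\<gamma> * (W \<epsilon> x \<omega> - liouville_Q \<gamma> / 2 * ln (Im \<tau>')))" for x
      have \<epsilon>r: "0 < \<epsilon> * r" using \<epsilon> r by simp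
      have vw: "Im \<tau>' * w x = Im \<tau> * v (?A x)" for x
        unfolding v_def w_def W_def \<tau>'_def r_def by (rule chaos_weight_modular_map[OF \<tau> det \<gamma> \<epsilon>])
      have "(\<integral>x. Im \<tau> * (f (?B x) * v x) \<partial>torus_lebesgue) = (\<integral>x. Im \<tau>' * (f x * w x) \<partial>torus_lebesgue)"
        using integral_torus_map[OF det, of "\<lambda>x. Im \<tau> * (f (?B x) * v x)"]
        by (simp add: torus_map_inverse'[OF det] mult.left_commute[of _ "f _"] vw)
      then show ?thesis
        unfolding regularized_chaos_eq[OF \<tau> fB V(2)[OF \<epsilon>r \<omega>]] regularized_chaos_eq[OF \<tau>'0 f cW[OF \<epsilon> \<omega>]] v_def w_def .
    qed
    have ev: "\<forall>\<^sub>F \<epsilon> in at_right 0. (0 :: real) < \<epsilon>" by (simp add: eventually_at_right_less)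
    show ?thesis
    proof (rule tendsto_in_prob_cong[OF _ _ lim])
      show "(\<integral>x. f (?B x) \<partial>measure_of_fmeas (M \<omega>)) = (\<integral>x. f x \<partial>measure_of_fmeas (pushforward (inv ?A) (M \<omega>)))" for \<omega>
        unfolding inv_torus_map[OF det]
        by (rule integral_pushforward[OF measurable_continuous_torus[OF continuous_torus_map]
              borel_measurable_continuous_onI[OF f], symmetric])
    qed (use ev in eventually_elim, use eq in blast)
  qed
  show ?thesis
    unfolding gmc_def \<tau>'_def[symmetric] regularized_chaos_def[symmetric] using 1 2 3 cW by (intro conjI exI[of _ W]) auto
qed

section \<open>Modular invariance of the Liouville law\<close>

text \<open>The infinite product converges absolutely and has no vanishing factor.\<close>

lemma dedekind_eta_nonzero:
  assumes "0 < Im \<tau>" shows "dedekind_eta \<tau> \<noteq> 0"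
proof -
  define q where "q = exp (\<i> * pi * \<tau>)"
  have q: "norm q < 1" using assms by (simp add: q_def)
  have q2: "norm (q\<^sup>2) < 1" using q by (simp add: norm_power power_less_one_iff)
  define f where "f n = 1 - q ^ (2 * (n + 1))" for n
  have "norm (f n - 1) = norm (q\<^sup>2) * norm (q\<^sup>2) ^ n" for n
  proof -
    have "q ^ (2 * (n + 1)) = q\<^sup>2 * (q\<^sup>2) ^ n" unfolding power_mult by simp
    moreover have "norm (f n - 1) = norm (q ^ (2 * (n + 1)))" unfolding f_def by (subst norm_minus_cancel[symmetric]) simp
    ultimately show ?thesis by (simp only: norm_mult norm_power)
  qed
  then have "summable (\<lambda>n. norm (f n - 1))" using q2 by (simp add: summable_geometric)
  then have "f has_prod prodinf f"
    by (intro convergent_prod_has_prod abs_convergent_prod_imp_convergent_prod summable_imp_abs_convergent_prod)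
  moreover have "f n \<noteq> 0" for n
  proof
    assume "f n = 0"
    then have "q ^ (2 * (n + 1)) = 1" by (simp add: f_def)
    then have "norm q ^ (2 * (n + 1)) = 1" by (metis norm_power norm_one)
    moreover have "norm q ^ (2 * (n + 1)) < 1" using q by (simp only: power_less_one_iff[OF norm_ge_zero]) simp
    ultimately show False by simp
  qed
  then have "0 \<notin> range f" by force
  ultimately have "prodinf f \<noteq> 0" by (simp add: has_prod_eq_0_iff)
  moreover have "dedekind_eta \<tau> = exp (\<i> * pi * \<tau> / 12) * prodinf f"
    unfolding dedekind_eta_def f_def q_def ..
  ultimately show ?thesis by simp
qed

lemma Z_FF_nonzero: "0 < Im \<tau> \<Longrightarrow> Z_FF \<tau> \<noteq> 0"
  by (simp add: Z_FF_def dedekind_eta_nonzero)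

text \<open>A set function that is not a measure induces the zero measure, so that the image under a
  bimeasurable bijection is described by the transported set function in all cases.\<close>

lemma measure_of_image:
  assumes sp: "space \<Sigma> = UNIV" and T: "T \<in> \<Sigma> \<rightarrow>\<^sub>M \<Sigma>" "T' \<in> \<Sigma> \<rightarrow>\<^sub>M \<Sigma>" and inv: "\<And>x. T (T' x) = x" "\<And>x. T' (T x) = x"
    and \<rho>: "\<And>S. S \<in> sets \<Sigma> \<Longrightarrow> \<rho>' S = \<rho> (T -` S)"
  shows "measure_of UNIV (sets \<Sigma>) \<rho>' = distr (measure_of UNIV (sets \<Sigma>) \<rho>) \<Sigma> T"
proof -
  interpret sigma_algebra UNIV "sets \<Sigma>" using sets.sigma_algebra_axioms[of \<Sigma>] by (simp add: sp)
  have pres: "measure_space UNIV (sets \<Sigma>) \<nu>'"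
    if ms: "measure_space UNIV (sets \<Sigma>) \<nu>" and R: "R \<in> \<Sigma> \<rightarrow>\<^sub>M \<Sigma>"
      and \<nu>': "\<And>S. S \<in> sets \<Sigma> \<Longrightarrow> \<nu>' S = \<nu> (R -` S)" for \<nu> \<nu>' R
  proof -
    have R': "R -` S \<in> sets \<Sigma>" if "S \<in> sets \<Sigma>" for S using measurable_sets[OF R that] by (simp add: sp)
    have \<nu>: "positive (sets \<Sigma>) \<nu>" "countably_additive (sets \<Sigma>) \<nu>" using ms by (auto simp: measure_space_def)
    have "positive (sets \<Sigma>) \<nu>'" using \<nu>(1) \<nu>'[of "{}"] by (simp add: positive_def)
    moreover have "countably_additive (sets \<Sigma>) \<nu>'"
    proof (rule countably_additiveI)
      fix S :: "nat \<Rightarrow> _" assume S: "range S \<subseteq> sets \<Sigma>" "disjoint_family S" "(\<Union>i. S i) \<in> sets \<Sigma>"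
      have "(\<Sum>i. \<nu> (R -` S i)) = \<nu> (\<Union>i. R -` S i)"
      proof (rule \<nu>(2)[unfolded countably_additive_def, rule_format])
        show "range (\<lambda>i. R -` S i) \<subseteq> sets \<Sigma>" using R' S(1) by auto
        show "disjoint_family (\<lambda>i. R -` S i)" using S(2) unfolding disjoint_family_on_def by blast
        show "(\<Union>i. R -` S i) \<in> sets \<Sigma>" using R'[OF S(3)] by (simp add: vimage_UN)
      qed
      moreover have "\<nu>' (S i) = \<nu> (R -` S i)" for i using S(1) by (intro \<nu>') auto
      ultimately show "(\<Sum>i. \<nu>' (S i)) = \<nu>' (\<Union>i. S i)" by (simp add: \<nu>'[OF S(3)] vimage_UN)
    qed
    ultimately show ?thesis using ms by (simp add: measure_space_def)
  qed
  have T'S: "T' -` S \<in> sets \<Sigma>" if "S \<in> sets \<Sigma>" for S using measurable_sets[OF T(2) that] by (simp add: sp)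
  have TS: "T -` S \<in> sets \<Sigma>" if "S \<in> sets \<Sigma>" for S using measurable_sets[OF T(1) that] by (simp add: sp)
  have "\<rho> S = \<rho>' (T' -` S)" if "S \<in> sets \<Sigma>" for S
  proof -
    have "T -` (T' -` S) = S" by (auto simp: inv)
    then show ?thesis using \<rho>[OF T'S[OF that]] by simp
  qed
  then have iff: "measure_space UNIV (sets \<Sigma>) \<rho>' \<longleftrightarrow> measure_space UNIV (sets \<Sigma>) \<rho>"
    using pres[OF _ T(1), of \<rho> \<rho>'] pres[OF _ T(2), of \<rho>' \<rho>] \<rho> by blast
  have ss: "sets (measure_of UNIV (sets \<Sigma>) \<nu>) = sets \<Sigma>" for \<nu> by simp
  show ?thesis
  proof (rule measure_eqI)
    fix S assume "S \<in> sets (measure_of UNIV (sets \<Sigma>) \<rho>')"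
    then have S: "S \<in> sets \<Sigma>" by simp
    have "T \<in> measure_of UNIV (sets \<Sigma>) \<rho> \<rightarrow>\<^sub>M \<Sigma>"
      using T(1) measurable_cong_sets[OF ss refl] by blast
    from emeasure_distr[OF this S]
    have "emeasure (distr (measure_of UNIV (sets \<Sigma>) \<rho>) \<Sigma> T) S = emeasure (measure_of UNIV (sets \<Sigma>) \<rho>) (T -` S)"
      by simp
    also have "\<dots> = (if measure_space UNIV (sets \<Sigma>) \<rho> then \<rho> (T -` S) else 0)"
      using TS[OF S] by (simp add: emeasure_measure_of_conv sigma_sets_eq)
    also have "\<dots> = emeasure (measure_of UNIV (sets \<Sigma>) \<rho>') S"
      using S by (simp add: emeasure_measure_of_conv sigma_sets_eq iff \<rho>)
    finally show "emeasure (measure_of UNIV (sets \<Sigma>) \<rho>') S = emeasure (distr (measure_of UNIV (sets \<Sigma>) \<rho>) \<Sigma> T) S"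
      by simp
  qed simp
qed

lemma measurable_H_insert:
  assumes "G \<in> borel_measurable borel"
  shows "H_insert G n z \<alpha> \<in> borel_measurable borel"
proof -
  have "(\<lambda>x. G (x - z i)) \<in> borel_measurable borel" for i
    using measurable_compose[OF measurable_continuous_torus[OF continuous_torus_minus] assms] .
  then show ?thesis unfolding H_insert_def[abs_def]
    by (intro borel_measurable_sum borel_measurable_times borel_measurable_const)
qed

text \<open>At a fixed value of the zero mode \<open>c\<close> the functional depends on the probability space only through
  the joint law of field and chaos measure: it integrates this function of the pair.\<close>

definition liouville_integrand ::
  "real \<Rightarrow> real \<Rightarrow> complex \<Rightarrow> (torus \<Rightarrow> real) \<Rightarrow> (hm1 \<times> fmeas \<Rightarrow> real) \<Rightarrow> real \<Rightarrow> hm1 \<times> fmeas \<Rightarrow> real" where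
  "liouville_integrand \<gamma> \<mu> \<tau> H F c = (\<lambda>(\<phi>, m).
     F (\<phi> + fun_hm1 (\<lambda>x. c + H x - liouville_Q \<gamma> / 2 * ln (Im \<tau>)), tilt (\<lambda>x. exp (\<gamma> * c) * exp (\<gamma> * H x)) m) *
     exp (- \<mu> * exp (\<gamma> * c) * (\<integral>x. exp (\<gamma> * H x) \<partial>measure_of_fmeas m)))"

lemma measurable_liouville_integrand:
  assumes H [measurable]: "H \<in> borel_measurable borel" and F: "F \<in> borel_measurable (borel \<Otimes>\<^sub>M borel)"
  shows "liouville_integrand \<gamma> \<mu> \<tau> H F c \<in> borel_measurable (borel \<Otimes>\<^sub>M borel)"
proof -
  have "(\<lambda>\<phi> :: hm1. \<phi> + fun_hm1 (\<lambda>x. c + H x - liouville_Q \<gamma> / 2 * ln (Im \<tau>))) \<in> borel \<rightarrow>\<^sub>M borel"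
    by (intro borel_measurable_continuous_onI continuous_intros)
  from measurable_compose[OF measurable_fst this]
  have 1: "(\<lambda>p. fst p + fun_hm1 (\<lambda>x. c + H x - liouville_Q \<gamma> / 2 * ln (Im \<tau>))) \<in> borel \<Otimes>\<^sub>M (borel :: fmeas measure) \<rightarrow>\<^sub>M borel" .
  have "tilt (\<lambda>x. exp (\<gamma> * c) * exp (\<gamma> * H x)) \<in> borel \<rightarrow>\<^sub>M borel"
    by (intro measurable_tilt) auto
  from measurable_compose[OF measurable_snd this]
  have 2: "(\<lambda>p. tilt (\<lambda>x. exp (\<gamma> * c) * exp (\<gamma> * H x)) (snd p)) \<in> (borel :: hm1 measure) \<Otimes>\<^sub>M borel \<rightarrow>\<^sub>M borel" .
  have "(\<lambda>m. \<integral>x. exp (\<gamma> * H x) \<partial>measure_of_fmeas m) \<in> borel_measurable borel"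
    by (intro measurable_fmeas_integral_borel) measurable
  from measurable_compose[OF measurable_snd this]
  have [measurable]: "(\<lambda>p. \<integral>x. exp (\<gamma> * H x) \<partial>measure_of_fmeas (snd p)) \<in> borel_measurable ((borel :: hm1 measure) \<Otimes>\<^sub>M borel)" .
  have [measurable]: "(\<lambda>p. F (fst p + fun_hm1 (\<lambda>x. c + H x - liouville_Q \<gamma> / 2 * ln (Im \<tau>)), tilt (\<lambda>x. exp (\<gamma> * c) * exp (\<gamma> * H x)) (snd p)))
      \<in> borel_measurable (borel \<Otimes>\<^sub>M borel)"
    using measurable_compose[OF measurable_Pair[OF 1 2] F] .
  show ?thesis unfolding liouville_integrand_def case_prod_unfold by measurable
qed

lemma liouville_functional_integrand:
  "liouville_functional \<gamma> \<mu> \<tau> G P X M n z \<alpha> F = Z_FF \<tau> * exp (C_insert \<gamma> \<tau> G n z \<alpha>) *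
    (\<integral>c. exp (c * (\<Sum>i<n. \<alpha> i)) * (\<integral>\<omega>. liouville_integrand \<gamma> \<mu> \<tau> (H_insert G n z \<alpha>) F c (X \<omega>, M \<omega>) \<partial>P) \<partial>lborel)"
  by (simp add: liouville_functional_def liouville_integrand_def Let_def)

text \<open>Under the change of variables the shift \<open>- Q / 2 ln Im \<tau>\<close> of the field changes by the constant
  \<open>Q ln \<bar>c\<tau> + d\<bar>\<close>, which is the one in the transformation law.\<close>

lemma liouville_integrand_modular_map:
  fixes a b c d :: int
  assumes \<tau>: "0 < Im \<tau>" and det: "a * d - b * c = 1"
    and H: "L2_functional H" and Hm: "H \<in> borel_measurable borel"
  defines "A \<equiv> torus_map a b c d"
  shows "liouville_integrand \<gamma> \<mu> (modular_map a b c d \<tau>) (\<lambda>x. H (A x)) F t (hm1_comp \<phi> A, pushforward (inv A) m)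
    = liouville_integrand \<gamma> \<mu> \<tau> H
        (\<lambda>p. F (case p of (\<phi>, m) \<Rightarrow> (hm1_comp \<phi> A + fun_hm1 (\<lambda>_. liouville_Q \<gamma> * ln (cmod (of_int c * \<tau> + of_int d))),
           pushforward (inv A) m))) t (\<phi>, m)"
proof -
  let ?r = "cmod (of_int c * \<tau> + of_int d)" and ?Q = "liouville_Q \<gamma>"
  have r: "0 < ?r" using modular_denominator_nonzero[OF \<tau> det] by simp
  have lnI: "ln (Im (modular_map a b c d \<tau>)) = ln (Im \<tau>) - 2 * ln ?r"
    unfolding Im_modular_map[OF \<tau> det] using \<tau> r by (simp add: ln_div ln_realpow)
  have shift: "t + h - ?Q / 2 * ln (Im (modular_map a b c d \<tau>)) = (h + (t - ?Q / 2 * ln (Im \<tau>))) + ?Q * ln ?r" for h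
    unfolding lnI by (simp add: algebra_simps)
  have invA: "inv A = torus_map d (- b) (- c) a" unfolding A_def by (rule inv_torus_map[OF det])
  have AB: "A (inv A x) = x" for x unfolding invA unfolding A_def by (rule torus_map_inverse[OF det])
  have cA: "continuous_on UNIV A" "continuous_on UNIV (inv A)"
    unfolding invA unfolding A_def by (rule continuous_torus_map)+
  have L: "L2_functional (\<lambda>x. H x + (t - ?Q / 2 * ln (Im \<tau>)))" by (rule L2_functional_add[OF H L2_functional_const])
  have LA: "L2_functional (\<lambda>x. H (A x) + (t - ?Q / 2 * ln (Im \<tau>)))"
    unfolding A_def
    by (rule L2_functional_bij[OF L continuous_torus_map continuous_torus_map torus_map_inverse[OF det]
          torus_map_inverse'[OF det] torus_lebesgue_torus_map[OF det]])
  have "fun_hm1 (\<lambda>x. t + H (A x) - ?Q / 2 * ln (Im (modular_map a b c d \<tau>)))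
    = fun_hm1 (\<lambda>x. H (A x) + (t - ?Q / 2 * ln (Im \<tau>))) + fun_hm1 (\<lambda>_. ?Q * ln ?r)"
    unfolding shift by (rule fun_hm1_add[OF LA L2_functional_const])
  also have "fun_hm1 (\<lambda>x. H (A x) + (t - ?Q / 2 * ln (Im \<tau>))) = hm1_comp (fun_hm1 (\<lambda>x. H x + (t - ?Q / 2 * ln (Im \<tau>)))) A"
    unfolding A_def by (rule hm1_comp_fun_hm1[OF det L, symmetric])
  also have "(\<lambda>x. H x + (t - ?Q / 2 * ln (Im \<tau>))) = (\<lambda>x. t + H x - ?Q / 2 * ln (Im \<tau>))" by auto
  finally have field: "hm1_comp \<phi> A + fun_hm1 (\<lambda>x. t + H (A x) - ?Q / 2 * ln (Im (modular_map a b c d \<tau>)))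
    = hm1_comp (\<phi> + fun_hm1 (\<lambda>x. t + H x - ?Q / 2 * ln (Im \<tau>))) A + fun_hm1 (\<lambda>_. ?Q * ln ?r)"
    by (simp add: A_def hm1_comp_add[OF det])
  have meas: "tilt (\<lambda>x. exp (\<gamma> * t) * exp (\<gamma> * H (A x))) (pushforward (inv A) m)
    = pushforward (inv A) (tilt (\<lambda>x. exp (\<gamma> * t) * exp (\<gamma> * H x)) m)"
    using pushforward_tilt[OF cA AB, of "\<lambda>x. exp (\<gamma> * t) * exp (\<gamma> * H x)" m] Hm by simp
  have "(\<lambda>x. exp (\<gamma> * H (A x))) \<in> borel_measurable borel"
    using measurable_compose[OF measurable_continuous_torus[OF cA(1)] Hm] by measurable
  from integral_pushforward[OF measurable_continuous_torus[OF cA(2)] this, of m]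
  have mass: "(\<integral>x. exp (\<gamma> * H (A x)) \<partial>measure_of_fmeas (pushforward (inv A) m)) = (\<integral>x. exp (\<gamma> * H x) \<partial>measure_of_fmeas m)"
    by (simp add: AB)
  show ?thesis unfolding liouville_integrand_def prod.case field meas mass ..
qed

theorem theorem4p9:
  fixes \<tau> \<tau>' :: complex and \<gamma> \<mu> :: real
    and n :: nat and z :: "nat \<Rightarrow> torus" and \<alpha> :: "nat \<Rightarrow> real"
    and a b c d :: int
    and G G' :: "torus \<Rightarrow> real"
    and P :: "'a measure" and X :: "'a \<Rightarrow> hm1" and M :: "'a \<Rightarrow> fmeas"
    and P' :: "'b measure" and X' :: "'b \<Rightarrow> hm1" and M' :: "'b \<Rightarrow> fmeas"
  assumes "0 < Im \<tau>" and "0 < \<gamma>" and "\<gamma> < 2" and "0 < \<mu>"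
    and "inj_on z {..<n}" and "0 < (\<Sum>i<n. \<alpha> i)" and "\<And>i. i < n \<Longrightarrow> \<alpha> i < liouville_Q \<gamma>"
    and "a * d - b * c = 1" and "\<tau>' = modular_map a b c d \<tau>"
    and "green_function \<tau> G" and "gff G P X" and "gmc \<gamma> \<tau> P X M"
    and "green_function \<tau>' G'" and "gff G' P' X'" and "gmc \<gamma> \<tau>' P' X' M'"
  shows "liouville_law \<gamma> \<mu> \<tau>' G' P' X' M' n z \<alpha> =
    distr (liouville_law \<gamma> \<mu> \<tau> G P X M n (\<lambda>i. torus_map a b c d (z i)) \<alpha>)
      (borel \<Otimes>\<^sub>M borel)
      (\<lambda>(\<phi>, m).
         (hm1_comp \<phi> (torus_map a b c d)
            + fun_hm1 (\<lambda>_. liouville_Q \<gamma> * ln (cmod (of_int c * \<tau> + of_int d))),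
          pushforward (inv (torus_map a b c d)) m))"
proof -
  note \<tau> = assms(1) and \<gamma> = assms(2) and det = assms(8) and \<tau>'_def = assms(9)
  note G = assms(10) and X = assms(11) and M = assms(12) and G' = assms(13) and X' = assms(14) and M' = assms(15)
  define A where "A = torus_map a b c d"
  define k where "k = fun_hm1 (\<lambda>_. liouville_Q \<gamma> * ln (cmod (of_int c * \<tau> + of_int d)))"
  define T where "T = (\<lambda>(\<phi>, m). (hm1_comp \<phi> A + k, pushforward (inv A) m))"
  define T' where "T' = (\<lambda>(\<phi>, m). (hm1_comp (\<phi> - k) (inv A), pushforward A m))"
  define y where "y = (\<lambda>i. A (z i))"
  have invA: "inv A = torus_map d (- b) (- c) a" unfolding A_def by (rule inv_torus_map[OF det])
  have cA: "continuous_on UNIV A" "continuous_on UNIV (inv A)"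
    unfolding invA unfolding A_def by (rule continuous_torus_map)+
  have AB: "A (inv A x) = x" "inv A (A x) = x" for x
    unfolding invA unfolding A_def by (rule torus_map_inverse[OF det] torus_map_inverse'[OF det])+
  have "(\<lambda>\<phi>. hm1_comp \<phi> A + k) \<in> borel \<rightarrow>\<^sub>M borel"
    unfolding A_def by (intro borel_measurable_continuous_onI continuous_intros continuous_hm1_comp[OF det])
  then have T: "T \<in> borel \<Otimes>\<^sub>M borel \<rightarrow>\<^sub>M borel \<Otimes>\<^sub>M borel"
    unfolding T_def case_prod_unfold
    by (intro measurable_Pair measurable_compose[OF measurable_fst] measurable_compose[OF measurable_snd]
        measurable_pushforward cA)
  have "(\<lambda>\<phi>. hm1_comp (\<phi> - k) (inv A)) \<in> borel \<rightarrow>\<^sub>M borel"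
    unfolding invA
    by (intro borel_measurable_continuous_onI continuous_on_compose2[OF continuous_hm1_comp[OF det_inverse[OF det]]]
        continuous_intros) auto
  then have T': "T' \<in> borel \<Otimes>\<^sub>M borel \<rightarrow>\<^sub>M borel \<Otimes>\<^sub>M borel"
    unfolding T'_def case_prod_unfold
    by (intro measurable_Pair measurable_compose[OF measurable_fst] measurable_compose[OF measurable_snd]
        measurable_pushforward cA)
  have comp: "hm1_comp (hm1_comp u A) (inv A) = u" "hm1_comp (hm1_comp u (inv A)) A = u" for u
    using hm1_comp_inverse[OF det, of u] hm1_comp_inverse[OF det_inverse[OF det], of u] unfolding invA unfolding A_def by simp_all
  have TT: "T (T' p) = p" "T' (T p) = p" for p
    using pushforward_inverse[OF cA(2) cA(1) AB(2)] pushforward_inverse[OF cA AB(1)]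
    by (cases p; simp add: T_def T'_def comp)+
  have GA: "G' x = G (A x)" for x
    unfolding A_def by (rule green_function_modular_map[OF \<tau> det \<tau>'_def G G'])
  have \<tau>': "0 < Im \<tau>'"
    using Im_modular_map[OF \<tau> det] modular_denominator_nonzero[OF \<tau> det] \<tau> by (simp add: \<tau>'_def)
  have law: "distr P' (borel \<Otimes>\<^sub>M borel) (\<lambda>\<omega>. (X' \<omega>, M' \<omega>))
    = distr P (borel \<Otimes>\<^sub>M borel) (\<lambda>\<omega>. (hm1_comp (X \<omega>) A, pushforward (inv A) (M \<omega>)))"
    by (rule gff_gmc_law_unique[OF \<tau>' X' M'])
      (use gff_modular_map[OF det GA[unfolded A_def] X] gmc_modular_map[OF \<tau> det \<gamma> M] in \<open>simp_all add: A_def \<tau>'_def\<close>)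
  define H where "H = H_insert G n y \<alpha>"
  have H': "H_insert G' n z \<alpha> = (\<lambda>x. H (A x))"
    by (simp add: H_def H_insert_def[abs_def] GA y_def A_def torus_map_diff)
  have HL: "L2_functional H" unfolding H_def by (rule L2_functional_H_insert[OF \<tau> G])
  have Hm: "H \<in> borel_measurable borel" unfolding H_def by (rule measurable_H_insert[OF green_function_measurable[OF G]])
  have HAm: "(\<lambda>x. H (A x)) \<in> borel_measurable borel"
    using measurable_compose[OF measurable_continuous_torus[OF cA(1)] Hm] .
  have XM: "X \<in> P \<rightarrow>\<^sub>M borel" "X' \<in> P' \<rightarrow>\<^sub>M borel" "M \<in> P \<rightarrow>\<^sub>M borel" "M' \<in> P' \<rightarrow>\<^sub>M borel"
    using X X' M M' by (auto simp: gff_def gmc_def)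
  have m': "(\<lambda>\<omega>. (X' \<omega>, M' \<omega>)) \<in> P' \<rightarrow>\<^sub>M borel \<Otimes>\<^sub>M borel" using XM by (intro measurable_Pair)
  have m: "(\<lambda>\<omega>. (hm1_comp (X \<omega>) A, pushforward (inv A) (M \<omega>))) \<in> P \<rightarrow>\<^sub>M borel \<Otimes>\<^sub>M borel"
    using borel_measurable_continuous_onI[OF continuous_hm1_comp[OF det]] measurable_pushforward[OF cA(2)]
    by (intro measurable_Pair measurable_compose[OF XM(1)] measurable_compose[OF XM(3)]) (simp_all add: A_def)
  define J where "J F = (\<integral>t. exp (t * (\<Sum>i<n. \<alpha> i)) * (\<integral>\<omega>. liouville_integrand \<gamma> \<mu> \<tau> H F t (X \<omega>, M \<omega>) \<partial>P) \<partial>lborel)" for F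
  define K where "K = Z_FF \<tau> * exp (C_insert \<gamma> \<tau> G n y \<alpha>)"
  define K' where "K' = Z_FF \<tau>' * exp (C_insert \<gamma> \<tau>' G' n z \<alpha>)"
  have K: "K \<noteq> 0" "K' \<noteq> 0" using Z_FF_nonzero \<tau> \<tau>' by (auto simp: K_def K'_def)
  have fn: "liouville_functional \<gamma> \<mu> \<tau> G P X M n y \<alpha> F = K * J F" for F
    by (simp add: liouville_functional_integrand K_def J_def H_def)
  have fn': "liouville_functional \<gamma> \<mu> \<tau>' G' P' X' M' n z \<alpha> F = K' * J (\<lambda>p. F (T p))"
    if F: "F \<in> borel_measurable (borel \<Otimes>\<^sub>M borel)" for F
  proof -
    have "(\<integral>\<omega>. liouville_integrand \<gamma> \<mu> \<tau>' (\<lambda>x. H (A x)) F t (X' \<omega>, M' \<omega>) \<partial>P')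
      = (\<integral>\<omega>. liouville_integrand \<gamma> \<mu> \<tau> H (\<lambda>p. F (T p)) t (X \<omega>, M \<omega>) \<partial>P)" for t
    proof -
      note meas = measurable_liouville_integrand[OF HAm F, of \<gamma> \<mu> \<tau>' t]
      have "(\<integral>\<omega>. liouville_integrand \<gamma> \<mu> \<tau>' (\<lambda>x. H (A x)) F t (X' \<omega>, M' \<omega>) \<partial>P')
        = (\<integral>\<omega>. liouville_integrand \<gamma> \<mu> \<tau>' (\<lambda>x. H (A x)) F t (hm1_comp (X \<omega>) A, pushforward (inv A) (M \<omega>)) \<partial>P)"
        using integral_distr[OF m' meas] integral_distr[OF m meas] law by simp
      then show ?thesis
        unfolding \<tau>'_def A_def liouville_integrand_modular_map[OF \<tau> det HL Hm] T_def k_def .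
    qed
    then show ?thesis by (simp add: liouville_functional_integrand K'_def J_def H')
  qed
  have sp: "space ((borel :: hm1 measure) \<Otimes>\<^sub>M (borel :: fmeas measure)) = UNIV" by (simp add: space_pair_measure)
  have "liouville_law \<gamma> \<mu> \<tau>' G' P' X' M' n z \<alpha> = distr (liouville_law \<gamma> \<mu> \<tau> G P X M n y \<alpha>) (borel \<Otimes>\<^sub>M borel) T"
    unfolding liouville_law_def
  proof (rule measure_of_image[OF sp T T' TT])
    fix S :: "(hm1 \<times> fmeas) set" assume S: "S \<in> sets (borel \<Otimes>\<^sub>M borel)"
    have ind: "(\<lambda>p. indicat_real S (T p)) = indicator (T -` S)" by (auto simp: indicator_def)
    show "ennreal (liouville_functional \<gamma> \<mu> \<tau>' G' P' X' M' n z \<alpha> (indicator S)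
          / liouville_functional \<gamma> \<mu> \<tau>' G' P' X' M' n z \<alpha> (\<lambda>_. 1))
      = ennreal (liouville_functional \<gamma> \<mu> \<tau> G P X M n y \<alpha> (indicator (T -` S))
          / liouville_functional \<gamma> \<mu> \<tau> G P X M n y \<alpha> (\<lambda>_. 1))"
      using fn'[OF borel_measurable_indicator[OF S]] fn'[of "\<lambda>_. 1"] K by (simp add: fn ind)
  qed
  then show ?thesis by (simp add: T_def A_def k_def y_def)
qed

end
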